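(* Let $\{f_\lambda\}$ and $\{g_\lambda\}$ each be one of the following linear bases of symmetric functions indexed by partitions: Schur functions $\{s_\lambda\}$, monomial symmetric functions $\{m_\lambda\}$, power sums $\{p_\lambda\}$, elementary symmetric functions $\{e_\lambda\}$, complete homogeneous symmetric functions $\{h_\lambda\}$. Define the plethysm coefficients $a^\lambda_{\mu\nu}$ by $f_\mu[g_\nu]=\sum_\lambda a^\lambda_{\mu\nu}s_\lambda$, where $f[g]$ denotes plethysm. Then the function $(\lambda,\mu,\nu)\mapsto a^\lambda_{\mu\nu}$ is in $\mathsf{GapP}$.
   Context: Partitions are encoded in unary. $f\in\#\mathsf{P}$ if $f(w)=\#\{u:(w,u)\in B\}$ for some polynomial-time decidable $B$ with polynomially bounded witnesses; $\mathsf{GapP}=\#\mathsf{P}-\#\mathsf{P}$. Plethysm is the standard operation on symmetric functions: if $g=\sum_i x^{\tau^{(i)}}$ is written as a sum of monomials (with multiplicity), then $f[g]=f(x^{\tau^{(1)}},x^{\tau^{(2)}},\ldots)$. *)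

theory Defs
  imports "HOL-Library.Multiset" "HOL-Library.Countable" "HOL-Computational_Algebra.Polynomial"
begin

section \<open>Polynomial time, #P and GapP\<close>

text \<open>
  Deterministic multi-tape Turing machines. States are the numbers below \<open>tm_states\<close>, tape symbols
  the numbers below \<open>tm_symbols\<close>, and 0 is the blank. An entry of the list returned by the transition
  function is the symbol to be written on that tape and the displacement of its head. Only the values
  of \<open>tm_delta\<close> on existing states and symbols are ever used, so a machine is a finite object.
\<close>

record tm =
  tm_tapes :: nat
  tm_states :: nat
  tm_symbols :: nat
  tm_start :: nat
  tm_accept :: nat
  tm_reject :: nat
  tm_delta :: "nat \<Rightarrow> nat list \<Rightarrow> nat \<times> (nat \<times> int) list"

definition wf_tm :: "tm \<Rightarrow> bool" where
  "wf_tm M \<longleftrightarrow>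
     tm_tapes M \<ge> 1 \<and> tm_symbols M \<ge> 4 \<and>
     tm_start M < tm_states M \<and> tm_accept M < tm_states M \<and> tm_reject M < tm_states M \<and>
     tm_accept M \<noteq> tm_reject M \<and>
     (\<forall>q syms. q < tm_states M \<and> length syms = tm_tapes M \<and> (\<forall>a \<in> set syms. a < tm_symbols M) \<longrightarrow>
        (case tm_delta M q syms of (q', acts) \<Rightarrow>
           q' < tm_states M \<and> length acts = tm_tapes M \<and>
           (\<forall>(a, d) \<in> set acts. a < tm_symbols M \<and> d \<in> {-1, 0, 1})))"

text \<open>A tape is infinite in both directions; it comes with the position of its head.\<close>

type_synonym tape = "(int \<Rightarrow> nat) \<times> int"
type_synonym config = "nat \<times> tape list"

definition tape_read :: "tape \<Rightarrow> nat" where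
  "tape_read t = fst t (snd t)"

definition tape_act :: "nat \<times> int \<Rightarrow> tape \<Rightarrow> tape" where
  "tape_act ad t = ((fst t)(snd t := fst ad), snd t + snd ad)"

definition tm_step :: "tm \<Rightarrow> config \<Rightarrow> config" where
  "tm_step M c =
     (if fst c = tm_accept M \<or> fst c = tm_reject M then c
      else let (q', acts) = tm_delta M (fst c) (map tape_read (snd c))
           in (q', map2 tape_act acts (snd c)))"

definition tm_init :: "tm \<Rightarrow> nat list \<Rightarrow> config" where
  "tm_init M x =
     (tm_start M,
      (\<lambda>i. if 0 \<le> i \<and> i < int (length x) then x ! nat i else 0, 0) #
      replicate (tm_tapes M - 1) (\<lambda>_. 0, 0))"

text \<open>A pair of binary words is presented to a machine as \<open>w # u\<close>, the separator being the symbol 3.\<close>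

definition pair_input :: "bool list \<Rightarrow> bool list \<Rightarrow> nat list" where
  "pair_input w u = (let bit = (\<lambda>b. if b then 2 else 1) in map bit w @ [3] @ map bit u)"

definition poly_time_decidable :: "(bool list \<times> bool list) set \<Rightarrow> bool" where
  "poly_time_decidable B \<longleftrightarrow>
     (\<exists>M (p :: nat poly). wf_tm M \<and>
        (\<forall>w u. \<exists>t \<le> poly p (length (pair_input w u)).
           fst ((tm_step M ^^ t) (tm_init M (pair_input w u))) =
             (if (w, u) \<in> B then tm_accept M else tm_reject M)))"

definition sharpP :: "(bool list \<Rightarrow> nat) set" where
  "sharpP = {f. \<exists>B (p :: nat poly).
     poly_time_decidable B \<and>
     (\<forall>(w, u) \<in> B. length u \<le> poly p (length w)) \<and>
     (\<forall>w. f w = card {u. (w, u) \<in> B})}"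

definition GapP :: "(bool list \<Rightarrow> int) set" where
  "GapP = {f. \<exists>g \<in> sharpP. \<exists>h \<in> sharpP. \<forall>w. f w = int (g w) - int (h w)}"

text \<open>Membership in GapP of a function on a set \<open>D\<close> of objects that are encoded as binary words.\<close>

definition in_GapP_on :: "('a \<Rightarrow> bool list) \<Rightarrow> 'a set \<Rightarrow> ('a \<Rightarrow> int) \<Rightarrow> bool" where
  "in_GapP_on enc D f \<longleftrightarrow> (\<exists>F \<in> GapP. \<forall>x \<in> D. F (enc x) = f x)"


section \<open>Partitions\<close>

definition is_partition :: "nat list \<Rightarrow> bool" where
  "is_partition la \<longleftrightarrow> sorted_wrt (\<ge>) la \<and> 0 \<notin> set la"

text \<open>
  Unary encoding: every part \<open>k\<close> becomes \<open>1^k 0\<close>, and a further 0 ends the partition. Since parts are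
  positive, the code of a triple can be decoded uniquely.
\<close>

definition unary_partition :: "nat list \<Rightarrow> bool list" where
  "unary_partition la = concat (map (\<lambda>k. replicate k True @ [False]) la) @ [False]"

definition unary_triple :: "nat list \<times> nat list \<times> nat list \<Rightarrow> bool list" where
  "unary_triple = (\<lambda>(la, mu, nu). unary_partition la @ unary_partition mu @ unary_partition nu)"


section \<open>Symmetric functions\<close>

text \<open>
  Formal power series over the integers in the variables \<open>x_0, x_1, \<dots>\<close>, given by their coefficients.
  The multiset \<open>A\<close> stands for the monomial \<open>\<Prod>i\<in>#A. x_i\<close>, so that \<open>count A i\<close> is the exponent of
  \<open>x_i\<close>, and the product of two monomials is the sum of the multisets.
\<close>

type_synonym series = "nat multiset \<Rightarrow> int"

definition series_one :: series where
  "series_one A = (if A = {#} then 1 else 0)"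

definition series_mult :: "series \<Rightarrow> series \<Rightarrow> series" where
  "series_mult F G A = (\<Sum>B | B \<subseteq># A. F B * G (A - B))"

definition series_prod :: "series list \<Rightarrow> series" where
  "series_prod Fs = foldr series_mult Fs series_one"

definition elementary_n :: "nat \<Rightarrow> series" where
  "elementary_n r A = (if size A = r \<and> (\<forall>i. count A i \<le> 1) then 1 else 0)"

definition homogeneous_n :: "nat \<Rightarrow> series" where
  "homogeneous_n r A = (if size A = r then 1 else 0)"

text \<open>Used for \<open>r > 0\<close> only.\<close>

definition power_sum_n :: "nat \<Rightarrow> series" where
  "power_sum_n r A = (if \<exists>i. A = replicate_mset r i then 1 else 0)"

definition elementary :: "nat list \<Rightarrow> series" where
  "elementary la = series_prod (map elementary_n la)"

definition homogeneous :: "nat list \<Rightarrow> series" where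
  "homogeneous la = series_prod (map homogeneous_n la)"

definition power_sum :: "nat list \<Rightarrow> series" where
  "power_sum la = series_prod (map power_sum_n la)"

text \<open>The multiset on the left consists of the nonzero exponents of the monomial.\<close>

definition monomial :: "nat list \<Rightarrow> series" where
  "monomial la A = (if image_mset (count A) (mset_set (set_mset A)) = mset la then 1 else 0)"

text \<open>Semistandard Young tableaux, as lists of rows (English convention).\<close>

definition ssyt :: "nat list \<Rightarrow> nat list list \<Rightarrow> bool" where
  "ssyt la T \<longleftrightarrow> map length T = la \<and> (\<forall>row \<in> set T. sorted row) \<and>
     (\<forall>i j. Suc i < length T \<and> j < length (T ! Suc i) \<longrightarrow> T ! i ! j < T ! Suc i ! j)"

definition schur :: "nat list \<Rightarrow> series" where
  "schur la A = int (card {T. ssyt la T \<and> mset (concat T) = A})"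


section \<open>Plethysm\<close>

instance multiset :: (countable) countable
proof
  have "inj (\<lambda>A. to_nat (SOME xs. mset xs = (A :: 'a multiset)))"
    by (rule injI) (metis (mono_tags, lifting) ex_mset from_nat_to_nat someI_ex)
  then show "\<exists>f :: 'a multiset \<Rightarrow> nat. inj f"
    by blast
qed

text \<open>
  For \<open>g\<close> with nonnegative coefficients, the \<open>j\<close>-th copy of a monomial \<open>\<tau>\<close> of \<open>g\<close>, \<open>j < g \<tau>\<close>, is
  substituted for the variable of \<open>f\<close> with index \<open>to_nat (\<tau>, j)\<close>; the variables of \<open>f\<close> whose index
  does not arise in this way (\<open>None\<close>) are set to 0. For symmetric \<open>f\<close> it is immaterial which variable
  receives which monomial.
\<close>

definition monomial_at :: "series \<Rightarrow> nat \<Rightarrow> nat multiset option" where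
  "monomial_at g n =
     (if \<exists>\<tau> j. n = to_nat (\<tau> :: nat multiset, j :: nat) \<and> int j < g \<tau>
      then Some (fst (from_nat n :: nat multiset \<times> nat)) else None)"

text \<open>
  The coefficient of the monomial \<open>A\<close>. The sum is finite if \<open>f\<close> has bounded degree; the restriction to
  \<open>f C \<noteq> 0\<close> is needed for this when \<open>g\<close> has a nonzero constant term.
\<close>

definition plethysm :: "series \<Rightarrow> series \<Rightarrow> series" where
  "plethysm f g A =
     (\<Sum>C | f C \<noteq> 0 \<and> (\<forall>n \<in># C. monomial_at g n \<noteq> None) \<and>
            (\<Sum>n \<in># C. the (monomial_at g n)) = A. f C)"

definition schur_expansion :: "series \<Rightarrow> (nat list \<Rightarrow> int) \<Rightarrow> bool" where
  "schur_expansion F c \<longleftrightarrow>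
     finite {la. c la \<noteq> 0} \<and> (\<forall>la. c la \<noteq> 0 \<longrightarrow> is_partition la) \<and>
     (\<forall>A. F A = (\<Sum>la | c la \<noteq> 0. c la * schur la A))"

definition plethysm_coeff ::
    "(nat list \<Rightarrow> series) \<Rightarrow> (nat list \<Rightarrow> series) \<Rightarrow> nat list \<Rightarrow> nat list \<Rightarrow> nat list \<Rightarrow> int" where
  "plethysm_coeff f g la mu nu = (THE c. schur_expansion (plethysm (f mu) (g nu)) c) la"

end

theory Submission
  imports Defs "Jordan_Normal_Form.Determinant" "HOL-Library.Poly_Mapping"
    "HOL-Library.Multiset_Order" "HOL-Library.List_Lexorder"
begin

text \<open>
  Let \<open>n\<close> be the number of parts of \<open>\<lambda>\<close> and \<open>V = \<Prod>i<j<n. (x i - x j)\<close>. The bialternant identity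
  \<open>V * s \<mu> = det (x i ^ (\<mu> j + n - 1 - j))\<close>, proved by induction on \<open>n\<close> with the branching rule, shows
  that the coefficient of \<open>s \<lambda>\<close> in a symmetric function \<open>F\<close> is the coefficient of
  \<open>x ^ (\<lambda> + \<delta>)\<close> in \<open>V * F\<close>. Expanding \<open>V\<close> turns this into a signed sum over the choices of one term in
  each factor \<open>x i - x j\<close>.

  Each of the five bases counts fillings of a diagram that satisfy local conditions on the order of the
  entries. As \<open>f\<close> is symmetric, its variables may be replaced by the fillings that \<open>g\<close> counts, ordered
  lexicographically. Hence a coefficient of \<open>f[g]\<close> is a number of fillings by fillings, and the plethysm
  coefficient is the number of such objects with an even choice in \<open>V\<close> minus those with an odd one.

  Being unary, all numbers involved are polynomially bounded, so the condition on a witness can be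
  written as a term with bounded sums over positions of the input. A Turing machine evaluates such a
  term in polynomial time using the positions of its heads as counters.
\<close>

subsection \<open>Alternants and Schur polynomials\<close>

text \<open>Two obstacles shape the proof. The coefficient is a definite description over infinite
  series, so a Schur expansion of \<open>f[g]\<close> has to exist and be unique before it can be
  computed. This takes the symmetry of the bases and of plethysm, and the symmetry of Schur
  functions is itself drawn from the bialternant identity. Moreover, the definition of plethysm
  hands monomials to the variables of \<open>f\<close> by an unspecified numbering. Symmetry
  replaces it by a lexicographic order, which can be tested entry by entry.

  Working with as many variables as \<open>la\<close> has parts loses nothing: the Vandermonde
  product and the monomial to be extracted involve only these, and a Schur function with more rows
  vanishes on them. The same number bounds the entries of the inner fillings and so keeps witnesses
  short.

  All five bases have nonnegative coefficients, so signs come from the Vandermonde product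
  alone.\<close>

definition alternant :: "nat \<Rightarrow> (nat \<Rightarrow> nat) \<Rightarrow> (nat \<Rightarrow> 'a :: comm_ring_1) \<Rightarrow> 'a" where
  "alternant n l x = det (mat n n (\<lambda>(i, j). x i ^ l j))"

lemma alternant_eq:
  "alternant n l x = (\<Sum>p | p permutes {0..<n}. signof p * (\<Prod>j<n. x (p j) ^ l j))"
  unfolding alternant_def
proof (subst det_col[of _ n])
  show "(\<Sum>p | p permutes {0..<n}. signof p * (\<Prod>j<n. mat n n (\<lambda>(i, j). x i ^ l j) $$ (p j, j))) =
    (\<Sum>p | p permutes {0..<n}. signof p * (\<Prod>j<n. x (p j) ^ l j))"
  proof (intro sum.cong refl arg_cong2[where f = "(*)"] prod.cong)
    fix p j assume "p \<in> {p. p permutes {0..<n}}" "j \<in> {..<n}"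
    then have "p j < n" "j < n" using permutes_in_image[of p "{0..<n}" j] by auto
    then show "mat n n (\<lambda>(i, j). x i ^ l j) $$ (p j, j) = x (p j) ^ l j" by simp
  qed
qed simp

text \<open>
  Subtracting \<open>x n ^ (l j - l (Suc j))\<close> times column \<open>Suc j\<close> from column \<open>j\<close> clears the last row and
  makes row \<open>i\<close> divisible by \<open>x i - x n\<close>; the quotients are geometric sums.
\<close>

lemma alternant_Suc:
  fixes x :: "nat \<Rightarrow> 'a :: comm_ring_1"
  assumes l: "\<And>j. j < n \<Longrightarrow> l (Suc j) \<le> l j"
  shows "alternant (Suc n) l x = x n ^ l n * (\<Prod>i<n. x i - x n) *
    (\<Sum>m \<in> PiE {..<n} (\<lambda>j. {l (Suc j)..<l j}). (\<Prod>j<n. x n ^ (l j - 1 - m j)) * alternant n m x)"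
proof -
  define M where "M = mat (Suc n) (Suc n) (\<lambda>(i, j). x i ^ l j)"
  define c where "c = (\<lambda>j. x n ^ (l j - l (Suc j)))"
  define U where "U = mat (Suc n) (Suc n) (\<lambda>(k, j). if k = j then 1 else if k
      = Suc j then - c j else 0)"
  define N where "N = mat (Suc n) (Suc n) (\<lambda>(i, j). x i ^ l j - (if j < n then c j * x i ^ l (Suc
      j) else 0))"
  define Q where "Q = (\<lambda>i j. \<Sum>m \<in> {l (Suc j)..<l j}. x i ^ m * x n ^ (l j - 1 - m))"
  have MU: "M * U = N"
  proof (rule eq_matI)
    fix i j assume "i < dim_row N" "j < dim_col N"
    then have ij: "i < Suc n" "j < Suc n" by (auto simp: N_def)
    have "(M * U) $$ (i, j) = (\<Sum>k\<in>{0..<Suc n}. x i ^ l k * (if k = j then 1 else if k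
        = Suc j then - c j else 0))"
      using ij by (simp add: M_def U_def scalar_prod_def)
    also have "\<dots> = (\<Sum>k\<in>{0..<Suc n}. (if k = j then x i ^ l j else 0) +
        (if k = Suc j then - c j * x i ^ l (Suc j) else 0))"
      by (intro sum.cong) auto
    also have "\<dots> = N $$ (i, j)"
      using ij by (subst sum.distrib, subst (1 2) sum.delta) (auto simp: N_def)
    finally show "(M * U) $$ (i, j) = N $$ (i, j)" .
  qed (auto simp: M_def U_def N_def)
  have "det U = prod_list (diag_mat U)"
    by (rule det_lower_triangular[of "Suc n"]) (auto simp: U_def)
  also have "\<dots> = 1"
    by (simp add: prod_list_diag_prod U_def)
  finally have "det M = det N"
    using det_mult[of M "Suc n" U] MU by (simp add: M_def U_def)
  also have "det N = (\<Sum>j<Suc n. N $$ (n, j) * cofactor N n j)"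
    by (rule laplace_expansion_row) (auto simp: N_def)
  also have "\<dots> = N $$ (n, n) * cofactor N n n"
  proof -
    have "N $$ (n, j) = 0" if "j < n" for j
      using that l[OF that] by (simp add: N_def c_def flip: power_add)
    then show ?thesis by (simp add: lessThan_Suc)
  qed
  also have "N $$ (n, n) = x n ^ l n" by (simp add: N_def)
  also have "cofactor N n n = det (mat n n (\<lambda>(i, j). (x i - x n) * Q i j))"
  proof -
    have "mat_delete N n n = mat n n (\<lambda>(i, j). (x i - x n) * Q i j)"
    proof (rule eq_matI)
      fix i j assume "i < dim_row (mat n n (\<lambda>(i, j). (x i - x n) * Q i j))"
        "j < dim_col (mat n n (\<lambda>(i, j). (x i - x n) * Q i j))"
      then have ij: "i < n" "j < n" by auto
      define d where "d = l j - l (Suc j)"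
      have lj: "l j = l (Suc j) + d" using l[OF ij(2)] by (simp add: d_def)
      have "Q i j = (\<Sum>k<d. x i ^ (l (Suc j) + k) * x n ^ (d - Suc k))"
        unfolding Q_def lj
        by (rule sum.reindex_bij_witness[of _ "\<lambda>k. l (Suc j) + k" "\<lambda>m. m - l (Suc j)"])
           (auto simp: add.commute)
      also have "\<dots> = x i ^ l (Suc j) * (\<Sum>k<d. x n ^ (d - Suc k) * x i ^ k)"
        by (simp add: sum_distrib_left power_add algebra_simps)
      finally have "(x i - x n) * Q i j = x i ^ l (Suc j) * ((x i - x n) *
          (\<Sum>k<d. x n ^ (d - Suc k) * x i ^ k))"
        by (simp add: algebra_simps)
      also have "\<dots> = x i ^ l (Suc j) * (x i ^ d - x n ^ d)"
        by (subst power_diff_sumr2) simp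
      also have "\<dots> = x i ^ l j - c j * x i ^ l (Suc j)"
        by (simp add: c_def lj power_add algebra_simps)
      finally show "mat_delete N n n $$ (i, j) = mat n n (\<lambda>(i, j). (x i - x n) * Q i j) $$ (i, j)"
        using ij by (simp add: mat_delete_def N_def)
    qed (auto simp: mat_delete_def N_def)
    then show ?thesis by (simp add: cofactor_def)
  qed
  also have "\<dots> = (\<Sum>p | p permutes {0..<n}. signof p * (\<Prod>j<n. (x (p j) - x n) * Q (p j) j))"
  proof (subst det_col[of _ n])
    show "(\<Sum>p | p permutes {0..<n}. signof p * (\<Prod>j<n. mat n n
        (\<lambda>(i, j). (x i - x n) * Q i j) $$ (p j, j))) =
      (\<Sum>p | p permutes {0..<n}. signof p * (\<Prod>j<n. (x (p j) - x n) * Q (p j) j))"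
    proof (intro sum.cong refl arg_cong2[where f = "(*)"] prod.cong)
      fix p j assume "p \<in> {p. p permutes {0..<n}}" "j \<in> {..<n}"
      then have "p j < n" "j < n" using permutes_in_image[of p "{0..<n}" j] by auto
      then show "mat n n (\<lambda>(i, j). (x i - x n) * Q i j) $$ (p j, j) = (x (p j) - x n) * Q (p j) j"
        by simp
    qed
  qed simp
  also have "\<dots> = (\<Sum>p | p permutes {0..<n}. (\<Prod>i<n. x i - x n) *
      (\<Sum>m \<in> PiE {..<n} (\<lambda>j. {l (Suc j)..<l j}).
        (\<Prod>j<n. x n ^ (l j - 1 - m j)) * (signof p * (\<Prod>j<n. x (p j) ^ m j))))"
  proof (intro sum.cong refl)
    fix p assume "p \<in> {p. p permutes {0..<n}}"
    then have p: "p permutes {..<n}" by (simp add: lessThan_atLeast0)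
    \<comment> \<open>A permutation only reorders the factors \<open>x i - x n\<close>, so their
      product can be pulled out of the sum over permutations.\<close>
    have 1: "(\<Prod>j<n. x (p j) - x n) = (\<Prod>i<n. x i - x n)"
      using prod.permute[OF p, of "\<lambda>i. x i - x n"] by (simp add: comp_def)
    \<comment> \<open>One summand is picked in every column; the picks form an exponent vector
      \<open>m\<close> with \<open>l (Suc j) \<le> m j < l j\<close>.\<close>
    have 2: "(\<Prod>j<n. Q (p j) j) = (\<Sum>m \<in> PiE {..<n} (\<lambda>j. {l (Suc j)..<l j}).
        (\<Prod>j<n. x (p j) ^ m j * x n ^ (l j - 1 - m j)))"
      unfolding Q_def by (rule prod_sum_PiE) auto
    show "signof p * (\<Prod>j<n. (x (p j) - x n) * Q (p j) j) = (\<Prod>i<n. x i - x n) *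
      (\<Sum>m \<in> PiE {..<n} (\<lambda>j. {l (Suc j)..<l j}).
        (\<Prod>j<n. x n ^ (l j - 1 - m j)) * (signof p * (\<Prod>j<n. x (p j) ^ m j)))"
      unfolding prod.distrib 1 2 by (simp add: sum_distrib_left ac_simps)
  qed
  also have "\<dots> = (\<Prod>i<n. x i - x n) * (\<Sum>m \<in> PiE {..<n} (\<lambda>j. {l (Suc j)..<l j}).
        (\<Prod>j<n. x n ^ (l j - 1 - m j)) * alternant n m x)"
    unfolding sum_distrib_left[symmetric]
    by (subst sum.swap) (simp add: alternant_eq sum_distrib_left)
  finally show ?thesis
    by (simp add: alternant_def M_def mult.assoc)
qed

text \<open>One step of a Gelfand-Tsetlin pattern: \<open>mu / nu\<close> is a horizontal strip.
  Lists keep trailing zeros, so that their length is the number of variables.\<close>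

definition interlacing :: "nat \<Rightarrow> nat list \<Rightarrow> nat list set" where
  "interlacing n mu = {nu. length nu = n \<and> (\<forall>j<n. mu ! Suc j \<le> nu ! j \<and> nu ! j \<le> mu ! j)}"

lemma interlacing_decreasing:
  assumes "length mu = Suc n" "sorted_wrt (\<ge>) mu" "nu \<in> interlacing n mu"
  shows "sorted_wrt (\<ge>) nu"
  unfolding sorted_wrt_iff_nth_less
proof (intro allI impI)
  fix i j assume "i < j" "j < length nu"
  then have "nu ! j \<le> mu ! j" "mu ! j \<le> mu ! Suc i" "mu ! Suc i \<le> nu ! i"
    using assms sorted_wrt_nth_less[of "(\<ge>)" mu "Suc i" j]
    by (auto simp: interlacing_def) (metis Suc_lessI order_refl less_SucI)
  then show "nu ! j \<le> nu ! i" by simp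
qed

text \<open>The Schur polynomial in \<open>n\<close> variables, by the branching rule.\<close>

fun schur_poly :: "nat \<Rightarrow> (nat \<Rightarrow> 'a :: comm_ring_1) \<Rightarrow> nat list \<Rightarrow> 'a" where
  "schur_poly 0 x mu = 1"
| "schur_poly (Suc n) x mu =
     (\<Sum>nu \<in> interlacing n mu. x n ^ (sum_list mu - sum_list nu) * schur_poly n x nu)"

definition pairs :: "nat \<Rightarrow> (nat \<times> nat) set" where
  "pairs n = {(i, j). i < j \<and> j < n}"

lemma finite_pairs [simp]: "finite (pairs n)"
  by (rule finite_subset[where B = "{..<n} \<times> {..<n}"]) (auto simp: pairs_def)

lemma prod_pairs_Suc:
  "(\<Prod>(i, j) \<in> pairs (Suc n). f i j) = (\<Prod>(i, j) \<in> pairs n. f i j) * (\<Prod>i<n. f i n)"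
proof -
  have *: "pairs (Suc n) = pairs n \<union> (\<lambda>i. (i, n)) ` {..<n}"
    by (auto simp: pairs_def)
  have "(\<Prod>(i, j) \<in> pairs (Suc n). f i j) =
      (\<Prod>(i, j) \<in> pairs n. f i j) * (\<Prod>(i, j) \<in> (\<lambda>i. (i, n)) ` {..<n}. f i j)"
    unfolding * by (rule prod.union_disjoint) (simp_all, auto simp: pairs_def)
  also have "(\<Prod>(i, j) \<in> (\<lambda>i. (i, n)) ` {..<n}. f i j) = (\<Prod>i<n. f i n)"
    by (subst prod.reindex) (auto simp: inj_on_def)
  finally show ?thesis .
qed

text \<open>The exponent vectors \<open>m\<close> in \<open>alternant_Suc\<close> are the shapes of
  the branching rule after the shift \<open>m j = nu ! j + (n - 1 - j)\<close>. With one variable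
  fewer the shift drops by one, which turns the half-open intervals for \<open>m\<close> into the
  closed interlacing conditions for \<open>nu\<close>.\<close>

theorem alternant_schur_poly:
  assumes "length mu = n" "sorted_wrt (\<ge>) mu"
  shows "alternant n (\<lambda>j. mu ! j + (n - 1 - j)) x = (\<Prod>(i, j) \<in> pairs n. x i - x j) * schur_poly n
      x mu"
  using assms
proof (induction n arbitrary: mu)
  case 0
  have "alternant 0 l x = 1" for l by (simp add: alternant_def)
  then show ?case by (simp add: pairs_def)
next
  case (Suc n)
  define l where "l = (\<lambda>j. mu ! j + (n - j))"
  have mono: "mu ! Suc j \<le> mu ! j" if "j < n" for j
    using Suc.prems sorted_wrt_nth_less[of "(\<ge>)" mu j "Suc j"] that by simp
  have l: "l (Suc j) \<le> l j" if "j < n" for j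
    using mono[OF that] by (simp add: l_def)
  have sum_mu: "sum_list mu = (\<Sum>j<n. mu ! j) + mu ! n"
    using Suc.prems(1) by (simp add: sum_list_sum_nth lessThan_atLeast0)
  have "x n ^ l n * (\<Sum>m \<in> PiE {..<n} (\<lambda>j. {l (Suc j)..<l j}). (\<Prod>j<n. x n ^ (l j - 1 - m j)) *
      alternant n m x)
      = (\<Sum>nu \<in> interlacing n mu. x n ^ (sum_list mu - sum_list nu) *
          alternant n (\<lambda>j. nu ! j + (n - 1 - j)) x)"
    unfolding sum_distrib_left
  proof (rule sum.reindex_bij_witness[of _
        "\<lambda>nu. \<lambda>j\<in>{..<n}. nu ! j + (n - 1 - j)" "\<lambda>m. map (\<lambda>j. m j - (n - 1 - j)) [0..<n]"])
    fix m assume m: "m \<in> PiE {..<n} (\<lambda>j. {l (Suc j)..<l j})"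
    let ?nu = "map (\<lambda>j. m j - (n - 1 - j)) [0..<n]"
    have mj: "mu ! Suc j + (n - 1 - j) \<le> m j" "m j < mu ! j + (n - j)" if "j < n" for j
      using PiE_mem[OF m, of j] that by (auto simp: l_def)
    have eq: "?nu ! j + (n - 1 - j) = m j" if "j < n" for j
      using mj[OF that] that by simp
    show "(\<lambda>j\<in>{..<n}. ?nu ! j + (n - 1 - j)) = m"
      using PiE_arb[OF m] eq by (auto simp: fun_eq_iff restrict_def)
    have nu: "mu ! Suc j \<le> ?nu ! j" "?nu ! j \<le> mu ! j" if "j < n" for j
      using mj[OF that] that by simp_all
    then show "?nu \<in> interlacing n mu"
      by (simp add: interlacing_def)
    have "alternant n (\<lambda>j. ?nu ! j + (n - 1 - j)) x = alternant n m x"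
      unfolding alternant_eq using eq by (intro sum.cong arg_cong2[where f =
          "(*)"] prod.cong refl) simp
    \<comment> \<open>The last variable carries the boxes of \<open>mu\<close> that are missing in
      \<open>nu\<close>. Row by row these are the exponents left over in the geometric sums, and
      \<open>l n = mu ! n\<close> is the whole last row.\<close>
    moreover have "x n ^ (sum_list mu - sum_list ?nu) = x n ^ l n * (\<Prod>j<n. x n ^ (l j - 1 - m j))"
    proof -
      have "sum_list ?nu = (\<Sum>j<n. ?nu ! j)"
        by (simp add: sum_list_sum_nth lessThan_atLeast0)
      moreover have "(\<Sum>j<n. mu ! j) = (\<Sum>j<n. ?nu ! j) + (\<Sum>j<n. mu ! j - ?nu ! j)"
        unfolding sum.distrib[symmetric] using nu by (intro sum.cong) auto
      moreover have "(\<Sum>j<n. mu ! j - ?nu ! j) = (\<Sum>j<n. l j - 1 - m j)"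
      proof (intro sum.cong refl)
        fix j assume "j \<in> {..<n}"
        then have "j < n" by simp
        then show "mu ! j - ?nu ! j = l j - 1 - m j"
          using mj[of j] by (simp add: l_def)
      qed
      ultimately have "sum_list mu - sum_list ?nu = l n + (\<Sum>j<n. l j - 1 - m j)"
        by (simp add: sum_mu l_def)
      then show ?thesis by (simp only: power_add power_sum)
    qed
    ultimately show "x n ^ (sum_list mu - sum_list ?nu) * alternant n (\<lambda>j. ?nu ! j
        + (n - 1 - j)) x =
      x n ^ l n * ((\<Prod>j<n. x n ^ (l j - 1 - m j)) * alternant n m x)"
      by (simp add: mult.assoc)
  next
    fix nu assume nu: "nu \<in> interlacing n mu"
    then show "map (\<lambda>j. (\<lambda>j\<in>{..<n}. nu ! j + (n - 1 - j)) j - (n - 1 - j)) [0..<n] = nu"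
      by (intro nth_equalityI) (auto simp: interlacing_def)
    show "(\<lambda>j\<in>{..<n}. nu ! j + (n - 1 - j)) \<in> PiE {..<n} (\<lambda>j. {l (Suc j)..<l j})"
    proof (rule PiE_I)
      fix j assume "j \<in> {..<n}"
      then have "j < n" "mu ! Suc j \<le> nu ! j" "nu ! j \<le> mu ! j"
        using nu by (auto simp: interlacing_def)
      then show "(\<lambda>j\<in>{..<n}. nu ! j + (n - 1 - j)) j \<in> {l (Suc j)..<l j}"
        by (auto simp: l_def)
    qed simp
  qed
  also have "\<dots> = (\<Sum>nu \<in> interlacing n mu. x n ^ (sum_list mu - sum_list nu) *
          ((\<Prod>(i, j) \<in> pairs n. x i - x j) * schur_poly n x nu))"
  proof (intro sum.cong refl arg_cong2[where f = "(*)"] Suc.IH)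
    fix nu assume nu: "nu \<in> interlacing n mu"
    then show "length nu = n" by (simp add: interlacing_def)
    show "sorted_wrt (\<ge>) nu"
      using Suc.prems nu by (rule interlacing_decreasing)
  qed
  also have "\<dots> = (\<Prod>(i, j) \<in> pairs n. x i - x j) * schur_poly (Suc n) x mu"
    by (simp add: sum_distrib_left mult.left_commute)
  finally have "x n ^ l n * (\<Sum>m \<in> PiE {..<n} (\<lambda>j. {l (Suc j)..<l j}). (\<Prod>j<n. x n ^ (l j - 1 - m
      j)) * alternant n m x)
      = (\<Prod>(i, j) \<in> pairs n. x i - x j) * schur_poly (Suc n) x mu" (is "_ * ?S = _") .
  moreover have "alternant (Suc n) l x = x n ^ l n * ?S * (\<Prod>i<n. x i - x n)"
    using alternant_Suc[of n l x, OF l] by (simp only: mult.assoc mult.commute mult.left_commute)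
  ultimately have "alternant (Suc n) l x =
      ((\<Prod>(i, j) \<in> pairs n. x i - x j) * schur_poly (Suc n) x mu) * (\<Prod>i<n. x i - x n)"
    by simp
  also have "\<dots> = (\<Prod>(i, j) \<in> pairs (Suc n). x i - x j) * schur_poly (Suc n) x mu"
    unfolding prod_pairs_Suc by (simp only: mult.assoc mult.commute mult.left_commute)
  finally show ?case by (simp add: l_def)
qed

section \<open>Schur polynomials as sums over tableaux\<close>

lemma finite_fillings:
  assumes "finite X"
  shows "finite {T. map length T = mu \<and> set (concat T) \<subseteq> X}"
proof -
  let ?R = "{r. set r \<subseteq> X \<and> length r \<le> sum_list mu}"
  have "{T. map length T = mu \<and> set (concat T) \<subseteq> X} \<subseteq> {T. set T \<subseteq> ?R \<and> length T = length mu}"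
    by (auto intro: member_le_sum_list)
  moreover have "finite ?R" using assms by (rule finite_lists_length_le)
  ultimately show ?thesis
    using finite_lists_length_eq finite_subset by blast
qed

definition ssyts :: "nat \<Rightarrow> nat list \<Rightarrow> nat list list set" where
  "ssyts n mu = {T. ssyt mu T \<and> set (concat T) \<subseteq> {..<n}}"

lemma finite_ssyts [simp]: "finite (ssyts n mu)"
  by (rule finite_subset[OF _ finite_fillings[of "{..<n}" mu]]) (auto simp: ssyts_def ssyt_def)

lemma finite_interlacing [simp]: "finite (interlacing n mu)"
proof -
  let ?M = "Max (insert 0 (set mu \<union> {mu ! j | j. j < n}))"
  have "interlacing n mu \<subseteq> {nu. set nu \<subseteq> {..?M} \<and> length nu = n}"
  proof
    fix nu assume nu: "nu \<in> interlacing n mu"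
    have "nu ! j \<le> ?M" if "j < n" for j
      using nu that by (intro order_trans[OF _ Max_ge[of _ "mu ! j"]]) (auto simp: interlacing_def)
    then show "nu \<in> {nu. set nu \<subseteq> {..?M} \<and> length nu = n}"
      using nu by (auto simp: interlacing_def in_set_conv_nth)
  qed
  then show ?thesis using finite_lists_length_eq finite_subset by blast
qed

text \<open>Column strictness adds at least one per row. This forces the last of
  \<open>n + 1\<close> rows over the letters up to \<open>n\<close> to be constant, and it excludes
  tableaux with more rows than letters.\<close>

lemma ssyt_entry_ge:
  assumes "ssyt mu T" "sorted_wrt (\<ge>) mu" "i < length T" "j < length (T ! i)"
  shows "i \<le> T ! i ! j"
  using assms(3,4)
proof (induction i)
  case (Suc i)
  have mu: "mu = map length T" using assms(1) by (simp add: ssyt_def)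
  have "length (T ! Suc i) \<le> length (T ! i)"
    using assms(2) Suc.prems sorted_wrt_nth_less[of "(\<ge>)" mu i "Suc i"] by (simp add: mu)
  then have "i \<le> T ! i ! j" using Suc by simp
  also have "\<dots> < T ! Suc i ! j" using assms(1) Suc.prems by (simp add: ssyt_def)
  finally show ?case by simp
qed simp

lemma sorted_filter_replicate:
  assumes "sorted r" "\<forall>a \<in> set r. a < Suc n"
  shows "r = filter (\<lambda>a. a < n) r @ replicate (length r - length (filter (\<lambda>a. a < n) r)) n"
  using assms
proof (induction r)
  case (Cons a r)
  show ?case
  proof (cases "a < n")
    case False
    then have "\<forall>b \<in> set (a # r). b = n" using Cons.prems by force
    then have "filter (\<lambda>a. a < n) (a # r) = []" "a # r = replicate (length (a # r)) n"
      by (auto simp: filter_empty_conv intro!: replicate_eqI)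
    then show ?thesis by simp
  qed (use Cons in auto)
qed simp

lemma prod_list_concat_nth:
  fixes x :: "'b \<Rightarrow> 'a :: comm_monoid_mult"
  shows "prod_list (map x (concat T)) = (\<Prod>j<length T. prod_list (map x (T ! j)))"
proof (induction T rule: rev_induct)
  case (snoc r T)
  have "(\<Prod>j<length T. prod_list (map x ((T @ [r]) ! j))) = (\<Prod>j<length T. prod_list (map x (T ! j)))"
    by (intro prod.cong) (auto simp: nth_append)
  then show ?case using snoc by (simp add: mult.commute)
qed simp

text \<open>The branching rule on tableaux erases the letter \<open>n\<close>. With
  \<open>n + 1\<close> rows and letters up to \<open>n\<close>, row \<open>n\<close> consists of
  \<open>n\<close> alone and is dropped.\<close>

definition remove_last :: "nat \<Rightarrow> nat list list \<Rightarrow> nat list list" where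
  "remove_last n T = map (filter (\<lambda>a. a < n)) (take n T)"

definition add_last :: "nat \<Rightarrow> nat list \<Rightarrow> nat list list \<Rightarrow> nat list list" where
  "add_last n mu T =
     map (\<lambda>j. if j < n then T ! j @ replicate (mu ! j - length (T ! j)) n else replicate (mu ! j) n)
       [0..<Suc n]"

lemma remove_last_ssyts:
  assumes T: "T \<in> ssyts (Suc n) mu" and mu: "length mu = Suc n" "sorted_wrt (\<ge>) mu"
  defines "T' \<equiv> remove_last n T"
  shows "map length T' \<in> interlacing n mu" "T' \<in> ssyts n (map length T')" "add_last n mu T' = T"
proof -
  have ssyt: "ssyt mu T" and ent: "a < Suc n" if "a \<in> set (concat T)" for a
    using T that by (auto simp: ssyts_def)
  have mu_eq: "mu = map length T" using T by (simp add: ssyts_def ssyt_def)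
  have len: "length T = Suc n" using mu mu_eq by simp
  have row: "sorted (T ! j)" "\<forall>a \<in> set (T ! j). a < Suc n" if "j < Suc n" for j
    using T that len nth_mem[of j T] by (auto simp: ssyts_def ssyt_def simp del: nth_mem)
  have T'_len: "length T' = n" by (simp add: T'_def remove_last_def len)
  have T'_nth: "T' ! j = filter (\<lambda>a. a < n) (T ! j)" if "j < n" for j
    using that by (simp add: T'_def remove_last_def len)
  have split: "T ! j = T' ! j @ replicate (mu ! j - length (T' ! j)) n" if "j < n" for j
  proof -
    have "mu ! j = length (T ! j)" using that len by (simp add: mu_eq)
    then show ?thesis
      unfolding T'_nth[OF that] using sorted_filter_replicate[OF row[of j]] that by simp
  qed
  have last: "T ! n = replicate (mu ! n) n"
  proof -
    have "a = n" if "a \<in> set (T ! n)" for a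
    proof -
      from that obtain c where c: "c < length (T ! n)" "T ! n ! c = a"
        unfolding in_set_conv_nth by blast
      have "n \<le> T ! n ! c"
        by (rule ssyt_entry_ge[OF _ mu(2)]) (use T len c in \<open>auto simp: ssyts_def\<close>)
      moreover have "a < Suc n" using row(2)[of n] that by blast
      ultimately show ?thesis using c by simp
    qed
    moreover have "length (T ! n) = mu ! n" using len by (simp add: mu_eq)
    ultimately show ?thesis by (intro replicate_eqI) auto
  qed
  have below: "T' ! j ! c = T ! j ! c" if "j < n" "c < length (T' ! j)" for j c
    using split[OF that(1)] that(2) by (metis nth_append)
  \<comment> \<open>If row \<open>Suc j\<close> were longer than the shortened row \<open>j\<close>,
    it would have a cell directly below an entry \<open>n\<close>, and that cell would have to
    exceed \<open>n\<close>.\<close>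
  have wide: "length (T ! Suc j) \<le> length (T' ! j)" if "j < n" for j
  proof (rule ccontr)
    assume neg: "\<not> length (T ! Suc j) \<le> length (T' ! j)"
    let ?c = "length (T' ! j)"
    have "length (T ! Suc j) \<le> length (T ! j)"
      using mu(2) that len sorted_wrt_nth_less[of "(\<ge>)" mu j "Suc j"] by (simp add: mu_eq)
    with neg have c: "?c < length (T ! j)" "?c < length (T ! Suc j)" by auto
    have "T ! j ! ?c = (T' ! j @ replicate (mu ! j - length (T' ! j)) n) ! ?c"
      using split[OF that] by simp
    also have "\<dots> = n" using c(1) that len by (subst nth_append) (simp add: mu_eq)
    finally have "n < T ! Suc j ! ?c"
      using T c(2) that len by (auto simp: ssyts_def ssyt_def)
    moreover have "T ! Suc j ! ?c < Suc n"
      using row(2)[of "Suc j"] c(2) that by auto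
    ultimately show False by simp
  qed
  show "map length T' \<in> interlacing n mu"
    unfolding interlacing_def
    using wide by (auto simp: T'_len len mu_eq T'_nth)
  have "T' ! i ! j < T' ! Suc i ! j" if "Suc i < n" "j < length (T' ! Suc i)" for i j
  proof -
    have "length (T' ! Suc i) \<le> length (T ! Suc i)" using that by (simp add: T'_nth)
    then have j: "j < length (T ! Suc i)" "j < length (T' ! i)"
      using that wide[of i] by auto
    then have "T ! i ! j < T ! Suc i ! j"
      using T that len by (auto simp: ssyts_def ssyt_def)
    then show ?thesis using that j below by simp
  qed
  moreover have "sorted r" if "r \<in> set T'" for r
    using that row(1) by (auto simp: in_set_conv_nth T'_len T'_nth intro!: sorted_wrt_filter)
  moreover have "set (concat T') \<subseteq> {..<n}"
    by (auto simp: T'_def remove_last_def)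
  ultimately show "T' \<in> ssyts n (map length T')"
    by (auto simp: ssyts_def ssyt_def T'_len)
  show "add_last n mu T' = T"
  proof (rule nth_equalityI)
    fix j assume "j < length (add_last n mu T')"
    then have "j < Suc n" by (simp add: add_last_def)
    then show "add_last n mu T' ! j = T ! j"
      using split[of j] last by (cases "j = n") (auto simp: add_last_def nth_append)
  qed (simp add: add_last_def len)
qed

lemma add_last_ssyts:
  assumes nu: "nu \<in> interlacing n mu" and T: "T \<in> ssyts n nu" and mu: "length mu = Suc n"
  shows "add_last n mu T \<in> ssyts (Suc n) mu" "remove_last n (add_last n mu T) = T"
    "prod_list (map x (concat (add_last n mu T))) =
      (x n :: 'a :: comm_monoid_mult) ^ (sum_list mu - sum_list nu) * prod_list (map x (concat T))"
proof -
  let ?A = "add_last n mu T"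
  have nu_eq: "nu = map length T" using T by (simp add: ssyts_def ssyt_def)
  have len: "length T = n" using nu by (simp add: interlacing_def nu_eq)
  have il: "mu ! Suc j \<le> length (T ! j)" "length (T ! j) \<le> mu ! j" if "j < n" for j
    using nu that by (auto simp: interlacing_def nu_eq)
  have row: "sorted (T ! j)" "\<forall>a \<in> set (T ! j). a < n" if "j < n" for j
    using T that len nth_mem[of j T] by (auto simp: ssyts_def ssyt_def simp del: nth_mem)
  have A: "?A ! j = (if j < n then T ! j @ replicate (mu ! j - length (T ! j)) n else replicate
      (mu ! j) n)"
    if "j < Suc n" for j
    using that by (simp add: add_last_def del: upt_Suc)
  have A_len: "length ?A = Suc n" by (simp add: add_last_def)
  have "map length ?A = mu"
    by (rule nth_equalityI) (use il in \<open>auto simp: A_len A mu\<close>)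
  moreover have "sorted r" if "r \<in> set ?A" for r
  proof -
    from that obtain j where "j < length ?A" "?A ! j = r" unfolding in_set_conv_nth by blast
    then have j: "j < Suc n" "r = ?A ! j" by (simp_all only: A_len)
    show ?thesis
    proof (cases "j < n")
      case True
      then show ?thesis using j row[OF True] by (auto simp: A sorted_append less_imp_le)
    qed (use j in \<open>auto simp: A\<close>)
  qed
  moreover have "?A ! i ! j < ?A ! Suc i ! j" if "Suc i < Suc n" "j < length (?A ! Suc i)" for i j
  proof -
    have "j < mu ! Suc i" using that il[of "Suc i"] by (auto simp: A split: if_splits)
    then have ji: "j < length (T ! i)" using il[of i] that by simp
    then have 1: "?A ! i ! j = T ! i ! j" using that by (simp add: A nth_append)
    \<comment> \<open>The lower cell is either old or a new one with entry \<open>n\<close>. In the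
      second case interlacing makes the cell above it old, hence smaller than
      \<open>n\<close>.\<close>
    show ?thesis
    proof (cases "Suc i < n \<and> j < length (T ! Suc i)")
      case True
      then have "T ! i ! j < T ! Suc i ! j" using T len by (auto simp: ssyts_def ssyt_def)
      then show ?thesis using True 1 by (simp add: A nth_append)
    next
      case False
      then have "?A ! Suc i ! j = n" using that \<open>j < mu ! Suc i\<close> by (auto simp: A nth_append)
      moreover have "T ! i ! j < n" using row(2)[of i] ji that by auto
      ultimately show ?thesis using 1 by simp
    qed
  qed
  moreover have "set (concat ?A) \<subseteq> {..<Suc n}"
    using row(2) by (fastforce simp: add_last_def)
  ultimately show "?A \<in> ssyts (Suc n) mu"
    by (auto simp: ssyts_def ssyt_def A_len)
  show "remove_last n ?A = T"
  proof (rule nth_equalityI)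
    fix j assume "j < length (remove_last n ?A)"
    then have j: "j < n" by (simp add: remove_last_def A_len)
    then show "remove_last n ?A ! j = T ! j"
      using row(2)[OF j] by (simp add: remove_last_def A_len A)
  qed (simp add: remove_last_def A_len len)
  have "prod_list (map x (concat ?A)) =
      (\<Prod>j<n. prod_list (map x (T ! j)) * x n ^ (mu ! j - length (T ! j))) * x n ^ mu ! n"
    unfolding prod_list_concat_nth A_len by (simp add: A lessThan_Suc mult.commute)
  also have "\<dots> = prod_list (map x (concat T)) * x n ^ ((\<Sum>j<n. mu ! j - length (T ! j)) + mu ! n)"
    by (simp add: prod.distrib prod_list_concat_nth len power_add power_sum mult.assoc)
  also have "(\<Sum>j<n. mu ! j - length (T ! j)) + mu ! n = sum_list mu - sum_list nu"
  proof -
    have "sum_list nu = (\<Sum>j<n. length (T ! j))"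
      by (simp add: nu_eq sum_list_sum_nth len lessThan_atLeast0)
    moreover have "sum_list mu = (\<Sum>j<n. mu ! j) + mu ! n"
      using mu by (simp add: sum_list_sum_nth lessThan_atLeast0)
    moreover have "(\<Sum>j<n. mu ! j) = (\<Sum>j<n. length (T ! j)) + (\<Sum>j<n. mu ! j - length (T ! j))"
      unfolding sum.distrib[symmetric] using il by (intro sum.cong) auto
    ultimately show ?thesis by simp
  qed
  finally show "prod_list (map x (concat ?A)) =
      x n ^ (sum_list mu - sum_list nu) * prod_list (map x (concat T))"
    by (simp add: mult.commute)
qed

text \<open>Erasing the letter \<open>n\<close> is a bijection from tableaux to pairs of an
  interlacing shape and a tableau of that shape, which is the recursion that defines
  \<open>schur_poly\<close>.\<close>

lemma schur_poly_eq_sum: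
  assumes "length mu = n" "sorted_wrt (\<ge>) mu"
  shows "schur_poly n x mu = (\<Sum>T \<in> ssyts n mu. prod_list (map x (concat T)))"
  using assms
proof (induction n arbitrary: mu)
  case 0
  then have "ssyts 0 mu = {[]}" by (auto simp: ssyts_def ssyt_def)
  then show ?case by simp
next
  case (Suc n)
  note mono = interlacing_decreasing[OF Suc.prems]
  have "schur_poly (Suc n) x mu = (\<Sum>nu \<in> interlacing n mu. \<Sum>T \<in> ssyts n nu.
      x n ^ (sum_list mu - sum_list nu) * prod_list (map x (concat T)))"
    unfolding schur_poly.simps sum_distrib_left[symmetric]
    by (intro sum.cong refl arg_cong2[where f = "(*)"] Suc.IH mono) (auto simp: interlacing_def)
  also have "\<dots> = (\<Sum>(nu, T) \<in> Sigma (interlacing n mu) (ssyts n).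
      x n ^ (sum_list mu - sum_list nu) * prod_list (map x (concat T)))"
    by (rule sum.Sigma) auto
  also have "\<dots> = (\<Sum>T \<in> ssyts (Suc n) mu. prod_list (map x (concat T)))"
  proof (rule sum.reindex_bij_witness[of _ "\<lambda>T. (map length (remove_last n T), remove_last n T)"
        "\<lambda>(nu, T). add_last n mu T"])
    fix p assume p: "p \<in> Sigma (interlacing n mu) (ssyts n)"
    obtain nu T where p_eq: "p = (nu, T)" by force
    have *: "nu \<in> interlacing n mu" "T \<in> ssyts n nu" using p p_eq by auto
    have "map length T = nu" using * by (simp add: ssyts_def ssyt_def)
    with add_last_ssyts(1,2)[OF * Suc.prems(1)] add_last_ssyts(3)[OF * Suc.prems(1), of x]
    show "(map length (remove_last n (case p of (nu, T) \<Rightarrow> add_last n mu T)),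
        remove_last n (case p of (nu, T) \<Rightarrow> add_last n mu T)) = p"
      "(case p of (nu, T) \<Rightarrow> add_last n mu T) \<in> ssyts (Suc n) mu"
      "prod_list (map x (concat (case p of (nu, T) \<Rightarrow> add_last n mu T))) =
        (case p of (nu, T) \<Rightarrow> x n ^ (sum_list mu - sum_list nu) * prod_list (map x (concat T)))"
      by (simp_all add: p_eq)
  next
    fix T assume "T \<in> ssyts (Suc n) mu"
    from remove_last_ssyts[OF this Suc.prems]
    show "(case (map length (remove_last n T), remove_last n T) of (nu, T) \<Rightarrow> add_last n mu T) = T"
      "(map length (remove_last n T), remove_last n T) \<in> Sigma (interlacing n mu) (ssyts n)"
      by auto
  qed
  finally show ?case .
qed

subsection \<open>Extraction of Schur coefficients\<close>

text \<open>Monomials are multisets, exactly as for \<open>series\<close>, so coefficients in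
  polynomial identities can be compared with those of series by \<open>lookup\<close>.\<close>

definition X :: "nat \<Rightarrow> nat multiset \<Rightarrow>\<^sub>0 int" where
  "X i = Poly_Mapping.single {#i#} 1"

lemma single_empty [simp]: "Poly_Mapping.single ({#} :: nat multiset) (1 :: int) = 1"
  by (metis single_one zero_multiset_def)

lemma prod_list_X: "prod_list (map X xs) = Poly_Mapping.single (mset xs) 1"
  by (induction xs) (simp_all add: X_def mult_single)

lemma prod_X: "finite I \<Longrightarrow> (\<Prod>p \<in> I. X (h p)) = Poly_Mapping.single (\<Sum>p \<in> I. {#h p#}) 1"
  by (induction I rule: finite_induct) (simp_all add: X_def mult_single)

lemma X_power: "X i ^ k = Poly_Mapping.single (replicate_mset k i) 1"
  by (induction k) (simp_all add: X_def mult_single)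

text \<open>
  A subset \<open>S\<close> of the pairs is the choice of the term \<open>- x j\<close> in the factors \<open>x i - x j\<close> of the
  Vandermonde product with \<open>(i, j) \<in> S\<close>; the resulting monomial is \<open>choice_mset n S\<close>.
\<close>

definition choice_mset :: "nat \<Rightarrow> (nat \<times> nat) set \<Rightarrow> nat multiset" where
  "choice_mset n S = (\<Sum>p \<in> S. {#snd p#}) + (\<Sum>p \<in> pairs n - S. {#fst p#})"

lemma vandermonde_expand:
  "(\<Prod>(i, j) \<in> pairs n. X i - X j) =
     (\<Sum>S \<in> Pow (pairs n). Poly_Mapping.single (choice_mset n S) ((-1) ^ card S))"
proof -
  have "(\<Prod>(i, j) \<in> pairs n. X i - X j) = (\<Prod>p \<in> pairs n. - X (snd p) + X (fst p))"
    by (intro prod.cong) auto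
  also have "\<dots> = (\<Sum>S \<in> Pow (pairs n). (\<Prod>p \<in> S. - X (snd p)) * (\<Prod>p \<in> pairs n - S. X (fst p)))"
    by (rule prod_add) simp
  also have "\<dots> = (\<Sum>S \<in> Pow (pairs n). Poly_Mapping.single (choice_mset n S) ((-1) ^ card S))"
  proof (intro sum.cong refl)
    fix S assume "S \<in> Pow (pairs n)"
    then have fin: "finite S" by (auto intro: finite_subset[OF _ finite_pairs])
    have "(\<Prod>p \<in> S. - X (snd p)) = Poly_Mapping.single (\<Sum>p \<in> S. {#snd p#}) ((-1) ^ card S)"
      using fin by (induction S rule: finite_induct) (simp_all add: X_def mult_single single_uminus)
    then show "(\<Prod>p \<in> S. - X (snd p)) * (\<Prod>p \<in> pairs n - S. X (fst p)) =
        Poly_Mapping.single (choice_mset n S) ((-1) ^ card S)"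
      by (simp add: prod_X mult_single choice_mset_def)
  qed
  finally show ?thesis .
qed

section \<open>Coefficient extraction with the Vandermonde product\<close>

definition shifted_mset :: "nat list \<Rightarrow> nat multiset" where
  "shifted_mset la = (\<Sum>i < length la. replicate_mset (la ! i + (length la - 1 - i)) i)"

text \<open>This is the coefficient of \<open>x ^ (la + delta)\<close> in the product of
  \<open>F\<close> with the Vandermonde product. The inner sum has at most one term, and none if the
  chosen monomial does not divide the target.\<close>

definition schur_extract :: "nat list \<Rightarrow> series \<Rightarrow> int" where
  "schur_extract la F = (\<Sum>S \<in> Pow (pairs (length la)). (-1) ^ card S *
     (\<Sum>A | A + choice_mset (length la) S = shifted_mset la. F A))"

lemma finite_complement_mset [simp]: "finite {A. A + D = (B :: 'a multiset)}"
  by (rule finite_subset[of _ "{B - D}"]) auto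

text \<open>Extraction looks at the first \<open>length la\<close> variables only, so a series in
  infinitely many variables may be compared with a polynomial.\<close>

lemma set_shifted_mset: "A + D = shifted_mset la \<Longrightarrow> set_mset A \<subseteq> {..<length la}"
proof -
  have "set_mset (shifted_mset la) \<subseteq> {..<length la}"
    by (auto simp: shifted_mset_def set_mset_sum split: if_splits)
  moreover assume "A + D = shifted_mset la"
  ultimately show ?thesis by (metis le_sup_iff set_mset_union)
qed

lemma count_sum_replicate:
  assumes "bij_betw h I J" "finite I" "i \<in> I"
  shows "count (\<Sum>j \<in> I. replicate_mset (l j) (h j)) (h i) = l i"
proof -
  have "count (\<Sum>j \<in> I. replicate_mset (l j) (h j)) (h i) = (\<Sum>j \<in> I. if j = i then l j else 0)"
    unfolding count_sum using assms by (intro sum.cong) (auto simp: bij_betw_def inj_on_def)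
  then show ?thesis using assms by simp
qed

lemma count_shifted_mset: "i < length la \<Longrightarrow> count (shifted_mset la) i = la ! i + (length la - 1 - i)"
  unfolding shifted_mset_def
  using count_sum_replicate[of id "{..<length la}" "{..<length la}" i "\<lambda>i. la ! i
      + (length la - 1 - i)"] by simp

text \<open>Used to match two strictly decreasing exponent vectors that agree up to order.\<close>

lemma decreasing_image_unique:
  fixes f g :: "nat \<Rightarrow> nat"
  assumes "\<And>i j. i < j \<Longrightarrow> j < n \<Longrightarrow> f j < f i" "\<And>i j. i < j \<Longrightarrow> j < n \<Longrightarrow> g j < g i"
    and "f ` {..<n} = g ` {..<n}" and "i < n"
  shows "f i = g i"
proof -
  have "sorted_wrt (<) (rev (map f [0..<n]))" "sorted_wrt (<) (rev (map g [0..<n]))"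
    unfolding sorted_wrt_rev unfolding sorted_wrt_iff_nth_less using assms(1,2) by simp_all
  moreover have "set (rev (map f [0..<n])) = set (rev (map g [0..<n]))"
    using assms(3) by (simp add: lessThan_atLeast0)
  ultimately have "rev (map f [0..<n]) = rev (map g [0..<n])"
    by (intro strict_sorted_equal) simp_all
  then show ?thesis using assms(4) by (simp add: map_eq_conv)
qed

lemma shifted_strict:
  assumes "sorted_wrt (\<ge>) la" "i < j" "j < length la"
  shows "la ! j + (length la - 1 - j) < la ! i + (length la - 1 - i)"
  using sorted_wrt_nth_less[OF assms] assms by simp

text \<open>The exponents \<open>mu + delta\<close> and \<open>la + delta\<close> are both strictly
  decreasing. A permuted copy of the one equals the other only for the identity permutation, so a
  single term of the determinant can hit the monomial, with sign 1.\<close>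

lemma lookup_alternant:
  assumes "length mu = n" "sorted_wrt (\<ge>) mu" "length la = n" "sorted_wrt (\<ge>) la"
  shows "Poly_Mapping.lookup (alternant n (\<lambda>j. mu ! j + (n - 1 - j)) X) (shifted_mset la) = (if la
      = mu then 1 else 0)"
proof -
  define l where "l = (\<lambda>j. mu ! j + (n - 1 - j))"
  define M where "M = (\<lambda>p :: nat \<Rightarrow> nat. \<Sum>j<n. replicate_mset (l j) (p j))"
  have prod: "(\<Prod>j<n. X (p j) ^ l j) = Poly_Mapping.single (M p) 1" for p :: "nat \<Rightarrow> nat"
  proof -
    have "(\<Prod>j\<in>I. X (p j) ^ l j) = Poly_Mapping.single (\<Sum>j\<in>I. replicate_mset (l j) (p j)) 1"
      if "finite I" for I
      using that by (induction I rule: finite_induct) (simp_all add: X_power mult_single)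
    then show ?thesis by (simp add: M_def)
  qed
  have M_eq: "M p = shifted_mset la \<longleftrightarrow> p = id \<and> la = mu" if p: "p permutes {0..<n}" for p
  proof
    assume M: "M p = shifted_mset la"
    have p': "p permutes {..<n}" using p by (simp add: lessThan_atLeast0)
    have l_eq: "l j = la ! p j + (n - 1 - p j)" if "j < n" for j
    proof -
      have "p j < n" using permutes_in_image[OF p', of j] that by simp
      moreover have "count (M p) (p j) = l j"
        unfolding M_def using count_sum_replicate[of p "{..<n}"
            "{..<n}" j l] permutes_imp_bij[OF p'] that by simp
      ultimately show ?thesis
        using count_shifted_mset[of "p j" la] assms(3) by (simp add: M)
    qed
    have dec: "l j < l i" if "i < j" "j < n" for i j
      using shifted_strict[OF assms(2) that(1)] that assms(1) by (simp add: l_def)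
    have dec': "la ! j + (n - 1 - j) < la ! i + (n - 1 - i)" if "i < j" "j < n" for i j
      using shifted_strict[OF assms(4) that(1)] that assms(3) by simp
    have "l ` {..<n} = (\<lambda>i. la ! i + (n - 1 - i)) ` p ` {..<n}"
      unfolding image_image using l_eq by (intro image_cong) auto
    also have "p ` {..<n} = {..<n}" using permutes_image[OF p'] .
    finally have eq: "l i = la ! i + (n - 1 - i)" if "i < n" for i
      using decreasing_image_unique[of n l "\<lambda>i. la ! i + (n - 1 - i)" i] dec dec' that by blast
    have "la = mu"
    proof (rule nth_equalityI)
      fix i assume "i < length la"
      then have "mu ! i + (n - 1 - i) = la ! i + (n - 1 - i)" using eq[of i] assms(3)
          by (simp only: l_def)
      then show "la ! i = mu ! i" by simp
    qed (use assms in simp)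
    \<comment> \<open>Strictly decreasing exponents are distinct, and
      \<open>l j = l (p j)\<close>.\<close>
    moreover have "p j = j" for j
    proof (cases "j < n")
      case True
      have pj: "p j < n" using permutes_in_image[OF p', of j] True by simp
      have "l j = l (p j)" using l_eq[OF True] eq[OF pj] by simp
      then show ?thesis using dec[of j "p j"] dec[of "p j" j] True pj
        by (metis less_irrefl linorder_neqE_nat)
    next
      case False
      then show ?thesis using p' by (simp add: permutes_def)
    qed
    ultimately show "p = id \<and> la = mu" by auto
  next
    assume "p = id \<and> la = mu"
    then show "M p = shifted_mset la"
      using assms by (simp add: M_def shifted_mset_def l_def)
  qed
  have "alternant n l X = (\<Sum>p | p permutes {0..<n}. Poly_Mapping.single (M p) (sign p))"
    unfolding alternant_eq prod by (intro sum.cong refl) (auto simp: sign_def single_uminus)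
  then have "Poly_Mapping.lookup (alternant n l X) (shifted_mset la) =
      (\<Sum>p | p permutes {0..<n}. if M p = shifted_mset la then sign p else 0)"
    by (simp add: lookup_sum lookup_single when_def)
  also have "\<dots> = (\<Sum>p | p permutes {0..<n}. if p = id then (if la = mu then 1 else 0) else 0)"
    by (intro sum.cong refl) (simp add: M_eq)
  also have "\<dots> = (if la = mu then 1 else 0)"
    by (subst sum.delta) (auto simp: finite_permutations permutes_id)
  finally show ?thesis by (simp add: l_def)
qed

lemma schur_poly_X:
  assumes "length mu = n" "sorted_wrt (\<ge>) mu"
  shows "schur_poly n X mu = (\<Sum>T \<in> ssyts n mu. Poly_Mapping.single (mset (concat T)) 1)"
  unfolding schur_poly_eq_sum[OF assms] prod_list_X ..

lemma schur_eq_card_ssyts: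
  assumes "set_mset A \<subseteq> {..<n}"
  shows "schur mu A = int (card {T \<in> ssyts n mu. mset (concat T) = A})"
proof -
  have "{T. ssyt mu T \<and> mset (concat T) = A} = {T \<in> ssyts n mu. mset (concat T) = A}"
    using assms by (auto simp: ssyts_def simp flip: set_mset_mset)
  then show ?thesis by (simp add: schur_def)
qed

lemma drop_empty_rows:
  assumes "map length T = mu @ replicate k 0"
  shows "drop (length mu) T = replicate k []"
proof (intro replicate_eqI)
  show "length (drop (length mu) T) = k" using arg_cong[OF assms, of length] by simp
  fix r assume "r \<in> set (drop (length mu) T)"
  then have "length r \<in> set (drop (length mu) (map length T))" by (simp add: drop_map)
  then show "r = []" by (simp add: assms)
qed

text \<open>Zero parts are empty rows. Padding a shape to length \<open>n\<close> makes it fit the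
  bialternant identity in \<open>n\<close> variables.\<close>

lemma schur_append_zeros: "schur (mu @ replicate k 0) A = schur mu A"
proof -
  have "bij_betw (\<lambda>T. T @ replicate k []) {T. ssyt mu T \<and> mset (concat T) = A}
      {T. ssyt (mu @ replicate k 0) T \<and> mset (concat T) = A}"
  proof (rule bij_betwI[where g = "take (length mu)"])
    show "(\<lambda>T. T @ replicate k []) \<in> {T. ssyt mu T \<and> mset (concat T) = A} \<rightarrow>
        {T. ssyt (mu @ replicate k 0) T \<and> mset (concat T) = A}"
      by (auto simp: ssyt_def nth_append concat_eq_Nil_conv[THEN iffD2] split: if_splits)
    show "take (length mu) \<in> {T. ssyt (mu @ replicate k 0) T \<and> mset (concat T) = A} \<rightarrow>
        {T. ssyt mu T \<and> mset (concat T) = A}"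
    proof safe
      fix T assume T: "ssyt (mu @ replicate k 0) T"
      then have len: "map length T = mu @ replicate k 0" by (simp add: ssyt_def)
      note drop = drop_empty_rows[OF len]
      have tk: "map length (take (length mu) T) = mu"
        using len by (metis append_eq_conv_conj take_map)
      then show "ssyt mu (take (length mu) T)"
        using T by (auto simp: ssyt_def dest: in_set_takeD)
      have "concat T = concat (take (length mu) T) @ concat (drop (length mu) T)"
        by (metis append_take_drop_id concat_append)
      then have "concat (take (length mu) T) = concat T"
        by (simp add: drop concat_eq_Nil_conv[THEN iffD2])
      then show "mset (concat (take (length mu) T)) = mset (concat T)" by simp
    qed
  next
    fix T assume "T \<in> {T. ssyt mu T \<and> mset (concat T) = A}"
    then show "take (length mu) (T @ replicate k []) = T"
      by (auto simp: ssyt_def)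
  next
    fix T assume "T \<in> {T. ssyt (mu @ replicate k 0) T \<and> mset (concat T) = A}"
    then have len: "map length T = mu @ replicate k 0" by (simp add: ssyt_def)
    have "drop (length mu) T = replicate k []" by (rule drop_empty_rows[OF len])
    then show "take (length mu) T @ replicate k [] = T" by (metis append_take_drop_id)
  qed
  then show ?thesis by (simp add: schur_def bij_betw_same_card)
qed

text \<open>All monomials that the extraction inspects live on the first \<open>n\<close> variables,
  where Schur function and Schur polynomial agree. The value is thus a coefficient of an
  alternant.\<close>

lemma schur_extract_schur_same_length:
  assumes "length mu = n" "sorted_wrt (\<ge>) mu" "length la = n" "sorted_wrt (\<ge>) la"
  shows "schur_extract la (schur mu) = (if la = mu then 1 else 0)"
proof -
  let ?D = "choice_mset n" and ?B = "shifted_mset la"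
  have "(if la = mu then 1 else 0) = Poly_Mapping.lookup ((\<Prod>(i, j) \<in> pairs n. X i - X j) *
      schur_poly n X mu) ?B"
    using lookup_alternant[OF assms] alternant_schur_poly[OF assms(1,2), of X] by simp
  also have "\<dots> = (\<Sum>S \<in> Pow (pairs n). \<Sum>T \<in> ssyts n mu. if ?D S + mset (concat T)
      = ?B then (-1) ^ card S else 0)"
    unfolding vandermonde_expand schur_poly_X[OF assms(1,2)]
    by (simp add: sum_product lookup_sum mult_single lookup_single when_def)
  also have "\<dots> = (\<Sum>S \<in> Pow (pairs n). (-1) ^ card S * (\<Sum>A | A + ?D S = ?B. schur mu A))"
  proof (intro sum.cong refl)
    fix S
    have "(\<Sum>A | A + ?D S = ?B. schur mu A) = (\<Sum>A | A + ?D S = ?B. \<Sum>T \<in> ssyts n mu.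
        if mset (concat T) = A then 1 else 0)"
    proof (intro sum.cong refl)
      fix A assume "A \<in> {A. A + ?D S = ?B}"
      then have "set_mset A \<subseteq> {..<n}" using set_shifted_mset assms(3) by blast
      then show "schur mu A = (\<Sum>T \<in> ssyts n mu. if mset (concat T) = A then 1 else 0)"
        by (simp add: schur_eq_card_ssyts sum.If_cases Int_def)
    qed
    also have "\<dots> = (\<Sum>T \<in> ssyts n mu. \<Sum>A | A + ?D S = ?B. if mset (concat T) = A then 1 else 0)"
      by (rule sum.swap)
    also have "\<dots> = (\<Sum>T \<in> ssyts n mu. if ?D S + mset (concat T) = ?B then 1 else 0)"
      by (intro sum.cong refl) (simp add: sum.delta' add.commute)
    finally show "(\<Sum>T \<in> ssyts n mu. if ?D S + mset (concat T) = ?B then (-1) ^ card S else 0) =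
        (-1) ^ card S * (\<Sum>A | A + ?D S = ?B. schur mu A)"
      by (simp add: sum_distrib_left if_distrib cong: if_cong)
  qed
  finally show ?thesis by (simp add: schur_extract_def assms(3))
qed

lemma is_partition_pad: "is_partition mu \<Longrightarrow> sorted_wrt (\<ge>) (mu @ replicate k 0)"
  unfolding is_partition_def sorted_wrt_append by (auto simp: sorted_wrt_iff_nth_less[of _
      "replicate k 0"])

text \<open>A shape with at most as many rows as \<open>la\<close> is padded by zeros. One with more
  rows has no tableau with letters below \<open>length la\<close>, because entries grow down the
  columns.\<close>

theorem schur_extract_schur:
  assumes "is_partition la" "is_partition mu"
  shows "schur_extract la (schur mu) = (if la = mu then 1 else 0)"
proof (cases "length mu \<le> length la")
  case True
  let ?n = "length la"
  let ?mu = "mu @ replicate (?n - length mu) 0"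
  have "schur_extract la (schur ?mu) = (if la = ?mu then 1 else 0)"
    using assms True
    by (intro schur_extract_schur_same_length is_partition_pad) (auto simp: is_partition_def)
  moreover have "la = ?mu \<longleftrightarrow> la = mu"
  proof
    assume *: "la = ?mu"
    \<comment> \<open>A zero added by the padding would be a part of the partition
      \<open>la\<close>.\<close>
    have "?n - length mu = 0"
    proof (rule ccontr)
      assume "?n - length mu \<noteq> 0"
      then have "0 \<in> set ?mu" by simp
      then show False using assms(1) * by (metis is_partition_def)
    qed
    then show "la = mu" using * by simp
  qed auto
  moreover have "schur ?mu = schur mu" by (simp add: fun_eq_iff schur_append_zeros)
  ultimately show ?thesis by simp
next
  case False
  have "schur mu A = 0" if A: "set_mset A \<subseteq> {..<length la}" for A
  proof -
    have "ssyts (length la) mu = {}"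
    proof (rule ccontr)
      assume "ssyts (length la) mu \<noteq> {}"
      then obtain T where T: "ssyt mu T" "set (concat T) \<subseteq> {..<length la}" by (auto simp: ssyts_def)
      have mu: "mu = map length T" using T by (simp add: ssyt_def)
      have len: "length la < length T" using False mu by simp
      then have "T ! length la \<in> set T" by simp
      then have pos: "0 < length (T ! length la)" "T ! length la \<in> set T"
        using assms(2) unfolding mu is_partition_def by force+
      then have "length la \<le> T ! length la ! 0"
        using assms(2) pos len by (intro ssyt_entry_ge[OF T(1)]) (auto simp: is_partition_def)
      moreover have "T ! length la ! 0 \<in> set (concat T)"
        using pos by (auto intro!: bexI[of _ "T ! length la"])
      ultimately show False using T(2) by auto
    qed
    then show ?thesis using schur_eq_card_ssyts[OF A] by simp
  qed
  then have "schur_extract la (schur mu) = 0"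
    unfolding schur_extract_def using set_shifted_mset
    by (intro sum.neutral ballI) (simp add: sum.neutral)
  then show ?thesis using False by auto
qed


subsection \<open>Symmetry\<close>

text \<open>Invariance is demanded for every injective relabelling of the support, not just for
  permutations of finitely many variables; variables can then be moved into another index set at
  once.\<close>

definition symmetric :: "series \<Rightarrow> bool" where
  "symmetric F \<longleftrightarrow> (\<forall>A \<phi>. inj_on \<phi> (set_mset A) \<longrightarrow> F (image_mset \<phi> A) = F A)"

text \<open>The bialternant identity for the empty shape padded by zeros, whose Schur polynomial is
  1.\<close>

lemma vandermonde_alternant:
  fixes x :: "nat \<Rightarrow> 'a :: comm_ring_1"
  shows "(\<Prod>(i, j) \<in> pairs n. x i - x j) = alternant n (\<lambda>j. n - 1 - j) x"
proof -
  have "ssyts n (replicate n 0) = {replicate n []}"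
  proof
    show "ssyts n (replicate n 0) \<subseteq> {replicate n []}"
    proof
      fix T assume "T \<in> ssyts n (replicate n 0)"
      then have *: "map length T = replicate n 0" by (simp add: ssyts_def ssyt_def)
      then have "length T = n" by (metis length_map length_replicate)
      moreover have "r = []" if "r \<in> set T" for r
      proof -
        have "length r \<in> set (map length T)" using that by simp
        then show ?thesis unfolding * by simp
      qed
      ultimately show "T \<in> {replicate n []}" by (simp add: replicate_eqI)
    qed
  qed (auto simp: ssyts_def ssyt_def)
  then have "schur_poly n x (replicate n 0) = 1"
    by (subst schur_poly_eq_sum) (auto simp: sorted_wrt_iff_nth_less concat_eq_Nil_conv[THEN iffD2])
  moreover have "alternant n (\<lambda>j. replicate n 0 ! j + (n - 1 - j)) x = alternant n
      (\<lambda>j. n - 1 - j) x"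
    unfolding alternant_eq by (intro sum.cong arg_cong2[where f = "(*)"] prod.cong refl) simp
  ultimately show ?thesis
    using alternant_schur_poly[of "replicate n 0" n x] by (simp add: sorted_wrt_iff_nth_less)
qed

lemma alternant_permute:
  assumes "p permutes {0..<n}"
  shows "alternant n l (\<lambda>i. x (p i)) = signof p * alternant n l x"
proof -
  have "mat n n (\<lambda>(i, j). x (p i) ^ l j) = mat n n (\<lambda>(i, j). mat n n
      (\<lambda>(i, j). x i ^ l j) $$ (p i, j))"
  proof (rule eq_matI)
    fix i j assume "i < dim_row (mat n n (\<lambda>(i, j). mat n n (\<lambda>(i, j). x i ^ l j) $$ (p i, j)))"
      "j < dim_col (mat n n (\<lambda>(i, j). mat n n (\<lambda>(i, j). x i ^ l j) $$ (p i, j)))"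
    moreover from this have "p i < n" using permutes_in_image[OF assms, of i] by simp
    ultimately show "mat n n (\<lambda>(i, j). x (p i) ^ l j) $$ (i, j) =
        mat n n (\<lambda>(i, j). mat n n (\<lambda>(i, j). x i ^ l j) $$ (p i, j)) $$ (i, j)" by simp
  qed auto
  then show ?thesis
    unfolding alternant_def using det_permute_rows[OF _ assms, of "mat n n (\<lambda>(i, j). x i ^ l j)"]
        by simp
qed

text \<open>In the quotient of alternants a permutation of the variables multiplies numerator and
  denominator by the same sign. The Vandermonde factor cancels because the polynomial ring has no
  zero divisors.\<close>

lemma schur_permute:
  assumes p: "p permutes {0..<n}" and A: "set_mset A \<subseteq> {..<n}"
    and mu: "length mu = n" "sorted_wrt (\<ge>) mu"
  shows "schur mu (image_mset p A) = schur mu A"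
proof -
  define V where "V = alternant n (\<lambda>j. n - 1 - j) X"
  \<comment> \<open>Its coefficient at \<open>x ^ delta\<close> is 1.\<close>
  have "V \<noteq> 0"
  proof -
    have "Poly_Mapping.lookup V (shifted_mset (replicate n 0)) = 1"
      using lookup_alternant[of "replicate n 0" n "replicate n 0"] vandermonde_alternant[of X n]
        alternant_schur_poly[of "replicate n 0" n X]
      by (simp add: V_def sorted_wrt_iff_nth_less alternant_eq)
    then show ?thesis by auto
  qed
  have V': "alternant n (\<lambda>j. n - 1 - j) (\<lambda>i. X (p i)) = signof p * V"
    unfolding V_def by (rule alternant_permute[OF p])
  have "signof p * V * schur_poly n (\<lambda>i. X (p i)) mu = signof p * V * schur_poly n X mu"
  proof -
    have "signof p * V * schur_poly n (\<lambda>i. X (p i)) mu =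
        alternant n (\<lambda>j. mu ! j + (n - 1 - j)) (\<lambda>i. X (p i))"
      using alternant_schur_poly[OF mu, of "\<lambda>i. X (p i)"] vandermonde_alternant[of
          "\<lambda>i. X (p i)" n] V'
      by simp
    also have "\<dots> = signof p * alternant n (\<lambda>j. mu ! j + (n - 1 - j)) X"
      by (rule alternant_permute[OF p])
    also have "\<dots> = signof p * V * schur_poly n X mu"
      using alternant_schur_poly[OF mu, of X] vandermonde_alternant[of X n]
      by (simp add: V_def mult.assoc)
    finally show ?thesis .
  qed
  moreover have "signof p * V \<noteq> 0"
    using \<open>V \<noteq> 0\<close> by (cases p rule: sign_cases) auto
  ultimately have eq: "schur_poly n (\<lambda>i. X (p i)) mu = schur_poly n X mu"
    by (metis mult_left_cancel)
  have inj: "inj p" using p by (rule permutes_inj)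
  have "schur_poly n (\<lambda>i. X (p i)) mu =
      (\<Sum>T \<in> ssyts n mu. Poly_Mapping.single (image_mset p (mset (concat T))) 1)"
    unfolding schur_poly_eq_sum[OF mu]
    by (intro sum.cong refl) (simp add: prod_list_X[of "map p xs"
        for xs, unfolded map_map comp_def])
  then have "Poly_Mapping.lookup (schur_poly n (\<lambda>i. X (p i)) mu) (image_mset p A) =
      (\<Sum>T \<in> ssyts n mu. if image_mset p (mset (concat T)) = image_mset p A then 1 else 0)"
    by (simp add: lookup_sum lookup_single when_def eq_commute[of "image_mset p A"])
  also have "\<dots> = (\<Sum>T \<in> ssyts n mu. if mset (concat T) = A then 1 else 0)"
    by (simp only: inj_eq[OF multiset.inj_map[OF inj]])
  also have "\<dots> = schur mu A"
    using schur_eq_card_ssyts[OF A, of mu] by (simp add: sum.If_cases Int_def)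
  finally have 1: "Poly_Mapping.lookup (schur_poly n X mu) (image_mset p A) = schur mu A"
    by (simp add: eq)
  have A': "set_mset (image_mset p A) \<subseteq> {..<n}"
    using A permutes_in_image[OF p] by auto
  have "Poly_Mapping.lookup (schur_poly n X mu) (image_mset p A) = schur mu (image_mset p A)"
    unfolding schur_poly_X[OF mu] using schur_eq_card_ssyts[OF A', of mu]
    by (simp add: lookup_sum lookup_single when_def sum.If_cases Int_def
        eq_commute[of "image_mset p A"])
  with 1 show ?thesis by simp
qed

lemma extend_to_permutation:
  assumes "inj_on \<phi> B" "B \<subseteq> {..<n}" "\<phi> ` B \<subseteq> {..<n :: nat}"
  obtains p where "p permutes {0..<n}" "\<And>i. i \<in> B \<Longrightarrow> p i = \<phi> i"
proof -
  have fin: "finite B" using assms(2) finite_subset by blast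
  have "card ({..<n} - B) = card ({..<n} - \<phi> ` B)"
    using assms fin by (simp add: card_Diff_subset card_image)
  then obtain h where h: "bij_betw h ({..<n} - B) ({..<n} - \<phi> ` B)"
    by (metis finite_Diff finite_lessThan finite_same_card_bij)
  define q where "q = (\<lambda>i. if i \<in> B then \<phi> i else h i)"
  have "bij_betw q (B \<union> ({..<n} - B)) (\<phi> ` B \<union> ({..<n} - \<phi> ` B))"
  proof (rule bij_betw_combine)
    show "bij_betw q B (\<phi> ` B)" using assms(1) by (auto simp: q_def bij_betw_def inj_on_def)
    show "bij_betw q ({..<n} - B) ({..<n} - \<phi> ` B)"
      using h by (subst bij_betw_cong[where g = h]) (auto simp: q_def)
  qed auto
  moreover have "B \<union> ({..<n} - B) = {..<n}" "\<phi> ` B \<union> ({..<n} - \<phi> ` B) = {..<n}" using assms by auto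
  ultimately have bij: "bij_betw q {0..<n} {0..<n}" by (simp add: lessThan_atLeast0)
  define p where "p = (\<lambda>i. if i < n then q i else i)"
  have "bij_betw p {0..<n} {0..<n}"
    using bij by (subst bij_betw_cong[where g = q]) (auto simp: p_def)
  then have "p permutes {0..<n}"
    by (rule bij_imp_permutes) (auto simp: p_def)
  moreover have "p i = \<phi> i" if "i \<in> B" for i
    using that assms(2) by (auto simp: p_def q_def)
  ultimately show ?thesis by (rule that)
qed

theorem symmetric_schur:
  assumes "is_partition mu"
  shows "symmetric (schur mu)"
  unfolding symmetric_def
proof (intro allI impI)
  fix A :: "nat multiset" and \<phi> :: "nat \<Rightarrow> nat"
  assume inj: "inj_on \<phi> (set_mset A)"
  \<comment> \<open>Large enough for the rows of \<open>mu\<close>, the support of \<open>A\<close>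
    and the image of that support, so that the relabelling extends to a permutation of
    \<open>n\<close> variables.\<close>
  define n where "n = length mu + Suc (Max (insert 0 (set_mset A \<union> \<phi> ` set_mset A)))"
  have bound: "i < n" if "i \<in> set_mset A \<union> \<phi> ` set_mset A" for i
  proof -
    have "i \<le> Max (insert 0 (set_mset A \<union> \<phi> ` set_mset A))" using that by (intro Max_ge) auto
    then show ?thesis by (simp add: n_def)
  qed
  obtain p where p: "p permutes {0..<n}" "\<And>i. i \<in> set_mset A \<Longrightarrow> p i = \<phi> i"
    using extend_to_permutation[OF inj, of n] bound by auto
  let ?mu = "mu @ replicate (n - length mu) 0"
  have "schur ?mu (image_mset p A) = schur ?mu A"
  proof (rule schur_permute[OF p(1) _ _ is_partition_pad[OF assms]])
    show "set_mset A \<subseteq> {..<n}" using bound by auto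
  qed (simp add: n_def)
  moreover have "image_mset p A = image_mset \<phi> A" using p(2) by (intro image_mset_cong) auto
  ultimately show "schur mu (image_mset \<phi> A) = schur mu A"
    by (simp add: schur_append_zeros)
qed

subsection \<open>Schur expansions of symmetric functions\<close>

definition degree_only :: "nat \<Rightarrow> series \<Rightarrow> bool" where
  "degree_only d F \<longleftrightarrow> (\<forall>A. F A \<noteq> 0 \<longrightarrow> size A = d)"

definition partitions_of :: "nat \<Rightarrow> nat list set" where
  "partitions_of d = {la. is_partition la \<and> sum_list la = d}"

lemma finite_partitions_of: "finite (partitions_of d)"
proof -
  have len: "length la \<le> sum_list la" if "0 \<notin> set la" for la :: "nat list"
    using that
  proof (induction la)
    case (Cons a la)
    then show ?case by (cases a) auto
  qed simp
  have "partitions_of d \<subseteq> {la. set la \<subseteq> {..d} \<and> length la \<le> d}"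
    using len by (auto simp: partitions_of_def is_partition_def member_le_sum_list)
  then show ?thesis using finite_lists_length_le finite_subset by blast
qed

text \<open>The monomial \<open>x ^ la\<close>, standard representative of its orbit under
  relabelling; \<open>exponents\<close> finds the partition that represents a given
  monomial.\<close>

definition partition_mset :: "nat list \<Rightarrow> nat multiset" where
  "partition_mset la = (\<Sum>i < length la. replicate_mset (la ! i) i)"

definition exponents :: "nat multiset \<Rightarrow> nat list" where
  "exponents A = map (count A) (rev (sort_key (count A) (sorted_list_of_set (set_mset A))))"

lemma sum_replicate_mset_support: "(\<Sum>x \<in> set_mset A. replicate_mset (count A x) x) = A"
  by (rule multiset_eqI) (simp add: count_sum not_in_iff)

lemma image_mset_sum: "finite I \<Longrightarrow> image_mset f (\<Sum>i \<in> I. g i) = (\<Sum>i \<in> I. image_mset f (g i))"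
  by (induction I rule: finite_induct) simp_all

lemma exponents_relabel:
  "\<exists>\<psi>. inj_on \<psi> (set_mset (partition_mset (exponents A))) \<and> image_mset \<psi> (partition_mset
      (exponents A)) = A"
proof -
  define xs where "xs = rev (sort_key (count A) (sorted_list_of_set (set_mset A)))"
  have xs: "distinct xs" "set xs = set_mset A" by (auto simp: xs_def)
  have e: "exponents A = map (count A) xs" by (simp add: exponents_def xs_def)
  have "set_mset (partition_mset (exponents A)) \<subseteq> {..<length xs}"
    by (auto simp: partition_mset_def e set_mset_sum split: if_splits)
  then have "inj_on ((!) xs) (set_mset (partition_mset (exponents A)))"
    using xs(1) by (intro inj_on_nth) auto
  moreover have "image_mset ((!) xs) (partition_mset (exponents A)) = A"
  proof -
    have "image_mset ((!) xs) (partition_mset (exponents A)) =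
        (\<Sum>i<length xs. replicate_mset (count A (xs ! i)) (xs ! i))"
      by (simp add: partition_mset_def e image_mset_sum)
    also have "\<dots> = (\<Sum>x \<in> set_mset A. replicate_mset (count A x) x)"
      using bij_betw_nth[OF xs(1) refl xs(2)[symmetric]] by (rule sum.reindex_bij_betw)
    finally show ?thesis by (simp add: sum_replicate_mset_support)
  qed
  ultimately show ?thesis by blast
qed

lemma symmetric_exponents: "symmetric F \<Longrightarrow> F A = F (partition_mset (exponents A))"
  using exponents_relabel[of A] unfolding symmetric_def by metis

lemma exponents_partition: "exponents A \<in> partitions_of (size A)"
proof -
  have "sorted (map (count A) (sort_key (count A) (sorted_list_of_set (set_mset A))))"
    by (rule sorted_sort_key)
  then have "sorted_wrt (\<ge>) (exponents A)"
    by (simp only: exponents_def rev_map[symmetric] sorted_wrt_rev)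
  moreover have "0 \<notin> set (exponents A)"
    by (auto simp: exponents_def) (metis not_in_iff)
  moreover have "sum_list (exponents A) = size A"
    by (simp add: exponents_def sum_list_distinct_conv_sum_set size_multiset_overloaded_eq)
  ultimately show ?thesis by (simp add: partitions_of_def is_partition_def)
qed

lemma degree_only_schur: "degree_only (sum_list mu) (schur mu)"
  unfolding degree_only_def
proof (intro allI impI)
  fix A assume "schur mu A \<noteq> 0"
  then have "{T. ssyt mu T \<and> mset (concat T) = A} \<noteq> {}" unfolding schur_def
      by (metis card.empty of_nat_0)
  then obtain T where "map length T = mu" "mset (concat T) = A" by (auto simp: ssyt_def)
  then show "size A = sum_list mu" by (auto simp: length_concat)
qed

lemma schur_extract_sum:
  assumes "finite I"
  shows "schur_extract la (\<lambda>A. \<Sum>i \<in> I. a i * G i A) = (\<Sum>i \<in> I. a i * schur_extract la (G i))"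
proof -
  have "(\<Sum>A | A + choice_mset n S = B. \<Sum>i \<in> I. a i * G i A) =
      (\<Sum>i \<in> I. a i * (\<Sum>A | A + choice_mset n S = B. G i A))" for n S B
    by (subst sum.swap) (simp add: sum_distrib_left)
  then have "schur_extract la (\<lambda>A. \<Sum>i \<in> I. a i * G i A) =
     (\<Sum>S \<in> Pow (pairs (length la)). \<Sum>i \<in> I. a i * ((-1) ^ card S *
       (\<Sum>A | A + choice_mset (length la) S = shifted_mset la. G i A)))"
    unfolding schur_extract_def by (simp add: sum_distrib_left mult.left_commute)
  also have "\<dots> = (\<Sum>i \<in> I. a i * schur_extract la (G i))"
    unfolding schur_extract_def by (subst sum.swap) (simp add: sum_distrib_left)
  finally show ?thesis .
qed

text \<open>Duality with the Schur functions reads off the coefficient, and this also yields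
  uniqueness of expansions.\<close>

lemma schur_extract_expansion:
  assumes "schur_expansion F c" "is_partition la"
  shows "schur_extract la F = c la"
proof -
  have fin: "finite {mu. c mu \<noteq> 0}" and part: "\<And>mu. c mu \<noteq> 0 \<Longrightarrow> is_partition mu"
    and F: "F = (\<lambda>A. \<Sum>mu | c mu \<noteq> 0. c mu * schur mu A)"
    using assms(1) by (auto simp: schur_expansion_def fun_eq_iff)
  have "schur_extract la F = (\<Sum>mu | c mu \<noteq> 0. c mu * schur_extract la (schur mu))"
    unfolding F by (rule schur_extract_sum[OF fin])
  also have "\<dots> = (\<Sum>mu | c mu \<noteq> 0. if mu = la then c mu else 0)"
    using part by (intro sum.cong refl) (simp add: schur_extract_schur[OF assms(2)])
  also have "\<dots> = c la" using fin by (simp add: sum.delta)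
  finally show ?thesis .
qed

text \<open>
  On symmetric functions of degree \<open>d\<close>, extraction is given by a square matrix. It is a one-sided
  inverse of the matrix of Kostka numbers, hence a two-sided one.
\<close>

theorem schur_expansion_exists:
  assumes F: "symmetric F" "degree_only d F"
  shows "schur_expansion F (\<lambda>la. if la \<in> partitions_of d then schur_extract la F else 0)"
proof -
  let ?P = "partitions_of d"
  \<comment> \<open>For a partition \<open>al\<close> of \<open>d\<close> this is the monomial
    symmetric function of \<open>al\<close>; symmetric functions of degree \<open>d\<close> are
    combinations of these.\<close>
  define ind :: "nat list \<Rightarrow> series" where "ind = (\<lambda>al A. if size A = d \<and> exponents A
      = al then 1 else 0)"
  have expand: "G A = (\<Sum>al \<in> ?P. G (partition_mset al) * ind al A)" if "symmetric G"
      "degree_only d G" for G A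
  proof (cases "size A = d")
    case True
    then have "(\<Sum>al \<in> ?P. G (partition_mset al) * ind al A) =
        (\<Sum>al \<in> ?P. if al = exponents A then G (partition_mset al) else 0)"
      by (intro sum.cong) (auto simp: ind_def)
    also have "\<dots> = G (partition_mset (exponents A))"
      using exponents_partition[of A] True finite_partitions_of by (simp add: sum.delta)
    finally show ?thesis using symmetric_exponents[OF that(1)] by simp
  next
    case False
    then show ?thesis using that(2) by (auto simp: degree_only_def ind_def)
  qed
  have ext_eq: "schur_extract la G = (\<Sum>al \<in> ?P. G (partition_mset al) * schur_extract la (ind al))"
    if "symmetric G" "degree_only d G" for G la
  proof -
    have "G = (\<lambda>A. \<Sum>al \<in> ?P. G (partition_mset al) * ind al A)"
      by (rule ext) (rule expand[OF that])
    then have "schur_extract la G = schur_extract la (\<lambda>A. \<Sum>al \<in> ?P. G (partition_mset al) * ind al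
        A)"
      by (rule arg_cong)
    then show ?thesis
      by (simp only: schur_extract_sum[OF finite_partitions_of])
  qed
  obtain ps where ps: "set ps = ?P" "distinct ps"
    using finite_distinct_list[OF finite_partitions_of] by blast
  let ?N = "length ps"
  have reindex: "(\<Sum>al \<in> ?P. h al) = (\<Sum>j \<in> {0..<?N}. h (ps ! j))" for h :: "nat list \<Rightarrow> rat"
    using sum.reindex_bij_betw[OF bij_betw_nth[OF ps(2) refl refl], of h] ps(1)
    by (simp add: lessThan_atLeast0)
  \<comment> \<open>\<open>K\<close> holds the Kostka numbers and \<open>M\<close> the values of
    extraction on the monomial functions. Rational entries place the passage from a one-sided to a
    two-sided inverse over a field.\<close>
  define K where "K = mat ?N ?N (\<lambda>(i, j). rat_of_int (schur (ps ! i) (partition_mset (ps ! j))))"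
  define M where "M = mat ?N ?N (\<lambda>(j, k). rat_of_int (schur_extract (ps ! k) (ind (ps ! j))))"
  have part: "is_partition la" "degree_only d (schur la)" "symmetric (schur la)" if "la \<in> ?P" for la
  proof -
    have la: "is_partition la" "sum_list la = d" using that by (simp_all add: partitions_of_def)
    show "is_partition la" by (fact la(1))
    show "degree_only d (schur la)" using degree_only_schur[of la] unfolding la(2) .
    show "symmetric (schur la)" using la(1) by (rule symmetric_schur)
  qed
  have nthP: "ps ! i \<in> ?P" if "i < ?N" for i
    unfolding ps(1)[symmetric] using that by (rule nth_mem)
  have KM: "K * M = 1\<^sub>m ?N"
  proof (rule eq_matI)
    fix i k assume "i < dim_row (1\<^sub>m ?N :: rat mat)" "k < dim_col (1\<^sub>m ?N :: rat mat)"
    then have ik: "i < ?N" "k < ?N" by auto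
    have "(K * M) $$ (i, k) = (\<Sum>j \<in> {0..<?N}. rat_of_int
        (schur (ps ! i) (partition_mset (ps ! j)) * schur_extract (ps ! k) (ind (ps ! j))))"
      using ik by (simp add: K_def M_def scalar_prod_def)
    also have "\<dots> = rat_of_int (schur_extract (ps ! k) (schur (ps ! i)))"
      unfolding ext_eq[OF part(3,2)[OF nthP[OF ik(1)]]] of_int_sum reindex ..
    also have "\<dots> = 1\<^sub>m ?N $$ (i, k)"
    proof -
      have "schur_extract (ps ! k) (schur (ps ! i)) = (if ps ! k = ps ! i then 1 else 0)"
        by (rule schur_extract_schur) (rule part(1)[OF nthP], fact ik)+
      moreover have "ps ! k = ps ! i \<longleftrightarrow> i = k"
        using ik ps(2) by (auto simp: nth_eq_iff_index_eq)
      ultimately show ?thesis using ik by simp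
    qed
    finally show "(K * M) $$ (i, k) = 1\<^sub>m ?N $$ (i, k)" .
  qed (auto simp: K_def M_def)
  have MK: "M * K = 1\<^sub>m ?N"
    by (rule mat_mult_left_right_inverse[OF _ _ KM]) (auto simp: K_def M_def)
  have dual: "(\<Sum>la \<in> ?P. schur_extract la (ind al) * schur la (partition_mset be)) = (if al
      = be then 1 else 0)"
    if P: "al \<in> ?P" "be \<in> ?P" for al be
  proof -
    obtain i k where ik: "i < ?N" "k < ?N" "al = ps ! i" "be = ps ! k"
      using P unfolding ps(1)[symmetric] in_set_conv_nth by blast
    have "rat_of_int (\<Sum>la \<in> ?P. schur_extract la (ind al) * schur la (partition_mset be))
        = (M * K) $$ (i, k)"
      unfolding of_int_sum reindex using ik by (simp add: K_def M_def scalar_prod_def)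
    also have "\<dots> = rat_of_int (if al = be then 1 else 0)"
      using ik ps(2) by (simp add: MK nth_eq_iff_index_eq)
    finally show ?thesis by (simp only: of_int_eq_iff)
  qed
  have main: "F A = (\<Sum>la \<in> ?P. schur_extract la F * schur la A)" for A
  proof (cases "size A = d")
    case True
    let ?be = "exponents A"
    have be: "?be \<in> ?P" using exponents_partition True by blast
    have "(\<Sum>la \<in> ?P. schur_extract la F * schur la A) =
        (\<Sum>la \<in> ?P. schur_extract la F * schur la (partition_mset ?be))"
      using part(3) symmetric_exponents by (intro sum.cong) auto
    also have "\<dots> = (\<Sum>la \<in> ?P. \<Sum>al \<in> ?P. F (partition_mset al) *
        (schur_extract la (ind al) * schur la (partition_mset ?be)))"
      unfolding ext_eq[OF F] by (simp add: sum_distrib_right mult.assoc)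
    also have "\<dots> = (\<Sum>al \<in> ?P. F (partition_mset al) *
        (\<Sum>la \<in> ?P. schur_extract la (ind al) * schur la (partition_mset ?be)))"
      by (subst sum.swap) (simp add: sum_distrib_left)
    also have "\<dots> = (\<Sum>al \<in> ?P. if al = ?be then F (partition_mset al) else 0)"
      using dual be by (intro sum.cong) auto
    also have "\<dots> = F A"
      using be finite_partitions_of symmetric_exponents[OF F(1), of A] by (simp add: sum.delta)
    finally show ?thesis by simp
  next
    case False
    then have "schur la A = 0" if "la \<in> ?P" for la using part(2)[OF that]
        by (auto simp: degree_only_def)
    moreover have "F A = 0" using False F(2) by (auto simp: degree_only_def)
    ultimately show ?thesis by simp
  qed
  let ?c = "\<lambda>la. if la \<in> ?P then schur_extract la F else 0"
  have sub: "{la. ?c la \<noteq> 0} \<subseteq> ?P" by auto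
  show ?thesis
    unfolding schur_expansion_def
  proof (intro conjI allI impI)
    show "finite {la. ?c la \<noteq> 0}"
      by (rule finite_subset[OF sub finite_partitions_of])
    show "is_partition la" if "?c la \<noteq> 0" for la
      using sub that part(1)[of la] by auto
    fix A
    have "(\<Sum>la | ?c la \<noteq> 0. ?c la * schur la A) = (\<Sum>la \<in> ?P. ?c la * schur la A)"
      by (rule sum.mono_neutral_left[OF finite_partitions_of sub]) auto
    also have "\<dots> = (\<Sum>la \<in> ?P. schur_extract la F * schur la A)"
      by (rule sum.cong) simp_all
    finally show "F A = (\<Sum>la | ?c la \<noteq> 0. ?c la * schur la A)"
      unfolding main[of A] by (rule sym)
  qed
qed

text \<open>Extraction determines the coefficient at every partition, and elsewhere an expansion is
  zero by definition; so two expansions coincide and the definite description denotes.\<close>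

theorem the_schur_expansion:
  assumes "symmetric F" "degree_only d F" "is_partition la"
  shows "(THE c. schur_expansion F c) la = schur_extract la F"
proof -
  let ?c = "\<lambda>la. if la \<in> partitions_of d then schur_extract la F else 0"
  have "c = c'" if "schur_expansion F c" "schur_expansion F c'" for c c'
  proof
    fix la
    show "c la = c' la"
    proof (cases "is_partition la")
      case True
      then show ?thesis using that schur_extract_expansion by metis
    next
      case False
      then show ?thesis using that unfolding schur_expansion_def by metis
    qed
  qed
  then have "schur_expansion F (THE c. schur_expansion F c)"
    using schur_expansion_exists[OF assms(1,2)] by (metis theI)
  then show ?thesis using schur_extract_expansion[OF _ assms(3)] by metis
qed

subsection \<open>The bases as generating functions of fillings\<close>

datatype kind = Schur | Monomial | PowerSum | Elementary | Homogeneous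

fun basis :: "kind \<Rightarrow> nat list \<Rightarrow> series" where
  "basis Schur = schur"
| "basis Monomial = monomial"
| "basis PowerSum = power_sum"
| "basis Elementary = elementary"
| "basis Homogeneous = homogeneous"

text \<open>
  The conditions on a filling of a diagram with \<open>L\<close> rows of lengths \<open>mu 0, mu 1, \<dots>\<close>; \<open>lt r c r' c'\<close>
  says that the entry in cell \<open>(r, c)\<close> is less than the one in cell \<open>(r', c')\<close>.
\<close>

fun good :: "kind \<Rightarrow> nat \<Rightarrow> (nat \<Rightarrow> nat) \<Rightarrow> (nat \<Rightarrow> nat \<Rightarrow> nat \<Rightarrow> nat \<Rightarrow> bool) \<Rightarrow> bool" where
  "good Homogeneous L mu lt \<longleftrightarrow> (\<forall>r<L. \<forall>c'<mu r. \<forall>c<c'. \<not> lt r c' r c)"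
| "good Elementary L mu lt \<longleftrightarrow> (\<forall>r<L. \<forall>c'<mu r. \<forall>c<c'. lt r c r c')"
| "good PowerSum L mu lt \<longleftrightarrow> (\<forall>r<L. \<forall>c'<mu r. \<forall>c<c'. \<not> lt r c r c' \<and> \<not> lt r c' r c)"
| "good Schur L mu lt \<longleftrightarrow> (\<forall>r<L. \<forall>c'<mu r. \<forall>c<c'. \<not> lt r c' r c) \<and>
     (\<forall>r<L. \<forall>c<mu r. 0 < r \<longrightarrow> lt (r - 1) c r c)"
| "good Monomial L mu lt \<longleftrightarrow> (\<forall>r<L. \<forall>c'<mu r. \<forall>c<c'. \<not> lt r c r c' \<and> \<not> lt r c' r c) \<and>
     (\<forall>r'<L. \<forall>r<r'. (lt r 0 r' 0 \<or> lt r' 0 r 0) \<and> (mu r = mu r' \<longrightarrow> lt r 0 r' 0))"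

text \<open>Entries come from any linear order: numbers in the inner fillings, whole fillings in the
  outer one.\<close>

definition tab :: "kind \<Rightarrow> nat list \<Rightarrow> 'a :: linorder list list \<Rightarrow> bool" where
  "tab k mu T \<longleftrightarrow> map length T = mu \<and>
     good k (length mu) ((!) mu) (\<lambda>r c r' c'. T ! r ! c < T ! r' ! c')"

definition fillings :: "('a list \<Rightarrow> bool) \<Rightarrow> nat list \<Rightarrow> 'a multiset \<Rightarrow> 'a list list set" where
  "fillings R mu A = {T. map length T = mu \<and> (\<forall>r \<in> set T. R r) \<and> mset (concat T) = A}"

lemma finite_fillings_content: "finite {T. map length T = mu \<and> mset (concat T) = A \<and> P T}"
  by (rule finite_subset[OF _ finite_fillings[of "set_mset A" mu]]) (auto simp flip: set_mset_mset)

lemma finite_fillings_rows: "finite (fillings R mu A)"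
  by (rule finite_subset[OF _ finite_fillings_content[of mu A
      "\<lambda>_. True"]]) (auto simp: fillings_def)

lemma finite_submultisets: "finite {B. B \<subseteq># A}"
proof -
  have "{B. B \<subseteq># A} \<subseteq> mset ` {xs. set xs \<subseteq> set_mset A \<and> length xs \<le> size A}"
  proof
    fix B assume "B \<in> {B. B \<subseteq># A}"
    then have B: "B \<subseteq># A" by simp
    obtain xs where xs: "mset xs = B" using ex_mset by blast
    have "set xs \<subseteq> set_mset A" "length xs \<le> size A"
      using set_mset_mono[OF B] size_mset_mono[OF B] xs by auto
    then show "B \<in> mset ` {xs. set xs \<subseteq> set_mset A \<and> length xs \<le> size A}" using xs by blast
  qed
  then show ?thesis using finite_lists_length_le[of "set_mset A" "size A"] finite_surj by blast
qed

text \<open>The submultiset \<open>B\<close> in a product of series is the content of the first row;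
  the rows are filled independently of each other.\<close>

lemma series_prod_rows:
  "series_prod (map (\<lambda>r B. int (card {xs. length xs = r \<and> R xs \<and> mset xs = B})) mu) A =
     int (card (fillings R mu A))"
proof (induction mu arbitrary: A)
  case Nil
  have "fillings R [] A = (if A = {#} then {[]} else {})" by (auto simp: fillings_def)
  then show ?case by (simp add: series_prod_def series_one_def)
next
  case (Cons r mu)
  define N where "N = (\<lambda>B. {xs. length xs = r \<and> R xs \<and> mset xs = B})"
  let ?I = "\<lambda>B. (\<lambda>(xs, T). xs # T) ` (N B \<times> fillings R mu (A - B))"
  have "fillings R (r # mu) A = (\<Union>B \<in> {B. B \<subseteq># A}. ?I B)"
  proof (intro equalityI subsetI)
    fix T assume "T \<in> fillings R (r # mu) A"
    then obtain xs T' where T: "T = xs # T'" "length xs = r" "R xs" "map length T' = mu"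
      "\<forall>r \<in> set T'. R r" "mset xs + mset (concat T') = A"
      by (cases T) (auto simp: fillings_def)
    then have "mset xs \<subseteq># A" "A - mset xs = mset (concat T')" by auto
    then show "T \<in> (\<Union>B \<in> {B. B \<subseteq># A}. ?I B)"
      using T by (intro UN_I[of "mset xs"]) (auto simp: N_def fillings_def)
  qed (auto simp: N_def fillings_def)
  also have "card \<dots> = (\<Sum>B | B \<subseteq># A. card (?I B))"
  proof (rule card_UN_disjoint)
    have fin: "finite (N B)" for B
      by (rule finite_subset[OF _ finite_lists_length_eq[of "set_mset B" r]]) (auto simp: N_def)
    then show "\<forall>B \<in> {B. B \<subseteq># A}. finite (?I B)" using finite_fillings_rows by blast
  qed (auto simp: finite_submultisets N_def)
  also have "\<dots> = (\<Sum>B | B \<subseteq># A. card (N B) * card (fillings R mu (A - B)))"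
    by (intro sum.cong refl) (simp add: card_image inj_on_def card_cartesian_product)
  finally show ?case
    using Cons by (simp add: series_prod_def series_mult_def N_def)
qed

lemma sorted_list_of_multiset_unique:
  assumes "sorted xs" "mset xs = B"
  shows "xs = sorted_list_of_multiset B"
  unfolding assms(2)[symmetric] sorted_list_of_multiset_mset
  using sorted_sort_id[OF assms(1)] by (rule sym)

text \<open>A multiset has exactly one weakly increasing arrangement.\<close>

lemma row_count_homogeneous:
  "homogeneous_n r B = int (card {xs. length xs = r \<and> sorted_wrt (\<le>) xs \<and> mset xs = B})"
    (is "_ = int (card ?X)")
proof (cases "size B = r")
  case True
  have "?X = {sorted_list_of_multiset B}"
  proof (intro equalityI subsetI)
    fix xs assume "xs \<in> ?X"
    then show "xs \<in> {sorted_list_of_multiset B}" using sorted_list_of_multiset_unique[of xs B]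
        by blast
  next
    fix xs assume "xs \<in> {sorted_list_of_multiset B}"
    then show "xs \<in> ?X" using True by (simp flip: size_mset)
  qed
  then show ?thesis using True by (simp add: homogeneous_n_def)
next
  case False
  then have "?X = {}" by (auto simp flip: size_mset)
  then show ?thesis using False by (simp only: homogeneous_n_def card.empty) simp
qed

text \<open>The increasing arrangement of a multiset is strict exactly if no element
  repeats.\<close>

lemma row_count_elementary:
  "elementary_n r B = int (card {xs. length xs = r \<and> sorted_wrt (<) xs \<and> mset xs = B})"
    (is "_ = int (card ?X)")
proof (cases "size B = r \<and> (\<forall>i. count B i \<le> 1)")
  case True
  have "?X = {sorted_list_of_multiset B}"
  proof (intro equalityI subsetI)
    fix xs assume "xs \<in> ?X"
    then have "sorted xs" "mset xs = B" by (simp_all add: strict_sorted_iff)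
    then show "xs \<in> {sorted_list_of_multiset B}" using sorted_list_of_multiset_unique[of xs B]
        by blast
  next
    let ?s = "sorted_list_of_multiset B"
    have "count (mset ?s) a = (if a \<in> set ?s then 1 else 0)" for a
    proof -
      have "count B a \<le> 1" using True by blast
      moreover have "a \<in># B \<longleftrightarrow> 0 < count B a" by simp
      ultimately show ?thesis by (simp del: count_greater_zero_iff)
    qed
    then have "distinct ?s" using distinct_count_atmost_1[of ?s] by blast
    then have "sorted_wrt (<) ?s" by (simp add: strict_sorted_iff)
    moreover have "length ?s = r" using True by (simp flip: size_mset)
    ultimately show "xs \<in> ?X" if "xs \<in> {?s}" for xs using that by simp
  qed
  then show ?thesis using True by (simp add: elementary_n_def)
next
  case False
  have "?X = {}"
  proof (rule ccontr)
    assume "?X \<noteq> {}"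
    then obtain xs where xs: "length xs = r" "sorted_wrt (<) xs" "mset xs = B" by blast
    have "distinct xs" using xs(2) by (simp add: strict_sorted_iff)
    then have "count B i \<le> 1" for i
      using distinct_count_atmost_1[of xs] xs(3) by simp
    moreover have "size B = r" using xs by auto
    ultimately show False using False by blast
  qed
  then show ?thesis using False by (simp only: elementary_n_def card.empty) simp
qed

lemma sorted_wrt_eq_iff: "sorted_wrt (=) xs \<longleftrightarrow> (\<exists>i. xs = replicate (length xs) i)"
proof
  assume *: "sorted_wrt (=) xs"
  have "xs = replicate (length xs) (hd xs)"
  proof (cases xs)
    case (Cons a ys)
    then have "\<forall>b \<in> set xs. b = a" using * by auto
    then show ?thesis using Cons by (intro replicate_eqI) auto
  qed simp
  then show "\<exists>i. xs = replicate (length xs) i" ..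
next
  assume "\<exists>i. xs = replicate (length xs) i"
  then obtain i where "xs = replicate (length xs) i" ..
  moreover have "sorted_wrt (=) (replicate n i)" for n
    by (simp add: sorted_wrt_iff_nth_less)
  ultimately show "sorted_wrt (=) xs" by metis
qed

lemma row_count_power_sum:
  assumes "0 < r"
  shows "power_sum_n r B = int (card {xs. length xs = r \<and> sorted_wrt (=) xs \<and> mset xs = B})"
    (is "_ = int (card ?X)")
proof (cases "\<exists>i. B = replicate_mset r i")
  case True
  then obtain i where i: "B = replicate_mset r i" ..
  have "?X = {replicate r i}"
  proof (intro equalityI subsetI)
    fix xs assume "xs \<in> ?X"
    then have xs: "length xs = r" "mset xs = replicate_mset r i" by (auto simp: i)
    then have "set xs = {i}" using assms by (simp flip: set_mset_mset)
    then show "xs \<in> {replicate r i}" using xs(1) by (auto intro: replicate_eqI)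
  qed (auto simp: i sorted_wrt_eq_iff)
  then show ?thesis using True by (simp add: power_sum_n_def)
next
  case False
  have "?X = {}"
    using False unfolding sorted_wrt_eq_iff by auto (metis mset_replicate)
  then show ?thesis using False by (simp only: power_sum_n_def card.empty) simp
qed

lemma good_rows:
  assumes "map length T = mu"
  shows "(\<forall>r<length mu. \<forall>c'<mu ! r. \<forall>c<c'. Q (T ! r ! c) (T ! r ! c')) \<longleftrightarrow>
      (\<forall>r \<in> set T. sorted_wrt Q r)"
  using assms by (auto simp: sorted_wrt_iff_nth_less all_set_conv_all_nth)

lemma neither_less: "\<not> a < b \<and> \<not> b < a \<longleftrightarrow> a = (b :: 'a :: linorder)"
  by auto

lemma tab_simps:
  "tab Homogeneous mu T \<longleftrightarrow> map length T = mu \<and> (\<forall>r \<in> set T. sorted_wrt (\<le>) r)"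
  "tab Elementary mu T \<longleftrightarrow> map length T = mu \<and> (\<forall>r \<in> set T. sorted_wrt (<) r)"
  "tab PowerSum mu T \<longleftrightarrow> map length T = mu \<and> (\<forall>r \<in> set T. sorted_wrt (=) r)"
  unfolding tab_def good.simps not_less neither_less[unfolded not_less]
  by (intro conj_cong refl good_rows; assumption)+

lemma tab_Schur:
  fixes T :: "nat list list"
  shows "tab Schur mu T \<longleftrightarrow> ssyt mu T"
proof -
  have "(\<forall>r<length mu. \<forall>c<mu ! r. 0 < r \<longrightarrow> T ! (r - 1) ! c < T ! r ! c) \<longleftrightarrow>
      (\<forall>i j. Suc i < length T \<and> j < length (T ! Suc i) \<longrightarrow> T ! i ! j < T ! Suc i ! j)"
    (is "?l \<longleftrightarrow> ?r") if mu: "map length T = mu"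
  proof
    assume ?l
    then show ?r using mu by (metis diff_Suc_1 length_map nth_map zero_less_Suc)
  next
    assume r: ?r
    show ?l
    proof (intro allI impI)
      fix r c assume "r < length mu" "c < mu ! r" "0 < r"
      then show "T ! (r - 1) ! c < T ! r ! c" using r mu by (cases r) auto
    qed
  qed
  then show ?thesis
    unfolding tab_def ssyt_def good.simps not_less
    using good_rows[of T mu "(\<le>)"] by blast
qed

lemma tab_Monomial:
  "tab Monomial mu T \<longleftrightarrow> map length T = mu \<and> (\<forall>r \<in> set T. sorted_wrt (=) r) \<and>
    (\<forall>r'<length mu. \<forall>r<r'. T ! r ! 0 \<noteq> T ! r' ! 0 \<and> (mu ! r = mu ! r' \<longrightarrow> T ! r ! 0 < T ! r' ! 0))"
  unfolding tab_def good.simps not_less neither_less[unfolded not_less] neq_iff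
  by (intro conj_cong refl good_rows; assumption)

section \<open>Monomial symmetric functions as fillings with constant rows\<close>

definition constant_rows :: "nat list \<Rightarrow> 'a list \<Rightarrow> 'a list list" where
  "constant_rows mu v = map2 replicate mu v"

lemma mset_constant_rows:
  assumes "length v = length mu"
  shows "mset (concat (constant_rows mu v)) = (\<Sum>i<length mu. replicate_mset (mu ! i) (v ! i))"
  using assms
proof (induction v mu rule: list_induct2)
  case (Cons x v m mu)
  then show ?case
    by (simp add: constant_rows_def sum.lessThan_Suc_shift del: sum.lessThan_Suc)
qed (simp add: constant_rows_def)

text \<open>\<open>v ! r\<close> is the variable that carries the exponent \<open>mu ! r\<close>.
  The order imposed among equal parts selects one of the assignments that give the same
  monomial.\<close>

definition monomial_key :: "nat list \<Rightarrow> 'a :: linorder list \<Rightarrow> bool" where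
  "monomial_key mu v \<longleftrightarrow> length v = length mu \<and>
     (\<forall>r'<length mu. \<forall>r<r'. v ! r \<noteq> v ! r' \<and> (mu ! r = mu ! r' \<longrightarrow> v ! r < v ! r'))"

text \<open>Since no row is empty, column 0 shows the constant value of every row, and this is where
  \<open>good\<close> compares rows.\<close>

lemma tab_Monomial_iff:
  assumes "0 \<notin> set mu"
  shows "tab Monomial mu T \<longleftrightarrow> (\<exists>v. monomial_key mu v \<and> T = constant_rows mu v)"
proof
  assume T: "tab Monomial mu T"
  then have len: "map length T = mu" by (simp add: tab_Monomial)
  define v where "v = map (\<lambda>r. r ! 0) T"
  have rows: "T ! r = replicate (mu ! r) (v ! r)" "v ! r = T ! r ! 0" if "r < length mu" for r
  proof -
    have r: "r < length T" using that len by auto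
    then have "sorted_wrt (=) (T ! r)" using T by (simp add: tab_Monomial)
    then obtain a where a: "T ! r = replicate (length (T ! r)) a" unfolding sorted_wrt_eq_iff ..
    have l: "length (T ! r) = mu ! r" using r len by auto
    have "mu ! r \<noteq> 0" using that assms nth_mem by metis
    moreover have Tr: "T ! r = replicate (mu ! r) a" using a unfolding l .
    ultimately have "T ! r ! 0 = a" by simp
    then show "v ! r = T ! r ! 0" "T ! r = replicate (mu ! r) (v ! r)" using Tr r
        by (simp_all add: v_def)
  qed
  have lv: "length v = length mu" using len by (auto simp: v_def)
  have "T = constant_rows mu v"
    by (rule nth_equalityI) (use len lv rows in \<open>auto simp: constant_rows_def\<close>)
  moreover have "monomial_key mu v"
    unfolding monomial_key_def
  proof (intro conjI allI impI)
    fix r' r assume *: "r' < length mu" "r < r'"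
    then have "v ! r = T ! r ! 0" "v ! r' = T ! r' ! 0" using rows(2) by simp_all
    then show "v ! r \<noteq> v ! r'" "mu ! r = mu ! r' \<Longrightarrow> v ! r < v ! r'"
      using T * unfolding tab_Monomial by auto
  qed (fact lv)
  ultimately show "\<exists>v. monomial_key mu v \<and> T = constant_rows mu v" by blast
next
  assume "\<exists>v. monomial_key mu v \<and> T = constant_rows mu v"
  then obtain v where v: "monomial_key mu v" "T = constant_rows mu v" by blast
  have lv: "length v = length mu" using v by (simp add: monomial_key_def)
  have nth: "T ! r = replicate (mu ! r) (v ! r)" if "r < length mu" for r
    using that lv by (simp add: v constant_rows_def)
  have nth0: "T ! r ! 0 = v ! r" if "r < length mu" for r
  proof -
    have "mu ! r \<noteq> 0" using that assms nth_mem by metis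
    then show ?thesis using nth[OF that] by simp
  qed
  have lenT: "length T = length mu" using lv by (simp add: v constant_rows_def)
  have "map length T = mu"
    by (rule nth_equalityI) (use nth lenT in auto)
  moreover have "\<forall>r \<in> set T. sorted_wrt (=) r"
    unfolding all_set_conv_all_nth lenT using nth by (simp add: sorted_wrt_eq_iff)
  moreover have "T ! r ! 0 \<noteq> T ! r' ! 0 \<and> (mu ! r = mu ! r' \<longrightarrow> T ! r ! 0 < T ! r' ! 0)"
    if "r' < length mu" "r < r'" for r r'
    using v(1) that nth0[of r] nth0[of r'] by (simp add: monomial_key_def)
  ultimately show "tab Monomial mu T"
    unfolding tab_Monomial by blast
qed

lemma distinct_monomial_key: "monomial_key mu v \<Longrightarrow> distinct v"
  unfolding monomial_key_def distinct_conv_nth by (metis linorder_neqE_nat)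

lemma count_monomial_key:
  assumes "monomial_key mu v" "i < length mu"
  shows "count (\<Sum>i<length mu. replicate_mset (mu ! i) (v ! i)) (v ! i) = mu ! i"
proof -
  have "bij_betw ((!) v) {..<length mu} (set v)"
    using bij_betw_nth[OF distinct_monomial_key[OF assms(1)] refl refl] assms(1)
        by (simp add: monomial_key_def)
  then show ?thesis using count_sum_replicate[of "(!) v" "{..<length mu}" "set v" i
      "(!) mu"] assms(2) by simp
qed

lemma set_monomial_key:
  assumes "monomial_key mu v" "0 \<notin> set mu"
  shows "set_mset (\<Sum>i<length mu. replicate_mset (mu ! i) (v ! i)) = set v"
proof -
  have "mu ! i \<noteq> 0" if "i < length mu" for i using that assms(2) nth_mem by metis
  then have "(\<Union>i<length mu. set_mset (replicate_mset (mu ! i) (v ! i))) = (\<Union>i<length mu. {v ! i})"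
    by (intro SUP_cong refl) simp
  also have "\<dots> = set v"
    using assms(1) by (auto simp: in_set_conv_nth monomial_key_def)
  finally show ?thesis by (simp add: set_mset_sum)
qed

text \<open>An assignment for the monomial \<open>A\<close> has to list its variables by decreasing
  exponent and, for equal exponents, by increasing index. This lexicographic order is packed into a
  single number.\<close>

lemma sort_by_exponent:
  fixes A :: "nat multiset"
  obtains key :: "nat \<Rightarrow> nat" where "inj_on key (set_mset A)"
    "\<And>x y. x \<in># A \<Longrightarrow> y \<in># A \<Longrightarrow> key x < key y \<longleftrightarrow> count A y < count A x \<or> count A x = count A y \<and> x < y"
proof -
  define M where "M = size A"
  define K where "K = Suc (Max (insert 0 (set_mset A)))"
  \<comment> \<open>\<open>K\<close> exceeds every variable of \<open>A\<close>, so \<open>x\<close>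
    acts as a lower digit, while \<open>M - count A x\<close> reverses the order of the
    exponents.\<close>
  define key where "key = (\<lambda>x. (M - count A x) * K + x)"
  have K: "x < K" if "x \<in># A" for x
  proof -
    have "x \<le> Max (insert 0 (set_mset A))" using that by (intro Max_ge) auto
    then show ?thesis by (simp add: K_def)
  qed
  have M: "count A x \<le> M" for x by (simp add: M_def count_le_size)
  have less: "key x < key y" if "x \<in># A" "y \<in># A" "count A y < count A x" for x y
  proof -
    have "Suc (M - count A x) \<le> M - count A y" using that M[of x] by linarith
    then have "Suc (M - count A x) * K \<le> (M - count A y) * K" by (rule mult_le_mono1)
    then show ?thesis using K[OF that(1)] by (simp add: key_def)
  qed
  have iff: "key x < key y \<longleftrightarrow> count A y < count A x \<or> count A x = count A y \<and> x < y"
    if "x \<in># A" "y \<in># A" for x y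
  proof (cases "count A x" "count A y" rule: linorder_cases)
    case less
    then show ?thesis using \<open>\<And>x y. x \<in># A \<Longrightarrow> y \<in># A \<Longrightarrow> count A y < count A x
        \<Longrightarrow> key x < key y\<close>[of y x] that by simp
  next
    case equal
    then show ?thesis by (simp add: key_def)
  next
    case greater
    then show ?thesis using \<open>\<And>x y. x \<in># A \<Longrightarrow> y \<in># A \<Longrightarrow> count A y < count A x
        \<Longrightarrow> key x < key y\<close>[of x y] that by simp
  qed
  have "inj_on key (set_mset A)"
  proof (rule inj_onI)
    fix x y assume *: "x \<in># A" "y \<in># A" "key x = key y"
    then have "\<not> key x < key y" "\<not> key y < key x" by simp_all
    then show "x = y" unfolding iff[OF *(1,2)] iff[OF *(2,1)] by auto
  qed
  then show ?thesis using iff by (rule that)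
qed

lemma decreasing_mset_unique:
  fixes xs ys :: "'a :: linorder list"
  assumes "sorted_wrt (\<ge>) xs" "sorted_wrt (\<ge>) ys" "mset xs = mset ys"
  shows "xs = ys"
proof -
  have "sorted (rev xs)" "sorted (rev ys)" using assms(1,2) by (simp_all add: sorted_wrt_rev)
  then have "rev xs = sorted_list_of_multiset (mset ys)" "rev ys
      = sorted_list_of_multiset (mset ys)"
    using assms(3) by (intro sorted_list_of_multiset_unique; simp)+
  then show ?thesis by (metis rev_rev_ident)
qed

lemma mset_key_image: "image_mset (count A) (mset_set (set_mset A)) = mset (map (count A) v)"
  if "distinct v" "set v = set_mset A"
  using that by (metis mset_map mset_set_set)

text \<open>Fillings correspond to assignments \<open>v\<close>, and any such \<open>v\<close> is
  the list of the variables of \<open>A\<close> sorted by \<open>key\<close>. So there is at most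
  one, and it exists exactly if the sorted exponents form \<open>mu\<close>.\<close>

lemma monomial_count:
  assumes mu: "is_partition mu"
  shows "monomial mu A = int (card {T :: nat list list. tab Monomial mu T \<and> mset (concat T) = A})"
proof -
  have pos: "0 \<notin> set mu" using mu by (simp add: is_partition_def)
  define V where "V = {v. monomial_key mu v \<and> (\<Sum>i<length mu. replicate_mset (mu ! i) (v ! i)) = A}"
  have "{T :: nat list list. tab Monomial mu T \<and> mset (concat T) = A} = constant_rows mu ` V"
    unfolding tab_Monomial_iff[OF pos] V_def
    by (auto simp: mset_constant_rows monomial_key_def)
  moreover have "inj_on (constant_rows mu) V"
  proof (rule inj_onI)
    fix v v' assume *: "v \<in> V" "v' \<in> V" "constant_rows mu v = constant_rows mu v'"
    then have len: "length v = length mu" "length v' = length mu"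
        by (auto simp: V_def monomial_key_def)
    show "v = v'"
    proof (rule nth_equalityI)
      fix i assume "i < length v"
      then have i: "i < length mu" using len by simp
      have "mu ! i \<noteq> 0" using i pos nth_mem by metis
      moreover have "constant_rows mu v ! i = constant_rows mu v' ! i" using * by simp
      then have "replicate (mu ! i) (v ! i) = replicate (mu ! i) (v' ! i)"
        using i len by (simp add: constant_rows_def)
      ultimately show "v ! i = v' ! i" by simp
    qed (use len in simp)
  qed
  ultimately have card: "card {T :: nat list list. tab Monomial mu T \<and> mset (concat T) = A}
      = card V"
    by (simp add: card_image)
  obtain key :: "nat \<Rightarrow> nat" where key: "inj_on key (set_mset A)"
    "\<And>x y. x \<in># A \<Longrightarrow> y \<in># A \<Longrightarrow> key x < key y \<longleftrightarrow> count A y < count A x \<or> count A x = count A y \<and> x < y"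
    by (rule sort_by_exponent[of A]) (rule that)
  have V: "set v = set_mset A" "sorted_wrt (\<lambda>x y. key x < key y) v" "map (count A) v = mu" if
      "v \<in> V" for v
  proof -
    have v: "monomial_key mu v" "(\<Sum>i<length mu. replicate_mset (mu ! i) (v ! i)) = A"
      using that by (auto simp: V_def)
    show set: "set v = set_mset A" using set_monomial_key[OF v(1) pos] v(2) by simp
    have cnt: "count A (v ! i) = mu ! i" if "i < length mu" for i
      using count_monomial_key[OF v(1) that] v(2) by simp
    have len: "length v = length mu" using v(1) by (simp add: monomial_key_def)
    show "map (count A) v = mu"
      by (rule nth_equalityI) (use len cnt in auto)
    show "sorted_wrt (\<lambda>x y. key x < key y) v"
      unfolding sorted_wrt_iff_nth_less len
    proof (intro allI impI)
      fix i j assume ij: "i < j" "j < length mu"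
      have "v ! i \<in># A" "v ! j \<in># A" using ij len nth_mem[of i v] nth_mem[of j v] set by auto
      moreover have "mu ! j \<le> mu ! i"
        using mu ij sorted_wrt_nth_less[of "(\<ge>)" mu i j] by (simp add: is_partition_def)
      moreover have "mu ! i = mu ! j \<Longrightarrow> v ! i < v ! j"
        using v(1) ij by (simp add: monomial_key_def)
      ultimately show "key (v ! i) < key (v ! j)"
        using key(2)[of "v ! i" "v ! j"] cnt[of i] cnt[of j] ij by auto
    qed
  qed
  have unique: "v = v'" if "v \<in> V" "v' \<in> V" for v v'
  proof -
    have "sorted_wrt (<) (map key v)" "sorted_wrt (<) (map key v')"
      using V(2)[OF that(1)] V(2)[OF that(2)] by (simp_all add: sorted_wrt_map)
    moreover have "set (map key v') = set (map key v)" using V(1)[OF that(1)] V(1)[OF that(2)]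
        by simp
    ultimately have "map key v' = map key v" by (rule strict_sorted_equal)
    moreover have "inj_on key (set v' \<union> set v)"
      using key(1) V(1)[OF that(1)] V(1)[OF that(2)] by simp
    ultimately show ?thesis using inj_on_map_eq_map by blast
  qed
  show ?thesis
  proof (cases "image_mset (count A) (mset_set (set_mset A)) = mset mu")
    case True
    \<comment> \<open>Sorting the keys and pulling them back yields the only candidate.\<close>
    define ks where "ks = sorted_list_of_set (key ` set_mset A)"
    define v where "v = map (inv_into (set_mset A) key) ks"
    have inv: "inv_into (set_mset A) key (key x) = x" if "x \<in># A" for x
      using that key(1) by (rule inv_into_f_f[rotated])
    have set_ks: "set ks = key ` set_mset A" by (simp add: ks_def)
    have key_v: "map key v = ks"
      unfolding v_def map_map
    proof (rule map_idI)
      fix k assume "k \<in> set ks"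
      then obtain x where "x \<in># A" "k = key x" unfolding set_ks by blast
      then show "(key \<circ> inv_into (set_mset A) key) k = k" by (simp add: inv)
    qed
    have set_v: "set v = set_mset A"
    proof -
      have "set v = (\<lambda>x. inv_into (set_mset A) key (key x)) ` set_mset A"
        by (simp only: v_def set_map set_ks image_image)
      also have "\<dots> = (\<lambda>x. x) ` set_mset A" by (rule image_cong[OF refl inv])
      finally show ?thesis by simp
    qed
    have sorted_v: "sorted_wrt (\<lambda>x y. key x < key y) v"
    proof -
      have "sorted_wrt (<) (map key v)" unfolding key_v ks_def by (rule strict_sorted_list_of_set)
      then show ?thesis by (simp only: sorted_wrt_map)
    qed
    have "distinct v"
    proof -
      have "distinct (map key v)" unfolding key_v ks_def by simp
      then show ?thesis by (simp add: distinct_map)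
    qed
    have "sorted_wrt (\<ge>) (map (count A) v)"
      unfolding sorted_wrt_map
    proof (rule sorted_wrt_mono_rel[OF _ sorted_v])
      fix x y assume "x \<in> set v" "y \<in> set v" "key x < key y"
      then show "count A y \<le> count A x" using key(2)[of x y] set_v by auto
    qed
    moreover have "mset (map (count A) v) = mset mu"
      using True mset_key_image[OF \<open>distinct v\<close> set_v] by simp
    ultimately have map_v: "map (count A) v = mu"
      using mu unfolding is_partition_def by (intro decreasing_mset_unique) auto
    have len: "length v = length mu" unfolding map_v[symmetric] by simp
    have cnt: "mu ! i = count A (v ! i)" if "i < length mu" for i
    proof -
      have "map (count A) v ! i = count A (v ! i)" using that len by simp
      then show ?thesis unfolding map_v .
    qed
    have "v ! r \<noteq> v ! r' \<and> (mu ! r = mu ! r' \<longrightarrow> v ! r < v ! r')" if "r' < length mu" "r < r'"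
        for r r'
    proof -
      have "key (v ! r) < key (v ! r')"
        using sorted_v that len by (simp add: sorted_wrt_iff_nth_less)
      moreover have "v ! r \<in># A" "v ! r' \<in># A"
        using that len nth_mem[of r v] nth_mem[of r' v] set_v by auto
      ultimately show ?thesis
        using key(2)[of "v ! r" "v ! r'"] that cnt[of r] cnt[of r'] by auto
    qed
    then have mk: "monomial_key mu v" using len by (simp add: monomial_key_def)
    have "(\<Sum>i<length mu. replicate_mset (mu ! i) (v ! i)) = (\<Sum>i<length v. replicate_mset (count A
        (v ! i)) (v ! i))"
      unfolding len by (rule sum.cong) (simp_all only: cnt lessThan_iff)
    also have "\<dots> = (\<Sum>x \<in> set_mset A. replicate_mset (count A x) x)"
      using bij_betw_nth[OF \<open>distinct v\<close> refl set_v[symmetric]] by (rule sum.reindex_bij_betw)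
    also have "\<dots> = A" by (rule sum_replicate_mset_support)
    finally have "v \<in> V" using mk by (simp add: V_def)
    then have "V = {v}" using unique by blast
    then show ?thesis using True card by (simp add: monomial_def)
  next
    case False
    have "V = {}"
    proof (rule ccontr)
      assume "V \<noteq> {}"
      then obtain v where v: "v \<in> V" by blast
      have "distinct v" using v by (auto simp: V_def intro: distinct_monomial_key)
      then show False using mset_key_image[OF _ V(1)[OF v]] V(3)[OF v] False by simp
    qed
    then show ?thesis using False card by (simp add: monomial_def)
  qed
qed

theorem basis_count:
  assumes "is_partition mu"
  shows "basis k mu A = int (card {T :: nat list list. tab k mu T \<and> mset (concat T) = A})"
proof (cases k)
  case Schur
  then show ?thesis by (simp add: schur_def tab_Schur)
next
  case Monomial
  then show ?thesis using monomial_count[OF assms] by simp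
next
  case PowerSum
  have "map power_sum_n mu = map (\<lambda>r B. int (card {xs. length xs = r \<and> sorted_wrt (=) xs \<and> mset xs
      = B})) mu"
  proof (rule map_cong[OF refl])
    fix r assume "r \<in> set mu"
    then have "0 < r" using assms by (auto simp: is_partition_def intro: Nat.gr0I)
    then show "power_sum_n r = (\<lambda>B. int (card {xs. length xs = r \<and> sorted_wrt (=) xs \<and> mset xs
        = B}))"
      by (intro ext row_count_power_sum)
  qed
  then have "power_sum mu A = int (card (fillings (sorted_wrt (=)) mu A))"
    unfolding power_sum_def by (simp only: series_prod_rows)
  then show ?thesis
    using PowerSum by (simp add: fillings_def tab_simps)
next
  case Elementary
  have "elementary_n = (\<lambda>r B. int (card {xs. length xs = r \<and> sorted_wrt (<) xs \<and> mset xs = B}))"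
    by (intro ext row_count_elementary)
  then show ?thesis
    using Elementary series_prod_rows[of "sorted_wrt (<)" mu A]
    by (simp add: elementary_def fillings_def tab_simps)
next
  case Homogeneous
  have "homogeneous_n = (\<lambda>r B. int (card {xs. length xs = r \<and> sorted_wrt (\<le>) xs \<and> mset xs = B}))"
    by (intro ext row_count_homogeneous)
  then show ?thesis
    using Homogeneous series_prod_rows[of "sorted_wrt (\<le>)" mu A]
    by (simp add: homogeneous_def fillings_def tab_simps)
qed

lemma degree_only_basis:
  assumes "is_partition mu"
  shows "degree_only (sum_list mu) (basis k mu)"
  unfolding degree_only_def
proof (intro allI impI)
  fix A assume "basis k mu A \<noteq> 0"
  then have "{T :: nat list list. tab k mu T \<and> mset (concat T) = A} \<noteq> {}"
    unfolding basis_count[OF assms] by (metis card.empty of_nat_0)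
  then obtain T :: "nat list list" where "map length T = mu" "mset (concat T) = A"
      by (auto simp: tab_def)
  then show "size A = sum_list mu" by (auto simp: length_concat)
qed

subsection \<open>Symmetry of the bases\<close>

lemma count_image_mset_inj_on:
  assumes "inj_on \<phi> (set_mset A)" "x \<in># A"
  shows "count (image_mset \<phi> A) (\<phi> x) = count A x"
proof -
  have "\<phi> -` {\<phi> x} \<inter> set_mset A = {x}" using assms by (auto simp: inj_on_def)
  then show ?thesis by (simp add: count_image_mset)
qed

lemma image_mset_inv_into:
  assumes "inj_on \<phi> (set_mset A)" "B \<subseteq># A"
  shows "image_mset (inv_into (set_mset A) \<phi>) (image_mset \<phi> B) = B"
proof -
  have "inv_into (set_mset A) \<phi> (\<phi> x) = x" if "x \<in># B" for x
    using assms mset_subset_eqD[OF assms(2) that] by simp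
  then have "image_mset (inv_into (set_mset A) \<phi> \<circ> \<phi>) B = image_mset id B"
    by (intro image_mset_cong) simp
  then show ?thesis by (simp add: multiset.map_comp)
qed

lemma submset_image:
  assumes "inj_on \<phi> (set_mset A)" "B \<subseteq># image_mset \<phi> A"
  shows "image_mset (inv_into (set_mset A) \<phi>) B \<subseteq># A"
    "image_mset \<phi> (image_mset (inv_into (set_mset A) \<phi>) B) = B"
proof -
  show "image_mset (inv_into (set_mset A) \<phi>) B \<subseteq># A"
    using image_mset_subseteq_mono[OF assms(2), of "inv_into (set_mset A) \<phi>"]
      image_mset_inv_into[OF assms(1) subset_mset.order_refl] by simp
  have "\<phi> (inv_into (set_mset A) \<phi> x) = x" if "x \<in># B" for x
    using mset_subset_eqD[OF assms(2) that] by (auto intro: f_inv_into_f)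
  then have "image_mset (\<phi> \<circ> inv_into (set_mset A) \<phi>) B = image_mset id B"
    by (intro image_mset_cong) simp
  then show "image_mset \<phi> (image_mset (inv_into (set_mset A) \<phi>) B) = B"
    by (simp add: multiset.map_comp)
qed

text \<open>One implication suffices: the converse follows by applying it to the inverse
  relabelling.\<close>

lemma symmetric_indicator:
  assumes "\<And>A \<phi>. inj_on \<phi> (set_mset A) \<Longrightarrow> P A \<Longrightarrow> P (image_mset \<phi> A)"
  shows "symmetric (\<lambda>A. if P A then 1 else 0)"
  unfolding symmetric_def
proof (intro allI impI)
  fix A :: "nat multiset" and \<phi> :: "nat \<Rightarrow> nat"
  assume inj: "inj_on \<phi> (set_mset A)"
  have "P A" if "P (image_mset \<phi> A)"
  proof -
    have "inj_on (inv_into (set_mset A) \<phi>) (set_mset (image_mset \<phi> A))"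
      by (simp add: inj_on_inv_into)
    from assms[OF this that] show ?thesis
      using image_mset_inv_into[OF inj subset_mset.order_refl] by simp
  qed
  then show "(if P (image_mset \<phi> A) then 1 else 0) = (if P A then 1 else 0 :: int)"
    using assms[OF inj] by auto
qed

text \<open>Under an injective relabelling the divisors of the image are the images of the divisors,
  and complements correspond as well.\<close>

lemma symmetric_mult:
  assumes "symmetric F" "symmetric G"
  shows "symmetric (series_mult F G)"
  unfolding symmetric_def
proof (intro allI impI)
  fix A :: "nat multiset" and \<phi> :: "nat \<Rightarrow> nat"
  assume inj: "inj_on \<phi> (set_mset A)"
  let ?\<psi> = "inv_into (set_mset A) \<phi>"
  show "series_mult F G (image_mset \<phi> A) = series_mult F G A"
    unfolding series_mult_def
  proof (rule sum.reindex_bij_witness[of _ "image_mset \<phi>" "image_mset ?\<psi>"])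
    fix B assume "B \<in> {B. B \<subseteq># A}"
    then have B: "B \<subseteq># A" by simp
    show "image_mset ?\<psi> (image_mset \<phi> B) = B" by (rule image_mset_inv_into[OF inj B])
    show "image_mset \<phi> B \<in> {B. B \<subseteq># image_mset \<phi> A}" using B by (simp add: image_mset_subseteq_mono)
  next
    fix B assume "B \<in> {B. B \<subseteq># image_mset \<phi> A}"
    then have B: "B \<subseteq># image_mset \<phi> A" by simp
    note s = submset_image[OF inj B]
    show "image_mset \<phi> (image_mset ?\<psi> B) = B" by (rule s)
    show "image_mset ?\<psi> B \<in> {B. B \<subseteq># A}" using s by simp
    define B' where "B' = image_mset ?\<psi> B"
    have B': "B' \<subseteq># A" "image_mset \<phi> B' = B" using s by (simp_all add: B'_def)
    have "F (image_mset \<phi> B') = F B'"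
      using assms(1) inj_on_subset[OF inj set_mset_mono[OF B'(1)]] unfolding symmetric_def by blast
    moreover have "G (image_mset \<phi> (A - B')) = G (A - B')"
      using assms(2) inj_on_subset[OF inj set_mset_mono[of "A - B'" A]] unfolding symmetric_def
          by simp
    moreover have "image_mset \<phi> (A - B') = image_mset \<phi> A - B"
      using image_mset_Diff[OF B'(1), of \<phi>] B'(2) by simp
    ultimately show "F (image_mset ?\<psi> B) * G (A - image_mset ?\<psi> B) = F B * G (image_mset \<phi> A - B)"
      using B'(2) by (simp flip: B'_def)
  qed
qed

lemma symmetric_prod: "(\<And>F. F \<in> set Fs \<Longrightarrow> symmetric F) \<Longrightarrow> symmetric (series_prod Fs)"
proof (induction Fs)
  case Nil
  have "symmetric (\<lambda>A. if A = {#} then 1 else 0)" by (rule symmetric_indicator) simp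
  then show ?case by (simp add: series_prod_def series_one_def[abs_def])
next
  case (Cons F Fs)
  then show ?case using symmetric_mult by (simp add: series_prod_def)
qed

theorem symmetric_basis:
  assumes "is_partition mu"
  shows "symmetric (basis k mu)"
proof (cases k)
  case Schur
  then show ?thesis using symmetric_schur[OF assms] by simp
next
  case Monomial
  have "symmetric (\<lambda>A. if image_mset (count A) (mset_set (set_mset A)) = mset mu then 1 else 0)"
  proof (rule symmetric_indicator)
    fix A :: "nat multiset" and \<phi> :: "nat \<Rightarrow> nat"
    assume inj: "inj_on \<phi> (set_mset A)" and A: "image_mset (count A) (mset_set (set_mset A))
        = mset mu"
    have "image_mset (count (image_mset \<phi> A)) (mset_set (set_mset (image_mset \<phi> A))) =
        image_mset (count (image_mset \<phi> A) \<circ> \<phi>) (mset_set (set_mset A))"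
      using image_mset_mset_set[OF inj] by (simp flip: multiset.map_comp)
    also have "\<dots> = image_mset (count A) (mset_set (set_mset A))"
      using count_image_mset_inj_on[OF inj] by (intro image_mset_cong) simp
    finally show "image_mset (count (image_mset \<phi> A)) (mset_set (set_mset (image_mset \<phi> A)))
        = mset mu"
      using A by simp
  qed
  then show ?thesis using Monomial by (simp add: monomial_def[abs_def])
next
  case PowerSum
  have "symmetric (power_sum_n r)" for r
    unfolding power_sum_n_def[abs_def] by (rule symmetric_indicator) auto
  then show ?thesis using PowerSum by (auto simp: power_sum_def intro!: symmetric_prod)
next
  case Elementary
  have "symmetric (elementary_n r)" for r
    unfolding elementary_n_def[abs_def]
  proof (rule symmetric_indicator)
    fix A :: "nat multiset" and \<phi> :: "nat \<Rightarrow> nat"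
    assume inj: "inj_on \<phi> (set_mset A)" and A: "size A = r \<and> (\<forall>i. count A i \<le> 1)"
    have "count (image_mset \<phi> A) j \<le> 1" for j
    proof (cases "j \<in># image_mset \<phi> A")
      case True
      then obtain i where "i \<in># A" "j = \<phi> i" by auto
      then show ?thesis using count_image_mset_inj_on[OF inj, of i] A by simp
    next
      case False
      then have "count (image_mset \<phi> A) j = 0" by (simp only: not_in_iff)
      then show ?thesis by simp
    qed
    then show "size (image_mset \<phi> A) = r \<and> (\<forall>i. count (image_mset \<phi> A) i \<le> 1)" using A by simp
  qed
  then show ?thesis using Elementary by (auto simp: elementary_def intro!: symmetric_prod)
next
  case Homogeneous
  have "symmetric (homogeneous_n r)" for r
    unfolding homogeneous_n_def[abs_def] by (rule symmetric_indicator) simp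
  then show ?thesis using Homogeneous by (auto simp: homogeneous_def intro!: symmetric_prod)
qed

subsection \<open>Plethysm\<close>

definition mono_at :: "nat \<Rightarrow> nat multiset" where
  "mono_at m = fst (from_nat m :: nat multiset \<times> nat)"

definition copy_at :: "nat \<Rightarrow> nat" where
  "copy_at m = snd (from_nat m :: nat multiset \<times> nat)"

text \<open>The first conjunct says that \<open>m\<close> lies in the range of
  \<open>to_nat\<close>; outside it the value of \<open>from_nat\<close> is arbitrary.\<close>

definition valid_index :: "series \<Rightarrow> nat \<Rightarrow> bool" where
  "valid_index G m \<longleftrightarrow> to_nat (mono_at m, copy_at m) = m \<and> int (copy_at m) < G (mono_at m)"

lemma at_to_nat [simp]: "mono_at (to_nat (\<tau> :: nat multiset, j :: nat)) = \<tau>"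
  "copy_at (to_nat (\<tau> :: nat multiset, j :: nat)) = j"
  by (simp_all add: mono_at_def copy_at_def)

lemma monomial_at_eq: "monomial_at G m = (if valid_index G m then Some (mono_at m) else None)"
proof -
  have "(\<exists>\<tau> j. m = to_nat (\<tau> :: nat multiset, j :: nat) \<and> int j < G \<tau>) \<longleftrightarrow> valid_index G m"
  proof
    assume "\<exists>\<tau> j. m = to_nat (\<tau> :: nat multiset, j :: nat) \<and> int j < G \<tau>"
    then obtain \<tau> j where "m = to_nat (\<tau> :: nat multiset, j :: nat)" "int j < G \<tau>" by blast
    then show "valid_index G m" by (simp add: valid_index_def)
  next
    assume "valid_index G m"
    then have "m = to_nat (mono_at m, copy_at m)" "int (copy_at m) < G (mono_at m)"
      by (simp_all add: valid_index_def)
    then show "\<exists>\<tau> j. m = to_nat (\<tau> :: nat multiset, j :: nat) \<and> int j < G \<tau>" by blast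
  qed
  then show ?thesis by (simp add: monomial_at_def mono_at_def)
qed

lemma plethysm_eq:
  "plethysm F G A = (\<Sum>C | F C \<noteq> 0 \<and> (\<forall>m \<in># C. valid_index G m) \<and> (\<Sum>m \<in># C. mono_at m) = A. F C)"
proof -
  have "(\<forall>m \<in># C. monomial_at G m \<noteq> None) \<longleftrightarrow> (\<forall>m \<in># C. valid_index G m)" for C
    by (simp add: monomial_at_eq)
  moreover have "(\<Sum>m \<in># C. the (monomial_at G m)) = (\<Sum>m \<in># C. mono_at m)" if
      "\<forall>m \<in># C. valid_index G m" for C
    using that by (intro arg_cong[where f = sum_mset] image_mset_cong) (simp add: monomial_at_eq)
  ultimately have "F C \<noteq> 0 \<and> (\<forall>m \<in># C. monomial_at G m \<noteq> None) \<and> (\<Sum>m \<in># C. the (monomial_at G m))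
      = A \<longleftrightarrow>
      F C \<noteq> 0 \<and> (\<forall>m \<in># C. valid_index G m) \<and> (\<Sum>m \<in># C. mono_at m) = A" for C
    by metis
  then show ?thesis unfolding plethysm_def by simp
qed

lemma degree_only_plethysm:
  assumes "degree_only d F" "degree_only e G"
  shows "degree_only (d * e) (plethysm F G)"
  unfolding degree_only_def
proof (intro allI impI)
  fix A assume "plethysm F G A \<noteq> 0"
  then obtain C where "C \<in> {C. F C \<noteq> 0 \<and> (\<forall>m \<in># C. valid_index G m) \<and> (\<Sum>m \<in># C. mono_at m) = A}"
    unfolding plethysm_eq by (rule sum.not_neutral_contains_not_neutral)
  then have C: "F C \<noteq> 0" "\<forall>m \<in># C. valid_index G m" "(\<Sum>m \<in># C. mono_at m) = A" by simp_all
  have "size (mono_at m) = e" if "m \<in># C" for m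
  proof -
    have "int (copy_at m) < G (mono_at m)" using C(2) that unfolding valid_index_def by blast
    then have "0 < G (mono_at m)" by linarith
    then show ?thesis using assms(2) by (simp add: degree_only_def)
  qed
  then have "image_mset size (image_mset mono_at C) = image_mset (\<lambda>_. e) C"
    unfolding multiset.map_comp by (intro image_mset_cong) simp
  then have "size A = size C * e"
    unfolding C(3)[symmetric] size_mset_sum_mset_conv by (simp add: sum_mset_constant)
  moreover have "size C = d" using C(1) assms(1) by (simp add: degree_only_def)
  ultimately show "size A = d * e" by simp
qed

lemma member_sum_mset: "m \<in># C \<Longrightarrow> h m \<subseteq># (\<Sum>m \<in># C. h m)" for h :: "'b \<Rightarrow> 'a multiset"
  by (induction C) (auto intro: subset_mset.order_trans subset_mset.add_increasing)

text \<open>The action of a relabelling on the variables of the outer function: the monomial is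
  relabelled and its copy number is kept.\<close>

definition rename_index :: "(nat \<Rightarrow> nat) \<Rightarrow> nat \<Rightarrow> nat" where
  "rename_index \<phi> m = to_nat (image_mset \<phi> (mono_at m), copy_at m)"

text \<open>By symmetry of \<open>G\<close> a monomial and its image have the same number of copies.
  A relabelling therefore acts on the variables of \<open>F\<close>, and symmetry of
  \<open>F\<close> absorbs that action.\<close>

lemma symmetric_plethysm:
  assumes F: "symmetric F" and G: "symmetric G"
  shows "symmetric (plethysm F G)"
  unfolding symmetric_def
proof (intro allI impI)
  define \<C> where "\<C> = (\<lambda>A. {C. F C \<noteq> 0 \<and> (\<forall>m \<in># C. valid_index G m) \<and> (\<Sum>m \<in># C. mono_at m) = A})"
  have fwd: "F (image_mset (rename_index \<phi>) C) = F C" "image_mset (rename_index \<phi>) C \<in> \<C>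
      (image_mset \<phi> A)"
    if "inj_on \<phi> (set_mset A)" "C \<in> \<C> A" for \<phi> A C
  proof -
    have C: "F C \<noteq> 0" "\<forall>m \<in># C. valid_index G m" "(\<Sum>m \<in># C. mono_at m) = A"
      using that(2) unfolding \<C>_def by simp_all
    \<comment> \<open>Every monomial involved divides \<open>A\<close>, so \<open>\<phi>\<close> is
      injective on its support.\<close>
    have sub: "mono_at m \<subseteq># A" if "m \<in># C" for m
      using member_sum_mset[OF that, of mono_at] C(3) by simp
    have "inj_on (rename_index \<phi>) (set_mset C)"
    proof (rule inj_onI)
      fix m m' assume m: "m \<in># C" "m' \<in># C" "rename_index \<phi> m = rename_index \<phi> m'"
      from m(3) have "(image_mset \<phi> (mono_at m), copy_at m) = (image_mset \<phi> (mono_at m'), copy_at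
          m')"
        unfolding rename_index_def by (simp only: inj_eq[OF inj_to_nat])
      then have eq: "image_mset \<phi> (mono_at m) = image_mset \<phi> (mono_at m')" "copy_at m = copy_at m'"
        by simp_all
      have "mono_at m = image_mset (inv_into (set_mset A) \<phi>) (image_mset \<phi> (mono_at m))"
        by (rule image_mset_inv_into[OF that(1) sub[OF m(1)], symmetric])
      also have "\<dots> = mono_at m'"
        unfolding eq(1) by (rule image_mset_inv_into[OF that(1) sub[OF m(2)]])
      finally have "mono_at m = mono_at m'" .
      then have "to_nat (mono_at m, copy_at m) = to_nat (mono_at m', copy_at m')"
          by (simp only: eq(2))
      moreover have "to_nat (mono_at m, copy_at m) = m" "to_nat (mono_at m', copy_at m') = m'"
        using C(2) m(1,2) unfolding valid_index_def by blast+
      ultimately show "m = m'" by (simp only:)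
    qed
    then show FC: "F (image_mset (rename_index \<phi>) C) = F C"
      using F unfolding symmetric_def by blast
    have "valid_index G (rename_index \<phi> m)" if m: "m \<in># C" for m
    proof -
      have "G (image_mset \<phi> (mono_at m)) = G (mono_at m)"
        using G inj_on_subset[OF \<open>inj_on \<phi> (set_mset A)\<close> set_mset_mono[OF sub[OF m]]]
        unfolding symmetric_def by blast
      moreover have "int (copy_at m) < G (mono_at m)" using C(2) m unfolding valid_index_def
          by blast
      ultimately show ?thesis by (simp add: valid_index_def rename_index_def)
    qed
    moreover have "(\<Sum>m \<in># image_mset (rename_index \<phi>) C. mono_at m) = image_mset \<phi> A"
    proof -
      have "(\<Sum>m \<in># image_mset (rename_index \<phi>) C. mono_at m) = (\<Sum>m \<in># C. image_mset \<phi> (mono_at m))"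
        by (simp add: multiset.map_comp comp_def rename_index_def)
      also have "\<dots> = image_mset \<phi> (\<Sum>m \<in># C. mono_at m)" by (induction C) simp_all
      finally show ?thesis by (simp add: C(3))
    qed
    ultimately show "image_mset (rename_index \<phi>) C \<in> \<C> (image_mset \<phi> A)"
      using FC C(1) unfolding \<C>_def by simp
  qed
  have undo: "image_mset (rename_index \<psi>) (image_mset (rename_index \<phi>) C) = C"
    if "\<And>x. x \<in># A \<Longrightarrow> \<psi> (\<phi> x) = x" "C \<in> \<C> A" for \<phi> \<psi> A C
  proof -
    have C: "\<forall>m \<in># C. valid_index G m" "(\<Sum>m \<in># C. mono_at m) = A"
      using that(2) unfolding \<C>_def by simp_all
    have "rename_index \<psi> (rename_index \<phi> m) = m" if "m \<in># C" for m
    proof -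
      have "x \<in># A" if "x \<in># mono_at m" for x
        using mset_subset_eqD[OF member_sum_mset[OF \<open>m \<in># C\<close>, of mono_at] that] C(2) by simp
      then have "image_mset (\<psi> \<circ> \<phi>) (mono_at m) = image_mset id (mono_at m)"
        using \<open>\<And>x. x \<in># A \<Longrightarrow> \<psi> (\<phi> x) = x\<close> by (intro image_mset_cong) simp
      then have "image_mset \<psi> (image_mset \<phi> (mono_at m)) = mono_at m"
        by (simp add: multiset.map_comp)
      moreover have "to_nat (mono_at m, copy_at m) = m"
        using C(1) \<open>m \<in># C\<close> unfolding valid_index_def by blast
      ultimately show ?thesis by (simp add: rename_index_def)
    qed
    then have "image_mset (rename_index \<psi> \<circ> rename_index \<phi>) C = image_mset id C"
      by (intro image_mset_cong) simp
    then show ?thesis by (simp add: multiset.map_comp)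
  qed
  fix A :: "nat multiset" and \<phi> :: "nat \<Rightarrow> nat"
  assume inj: "inj_on \<phi> (set_mset A)"
  have pl: "plethysm F G A = (\<Sum>C \<in> \<C> A. F C)" for A by (simp only: plethysm_eq \<C>_def)
  define \<psi> where "\<psi> = inv_into (set_mset A) \<phi>"
  have \<psi>: "inj_on \<psi> (set_mset (image_mset \<phi> A))" by (simp add: \<psi>_def inj_on_inv_into)
  have cancel: "image_mset \<psi> (image_mset \<phi> A) = A"
    using image_mset_inv_into[OF inj subset_mset.order_refl] by (simp add: \<psi>_def)
  have inv1: "\<psi> (\<phi> x) = x" if "x \<in># A" for x using that inj by (simp add: \<psi>_def)
  have inv2: "\<phi> (\<psi> y) = y" if "y \<in># image_mset \<phi> A" for y
    using that unfolding \<psi>_def by (intro f_inv_into_f) simp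
  show "plethysm F G (image_mset \<phi> A) = plethysm F G A"
    unfolding pl
  proof (rule sum.reindex_bij_witness[of _ "image_mset (rename_index \<phi>)"
      "image_mset (rename_index \<psi>)"])
    fix C assume C: "C \<in> \<C> (image_mset \<phi> A)"
    show "image_mset (rename_index \<phi>) (image_mset (rename_index \<psi>) C) = C"
      using inv2 C by (rule undo)
    show "image_mset (rename_index \<psi>) C \<in> \<C> A" using fwd(2)[OF \<psi> C] unfolding cancel .
    show "F (image_mset (rename_index \<psi>) C) = F C" by (rule fwd(1)[OF \<psi> C])
  next
    fix C assume C: "C \<in> \<C> A"
    show "image_mset (rename_index \<psi>) (image_mset (rename_index \<phi>) C) = C"
      using inv1 C by (rule undo)
    show "image_mset (rename_index \<phi>) C \<in> \<C> (image_mset \<phi> A)" by (rule fwd(2)[OF inj C])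
  qed
qed

text \<open>Decreasing row lengths guarantee the cell above \<open>(r, c)\<close>, and positive ones
  the cell \<open>(r, 0)\<close>; so \<open>lt\<close> is only consulted on cells of the
  diagram.\<close>

lemma good_cong:
  assumes "\<And>r c r' c'. r < L \<Longrightarrow> c < mu r \<Longrightarrow> r' < L \<Longrightarrow> c' < mu r' \<Longrightarrow> lt r c r' c' = lt' r c r' c'"
    and "\<And>i j. i < j \<Longrightarrow> j < L \<Longrightarrow> mu j \<le> mu i" and "\<And>i. i < L \<Longrightarrow> 0 < mu i"
  shows "good k L mu lt = good k L mu lt'"
proof -
  have row: "(\<forall>r<L. \<forall>c'<mu r. \<forall>c<c'. \<not> lt r c' r c) = (\<forall>r<L. \<forall>c'<mu r. \<forall>c<c'. \<not> lt' r c' r c)"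
    "(\<forall>r<L. \<forall>c'<mu r. \<forall>c<c'. lt r c r c') = (\<forall>r<L. \<forall>c'<mu r. \<forall>c<c'. lt' r c r c')"
    "(\<forall>r<L. \<forall>c'<mu r. \<forall>c<c'. \<not> lt r c r c' \<and> \<not> lt r c' r c) =
      (\<forall>r<L. \<forall>c'<mu r. \<forall>c<c'. \<not> lt' r c r c' \<and> \<not> lt' r c' r c)"
    using assms(1) by (meson order_less_trans)+
  have col: "(\<forall>r<L. \<forall>c<mu r. 0 < r \<longrightarrow> lt (r - 1) c r c) = (\<forall>r<L. \<forall>c<mu r. 0 < r \<longrightarrow> lt' (r - 1) c r c)"
  proof -
    have "lt (r - 1) c r c = lt' (r - 1) c r c" if "r < L" "c < mu r" "0 < r" for r c
      using that assms(2)[of "r - 1" r] by (intro assms(1)) auto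
    then show ?thesis by blast
  qed
  have first: "(\<forall>r'<L. \<forall>r<r'. (lt r 0 r' 0 \<or> lt r' 0 r 0) \<and> (mu r = mu r' \<longrightarrow> lt r 0 r' 0)) =
      (\<forall>r'<L. \<forall>r<r'. (lt' r 0 r' 0 \<or> lt' r' 0 r 0) \<and> (mu r = mu r' \<longrightarrow> lt' r 0 r' 0))"
  proof -
    have "lt r 0 r' 0 = lt' r 0 r' 0" if "r < L" "r' < L" for r r'
      using that assms(3) by (intro assms(1)) auto
    then show ?thesis by (meson order_less_trans)
  qed
  show ?thesis by (cases k) (simp_all only: good.simps row col first)
qed

lemma good_cong_partition:
  assumes "is_partition mu"
    and "\<And>r c r' c'. r < length mu \<Longrightarrow> c < mu ! r \<Longrightarrow> r' < length mu \<Longrightarrow> c' < mu ! r' \<Longrightarrow> lt r c r' c'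
        = lt' r c r' c'"
  shows "good k (length mu) ((!) mu) lt = good k (length mu) ((!) mu) lt'"
proof (rule good_cong)
  show "mu ! j \<le> mu ! i" if "i < j" "j < length mu" for i j
    using assms(1) that sorted_wrt_nth_less[of "(\<ge>)" mu i j] by (simp add: is_partition_def)
  show "0 < mu ! i" if "i < length mu" for i
    using assms(1) nth_mem[OF that] by (auto simp: is_partition_def intro: Nat.gr0I)
qed (fact assms(2))

text \<open>The conditions on a filling see its entries through comparisons alone.\<close>

lemma tab_map:
  assumes "is_partition mu" "set (concat T) \<subseteq> Y" "\<And>x y. x \<in> Y \<Longrightarrow> y \<in> Y \<Longrightarrow> h x < h y \<longleftrightarrow> x < y"
  shows "tab k mu (map (map h) T) \<longleftrightarrow> tab k mu T"
proof (cases "map length T = mu")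
  case True
  have ent: "T ! r ! c \<in> Y" "map (map h) T ! r ! c = h (T ! r ! c)" if "r < length mu"
      "c < mu ! r" for r c
  proof -
    have "r < length T" "c < length (T ! r)" using that True by auto
    then show "T ! r ! c \<in> Y" "map (map h) T ! r ! c = h (T ! r ! c)"
      using assms(2) by (auto simp: subset_iff) (metis nth_mem)
  qed
  have "map length (map (map h) T) = map length T" by simp
  moreover have "good k (length mu) ((!) mu) (\<lambda>r c r' c'. map (map h) T ! r ! c < map (map h) T !
      r' ! c') =
      good k (length mu) ((!) mu) (\<lambda>r c r' c'. T ! r ! c < T ! r' ! c')"
    using ent assms(3) by (intro good_cong_partition[OF assms(1)]) simp
  ultimately show ?thesis unfolding tab_def by (simp only:)
next
  case False
  then show ?thesis by (simp add: tab_def comp_def)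
qed

text \<open>
  By symmetry of \<open>f\<close>, the variables of \<open>f\<close> may be replaced by the elements of any ordered set \<open>Y\<close>
  that has as many elements of weight \<open>\<tau>\<close> as \<open>g\<close> has copies of the monomial \<open>\<tau>\<close>.
\<close>

theorem plethysm_count:
  fixes Y :: "'a :: linorder set" and wt :: "'a \<Rightarrow> nat multiset"
  assumes mu: "is_partition mu" and Y: "finite Y"
    and G: "\<And>\<tau>. set_mset \<tau> \<subseteq> B \<Longrightarrow> G \<tau> = int (card {x \<in> Y. wt x = \<tau>})"
    and wt: "\<And>x. x \<in> Y \<Longrightarrow> set_mset (wt x) \<subseteq> B" and A: "set_mset A \<subseteq> B"
  shows "plethysm (basis k mu) G A =
    int (card {T. tab k mu T \<and> set (concat T) \<subseteq> Y \<and> (\<Sum>x \<in># mset (concat T). wt x) = A})"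
proof -
  let ?F = "basis k mu"
  define Y\<^sub>w where "Y\<^sub>w = (\<lambda>\<tau>. {x \<in> Y. wt x = \<tau>})"
  \<comment> \<open>The elements of weight \<open>\<tau>\<close> are numbered, which matches them
    with the copies of the monomial \<open>\<tau>\<close> in \<open>G\<close>.\<close>
  have "\<exists>b. bij_betw b (Y\<^sub>w \<tau>) {0..<card (Y\<^sub>w \<tau>)}" for \<tau>
    by (rule ex_bij_betw_finite_nat) (simp add: Y\<^sub>w_def Y)
  then have "\<exists>b. \<forall>\<tau>. bij_betw (b \<tau>) (Y\<^sub>w \<tau>) {0..<card (Y\<^sub>w \<tau>)}"
    by (intro choice allI)
  then obtain b where b: "\<And>\<tau>. bij_betw (b \<tau>) (Y\<^sub>w \<tau>) {0..<card (Y\<^sub>w \<tau>)}" by blast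
  have G': "G \<tau> = int (card (Y\<^sub>w \<tau>))" if "set_mset \<tau> \<subseteq> B" for \<tau>
    using G[OF that] by (simp add: Y\<^sub>w_def)
  have inY: "x \<in> Y\<^sub>w (wt x)" if "x \<in> Y" for x using that by (simp add: Y\<^sub>w_def)
  define \<psi> where "\<psi> = (\<lambda>x. to_nat (wt x, b (wt x) x))"
  have \<psi>_at: "mono_at (\<psi> x) = wt x" "copy_at (\<psi> x) = b (wt x) x" for x by (simp_all add: \<psi>_def)
  have inj\<psi>: "inj_on \<psi> Y"
  proof (rule inj_onI)
    fix x y assume *: "x \<in> Y" "y \<in> Y" "\<psi> x = \<psi> y"
    have w: "wt x = wt y" using arg_cong[OF *(3), of mono_at] by (simp only: \<psi>_at)
    have "b (wt x) x = b (wt x) y" using arg_cong[OF *(3), of copy_at] by (simp only: \<psi>_at w)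
    then show "x = y"
      using inj_onD[OF bij_betw_imp_inj_on[OF b[of "wt x"]]] inY[OF *(1)] inY[OF *(2)] unfolding w
          by blast
  qed
  have valid: "valid_index G (\<psi> x)" if "x \<in> Y" for x
  proof -
    have "b (wt x) x \<in> {0..<card (Y\<^sub>w (wt x))}"
      using b[of "wt x"] inY[OF that] by (rule bij_betw_apply)
    then have "int (b (wt x) x) < G (wt x)" unfolding G'[OF wt[OF that]] by simp
    moreover have "to_nat (mono_at (\<psi> x), copy_at (\<psi> x)) = \<psi> x" unfolding \<psi>_at by (simp only: \<psi>_def)
    ultimately show ?thesis unfolding valid_index_def \<psi>_at by blast
  qed
  have surj: "m \<in> \<psi> ` Y" if "valid_index G m" "set_mset (mono_at m) \<subseteq> B" for m
  proof -
    have "copy_at m \<in> {0..<card (Y\<^sub>w (mono_at m))}"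
      using that(1) G'[OF that(2)] unfolding valid_index_def by simp
    then have "copy_at m \<in> b (mono_at m) ` Y\<^sub>w (mono_at m)"
      unfolding bij_betw_imp_surj_on[OF b] .
    then obtain x where x: "copy_at m = b (mono_at m) x" "x \<in> Y\<^sub>w (mono_at m)" by (rule imageE)
    then have "x \<in> Y" "wt x = mono_at m" by (simp_all add: Y\<^sub>w_def)
    then have "\<psi> x = to_nat (mono_at m, copy_at m)" unfolding \<psi>_def x(1) by simp
    also have "\<dots> = m" using that(1) unfolding valid_index_def by blast
    finally show ?thesis using \<open>x \<in> Y\<close> by blast
  qed
  \<comment> \<open>The position within \<open>Y\<close> carries its order over to the numbers,
    where \<open>basis_count\<close> applies.\<close>
  define rank where "rank = (\<lambda>x. card {y \<in> Y. y < x})"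
  have rank: "rank x < rank y \<longleftrightarrow> x < y" if "x \<in> Y" "y \<in> Y" for x y
  proof -
    have mono: "rank u < rank v" if "u \<in> Y" "u < v" for u v
      unfolding rank_def using that Y by (intro psubset_card_mono) auto
    show ?thesis
      by (cases x y rule: linorder_cases) (use mono[of x y] mono[of y x] that in auto)
  qed
  have inj_rank: "inj_on rank Y"
  proof (rule inj_onI)
    fix x y assume "x \<in> Y" "y \<in> Y" "rank x = rank y"
    then show "x = y" using rank[of x y] rank[of y x] by (cases x y rule: linorder_cases) auto
  qed
  define \<T> where "\<T> = {T. tab k mu T \<and> set (concat T) \<subseteq> Y}"
  have fin: "finite \<T>"
    by (rule finite_subset[OF _ finite_fillings[OF Y, of mu]]) (auto simp: \<T>_def tab_def)
  have count: "?F (image_mset \<psi> D) = int (card {T \<in> \<T>. mset (concat T) = D})" if D: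
      "set_mset D \<subseteq> Y" for D
  proof -
    have undo: "map (map rank) (map (map (inv_into Y rank)) T) = T"
        "set (concat (map (map (inv_into Y rank)) T)) \<subseteq> Y"
      if "mset (concat T) = image_mset rank D" for T
    proof -
      have "set (concat T) = rank ` set_mset D" using that by (metis set_image_mset set_mset_mset)
      then have *: "a \<in> rank ` Y" if "a \<in> set (concat T)" for a using D that by auto
      then have "rank (inv_into Y rank a) = a" if "r \<in> set T" "a \<in> set r" for r a
        using that by (intro f_inv_into_f) auto
      then show "map (map rank) (map (map (inv_into Y rank)) T) = T"
        unfolding map_map comp_def by (intro map_idI) (simp add: map_idI)
      show "set (concat (map (map (inv_into Y rank)) T)) \<subseteq> Y"
      proof -
        have "concat (map (map (inv_into Y rank)) T) = map (inv_into Y rank) (concat T)"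
          by (simp only: map_concat)
        then show ?thesis using * inv_into_into[of _ rank Y] by (simp only: set_map) blast
      qed
    qed
    \<comment> \<open>\<open>\<psi>\<close> need not respect the order of \<open>Y\<close>. Symmetry
      of the outer function permits passing from \<open>\<psi>\<close> to \<open>rank\<close>, which
      does.\<close>
    have "inj_on (\<psi> \<circ> inv_into Y rank) (rank ` set_mset D)"
      using D inj_rank inj\<psi> by (intro comp_inj_on inj_on_inv_into inj_on_subset[OF inj\<psi>]) (auto
          simp: inv_into_into)
    then have "?F (image_mset (\<psi> \<circ> inv_into Y rank) (image_mset rank D)) = ?F (image_mset rank D)"
      using symmetric_basis[OF mu, of k] unfolding symmetric_def by simp
    moreover have "image_mset (\<psi> \<circ> inv_into Y rank) (image_mset rank D) = image_mset \<psi> D"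
      unfolding multiset.map_comp using D inj_rank by (intro image_mset_cong) (auto simp:
          subset_iff)
    moreover have "?F (image_mset rank D) = int (card {T :: nat list list. tab k mu T
        \<and> mset (concat T) = image_mset rank D})"
      by (rule basis_count[OF mu])
    moreover have "bij_betw (map (map rank)) {T \<in> \<T>. mset (concat T) = D}
        {T. tab k mu T \<and> mset (concat T) = image_mset rank D}"
    proof (rule bij_betwI[where g = "map (map (inv_into Y rank))"])
      show "map (map rank) \<in> {T \<in> \<T>. mset (concat T) = D} \<rightarrow> {T. tab k mu T \<and> mset (concat T)
          = image_mset rank D}"
        using tab_map[OF mu _ rank] by (auto simp: \<T>_def simp flip: map_concat)
      show "map (map (inv_into Y rank)) \<in> {T. tab k mu T \<and> mset (concat T) = image_mset rank D} \<rightarrow>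
          {T \<in> \<T>. mset (concat T) = D}"
      proof safe
        fix T :: "nat list list" assume T: "tab k mu T" "mset (concat T) = image_mset rank D"
        show "map (map (inv_into Y rank)) T \<in> \<T>"
          using tab_map[OF mu undo(2)[OF T(2)] rank] undo[OF T(2)] T(1) by (simp add: \<T>_def)
        have "mset (concat (map (map (inv_into Y rank)) T)) = image_mset (inv_into Y rank) (mset
            (concat T))"
          by (simp flip: map_concat)
        also have "\<dots> = image_mset (inv_into Y rank \<circ> rank) D" unfolding T(2)
            by (simp only: multiset.map_comp)
        also have "\<dots> = image_mset id D" using D inj_rank by (intro image_mset_cong) auto
        finally show "mset (concat (map (map (inv_into Y rank)) T)) = D" by simp
      qed
      fix T assume "T \<in> {T \<in> \<T>. mset (concat T) = D}"
      then have "a \<in> Y" if "r \<in> set T" "a \<in> set r" for r a using that by (auto simp: \<T>_def)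
      then show "map (map (inv_into Y rank)) (map (map rank) T) = T"
        unfolding map_map comp_def using inj_rank by (intro map_idI) (simp add: map_idI)
    next
      fix T :: "nat list list" assume "T \<in> {T. tab k mu T \<and> mset (concat T) = image_mset rank D}"
      then show "map (map rank) (map (map (inv_into Y rank)) T) = T" by (intro undo(1)) simp
    qed
    ultimately show ?thesis by (simp add: bij_betw_same_card)
  qed
  define \<T>\<^sub>A where "\<T>\<^sub>A = {T \<in> \<T>. (\<Sum>x \<in># mset (concat T). wt x) = A}"
  \<comment> \<open>The contents of fillings that occur. On the image of any other multiset over
    \<open>Y\<close> of total weight \<open>A\<close> the outer function vanishes.\<close>
  define \<D> where "\<D> = (\<lambda>T. mset (concat T)) ` \<T>\<^sub>A"
  have \<D>: "set_mset D \<subseteq> Y" "(\<Sum>x \<in># D. wt x) = A" if "D \<in> \<D>" for D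
    using that by (auto simp: \<D>_def \<T>\<^sub>A_def \<T>_def)
  have "plethysm ?F G A = (\<Sum>D \<in> \<D>. ?F (image_mset \<psi> D))"
    unfolding plethysm_eq
  proof (rule sum.reindex_bij_witness[of _ "image_mset \<psi>" "image_mset (inv_into Y \<psi>)"])
    fix C assume "C \<in> {C. ?F C \<noteq> 0 \<and> (\<forall>m \<in># C. valid_index G m) \<and> (\<Sum>m \<in># C. mono_at m) = A}"
    then have C: "?F C \<noteq> 0" "\<forall>m \<in># C. valid_index G m" "(\<Sum>m \<in># C. mono_at m) = A" by auto
    have img: "m \<in> \<psi> ` Y" if "m \<in># C" for m
    proof (rule surj)
      show "valid_index G m" using C(2) that by blast
      show "set_mset (mono_at m) \<subseteq> B"
        using set_mset_mono[OF member_sum_mset[OF that, of mono_at]] A C(3) by auto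
    qed
    then have "image_mset (\<psi> \<circ> inv_into Y \<psi>) C = image_mset id C"
      by (intro image_mset_cong) (simp add: f_inv_into_f)
    then show eq: "image_mset \<psi> (image_mset (inv_into Y \<psi>) C) = C" by (simp add: multiset.map_comp)
    define D where "D = image_mset (inv_into Y \<psi>) C"
    have C_eq: "C = image_mset \<psi> D" using eq by (simp add: D_def)
    have D: "set_mset D \<subseteq> Y" using img inv_into_into[of _ \<psi> Y] by (auto simp: D_def)
    have "card {T \<in> \<T>. mset (concat T) = D} \<noteq> 0" using C(1) count[OF D] C_eq by simp
    then obtain T where T: "T \<in> \<T>" "mset (concat T) = D" by (metis (mono_tags, lifting) card.empty
        ex_in_conv mem_Collect_eq)
    have "(\<Sum>x \<in># D. wt x) = A"
      using C(3) by (simp add: C_eq multiset.map_comp comp_def \<psi>_at)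
    then have "T \<in> \<T>\<^sub>A" using T by (simp add: \<T>\<^sub>A_def)
    then show "image_mset (inv_into Y \<psi>) C \<in> \<D>"
      unfolding \<D>_def D_def[symmetric] T(2)[symmetric] by (rule imageI)
    show "?F (image_mset \<psi> (image_mset (inv_into Y \<psi>) C)) = ?F C" by (simp only: eq)
  next
    fix D assume D: "D \<in> \<D>"
    have "image_mset (inv_into Y \<psi> \<circ> \<psi>) D = image_mset id D"
      using \<D>(1)[OF D] inj\<psi> by (intro image_mset_cong) auto
    then show "image_mset (inv_into Y \<psi>) (image_mset \<psi> D) = D" by (simp add: multiset.map_comp)
    have "{T \<in> \<T>. mset (concat T) = D} \<noteq> {}" using D by (auto simp: \<D>_def \<T>\<^sub>A_def)
    then have "?F (image_mset \<psi> D) \<noteq> 0" unfolding count[OF \<D>(1)[OF D]] using fin by simp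
    moreover have "\<forall>m \<in># image_mset \<psi> D. valid_index G m" using valid \<D>(1)[OF D] by auto
    moreover have "(\<Sum>m \<in># image_mset \<psi> D. mono_at m) = A"
      using \<D>(2)[OF D] by (simp add: multiset.map_comp comp_def \<psi>_at)
    ultimately show "image_mset \<psi> D \<in> {C. ?F C \<noteq> 0 \<and> (\<forall>m \<in># C. valid_index G m) \<and>
        (\<Sum>m \<in># C. mono_at m) = A}"
      by simp
  qed
  also have "\<dots> = (\<Sum>D \<in> \<D>. int (card {T \<in> \<T>\<^sub>A. mset (concat T) = D}))"
  proof (rule sum.cong[OF refl])
    fix D assume D: "D \<in> \<D>"
    have "{T \<in> \<T>. mset (concat T) = D} = {T \<in> \<T>\<^sub>A. mset (concat T) = D}"
      using \<D>(2)[OF D] by (auto simp: \<T>\<^sub>A_def)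
    then show "?F (image_mset \<psi> D) = int (card {T \<in> \<T>\<^sub>A. mset (concat T) = D})"
      using count[OF \<D>(1)[OF D]] by simp
  qed
  also have "\<dots> = int (card \<T>\<^sub>A)"
  proof -
    have "finite \<T>\<^sub>A" using fin by (simp add: \<T>\<^sub>A_def)
    then have "card \<T>\<^sub>A = (\<Sum>D \<in> \<D>. card {T \<in> \<T>\<^sub>A. mset (concat T) = D})"
      using sum.image_gen[of \<T>\<^sub>A "\<lambda>_. 1 :: nat" "\<lambda>T. mset (concat T)"] by (simp add: \<D>_def)
    then show ?thesis by simp
  qed
  also have "\<T>\<^sub>A = {T. tab k mu T \<and> set (concat T) \<subseteq> Y \<and> (\<Sum>x \<in># mset (concat T). wt x) = A}"
    by (auto simp: \<T>\<^sub>A_def \<T>_def)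
  finally show ?thesis .
qed

subsection \<open>Two-level fillings\<close>

text \<open>
  \<open>ent r c p q\<close> is the entry in cell \<open>(p, q)\<close> of the filling in cell \<open>(r, c)\<close>, and \<open>tb i j\<close> says that
  the pair \<open>(i, j)\<close> is chosen in the Vandermonde product.
\<close>

definition filling_less :: "nat \<Rightarrow> (nat \<Rightarrow> nat) \<Rightarrow> (nat \<Rightarrow> nat \<Rightarrow> nat) \<Rightarrow> (nat \<Rightarrow> nat \<Rightarrow> nat) \<Rightarrow> bool" where
  "filling_less L nu x y \<longleftrightarrow> (\<exists>p<L. \<exists>q<nu p. x p q < y p q \<and> (\<forall>q'<q. x p q' = y p q') \<and>
     (\<forall>p'<p. \<forall>q'<nu p'. x p' q' = y p' q'))"

text \<open>Shapes and entries are functions, so that values decoded from the input can be plugged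
  in, and all quantifiers and sums are bounded, so that a term can express them. The fourth conjunct
  compares exponents: the letters of the filling together with the chosen Vandermonde monomial must
  give \<open>x ^ (la + delta)\<close>. The last one says that the number of negative choices has
  parity \<open>par\<close>.\<close>

definition certificate :: "kind \<Rightarrow> kind \<Rightarrow> nat \<Rightarrow> nat \<Rightarrow> (nat \<Rightarrow> nat) \<Rightarrow> nat \<Rightarrow> (nat \<Rightarrow> nat) \<Rightarrow> nat \<Rightarrow> (nat
    \<Rightarrow> nat) \<Rightarrow>
    (nat \<Rightarrow> nat \<Rightarrow> nat \<Rightarrow> nat \<Rightarrow> nat) \<Rightarrow> (nat \<Rightarrow> nat \<Rightarrow> bool) \<Rightarrow> bool" where
  "certificate kf kg par n la L mu L' nu ent tb \<longleftrightarrow>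
     (\<forall>r<L. \<forall>c<mu r. \<forall>p<L'. \<forall>q<nu p. ent r c p q < n) \<and>
     (\<forall>r<L. \<forall>c<mu r. good kg L' nu (\<lambda>p q p' q'. ent r c p q < ent r c p' q')) \<and>
     good kf L mu (\<lambda>r c r' c'. filling_less L' nu (ent r c) (ent r' c')) \<and>
     (\<forall>a<n. (\<Sum>r<L. \<Sum>c<mu r. \<Sum>p<L'. \<Sum>q<nu p. of_bool (ent r c p q = a)) +
        ((\<Sum>i<a. of_bool (tb i a)) + (\<Sum>j<n. of_bool (a < j \<and> \<not> tb a j))) = la a + (n - 1 - a)) \<and>
     (\<exists>h < Suc (\<Sum>i<n. \<Sum>j<n. of_bool (tb i j)). (\<Sum>i<n. \<Sum>j<n. of_bool (tb i j)) = h + h + par)"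

lemma sum_mset_concat:
  "(\<Sum>x \<in># mset (concat T). f x) = (\<Sum>r<length T. \<Sum>c<length (T ! r). f (T ! r ! c))"
proof (induction T)
  case (Cons r T)
  have "(\<Sum>x \<in># mset r. f x) = (\<Sum>c<length r. f (r ! c))"
    by (simp add: sum_mset_sum_list sum_list_sum_nth lessThan_atLeast0 flip: mset_map)
  then show ?case
    using Cons by (simp add: sum.lessThan_Suc_shift del: sum.lessThan_Suc)
qed simp

lemma count_mset_sum: "count (mset xs) a = (\<Sum>x \<in># mset xs. of_bool (x = a))"
  by (induction xs) auto

lemma count_sum_mset_image: "count (\<Sum>x \<in># M. f x) a = (\<Sum>x \<in># M. count (f x) a)"
  by (induction M) auto

text \<open>With equal lengths no list is a proper prefix of the other, so the first differing
  position decides the lexicographic order.\<close>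

lemma list_less_nth:
  fixes xs ys :: "'a :: linorder list"
  assumes "length xs = length ys"
  shows "xs < ys \<longleftrightarrow> (\<exists>i<length xs. xs ! i < ys ! i \<and> (\<forall>j<i. xs ! j = ys ! j))"
  using assms
proof (induction xs ys rule: list_induct2)
  case (Cons x xs y ys)
  have ex: "(\<exists>i<Suc n. P i) \<longleftrightarrow> P 0 \<or> (\<exists>i<n. P (Suc i))" for n P
    using less_Suc_eq_0_disj by auto
  have all: "(\<forall>j<Suc n. P j) \<longleftrightarrow> P 0 \<and> (\<forall>j<n. P (Suc j))" for n P
    using less_Suc_eq_0_disj by auto
  have "(\<exists>i<length (x # xs). (x # xs) ! i < (y # ys) ! i \<and> (\<forall>j<i. (x # xs) ! j = (y # ys) ! j)) \<longleftrightarrow>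
      x < y \<or> (\<exists>i<length xs. xs ! i < ys ! i \<and> x = y \<and> (\<forall>j<i. xs ! j = ys ! j))"
    by (simp only: length_Cons ex all nth_Cons_0 nth_Cons_Suc) simp
  also have "\<dots> \<longleftrightarrow> x < y \<or> x = y \<and> (\<exists>i<length xs. xs ! i < ys ! i \<and> (\<forall>j<i. xs ! j = ys ! j))"
    by blast
  also have "\<dots> \<longleftrightarrow> x < y \<or> x = y \<and> xs < ys"
    by (simp only: Cons(2))
  also have "\<dots> \<longleftrightarrow> x # xs < y # ys"
    by (simp add: list_less_def)
  finally show ?case by (rule sym)
qed simp

text \<open>Two nested lexicographic orders: the first differing row decides, and within it the
  first differing entry. The right-hand side is the form that a term can test.\<close>

lemma filling_less_iff:
  fixes x y :: "nat list list"
  assumes "map length x = nu" "map length y = nu"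
  shows "x < y \<longleftrightarrow> filling_less (length nu) ((!) nu) (\<lambda>p q. x ! p ! q) (\<lambda>p q. y ! p ! q)"
proof -
  have len: "length x = length nu" "length y = length nu"
    using arg_cong[OF assms(1), of length] arg_cong[OF assms(2), of length] by simp_all
  have row: "length (x ! p) = nu ! p" "length (y ! p) = nu ! p" if "p < length nu" for p
    using arg_cong[OF assms(1), of "\<lambda>l. l ! p"] arg_cong[OF assms(2), of "\<lambda>l. l ! p"] that len
    by simp_all
  have eq: "x ! p = y ! p \<longleftrightarrow> (\<forall>q<nu ! p. x ! p ! q = y ! p ! q)" if "p < length nu" for p
    unfolding list_eq_iff_nth_eq row[OF that] by simp
  have less: "x ! p < y ! p \<longleftrightarrow> (\<exists>q<nu ! p. x ! p ! q < y ! p ! q \<and> (\<forall>q'<q. x ! p ! q' = y ! p ! q'))"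
    if "p < length nu" for p
    using list_less_nth[of "x ! p" "y ! p"] unfolding row[OF that] by blast
  have "x < y \<longleftrightarrow> (\<exists>p<length nu. x ! p < y ! p \<and> (\<forall>p'<p. x ! p' = y ! p'))"
    using list_less_nth[of x y] unfolding len by blast
  also have "\<dots> \<longleftrightarrow> filling_less (length nu) ((!) nu) (\<lambda>p q. x ! p ! q) (\<lambda>p q. y ! p ! q)"
    unfolding filling_less_def
  proof (intro ex_cong1 conj_cong refl)
    fix p assume p: "p < length nu"
    have "(\<forall>p'<p. x ! p' = y ! p') \<longleftrightarrow> (\<forall>p'<p. \<forall>q'<nu ! p'. x ! p' ! q' = y ! p' ! q')"
      by (intro all_cong eq) (use p in simp)
    then show "(x ! p < y ! p \<and> (\<forall>p'<p. x ! p' = y ! p')) \<longleftrightarrow>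
        (\<exists>q<nu ! p. x ! p ! q < y ! p ! q \<and> (\<forall>q'<q. x ! p ! q' = y ! p ! q') \<and>
          (\<forall>p'<p. \<forall>q'<nu ! p'. x ! p' ! q' = y ! p' ! q'))"
      unfolding less[OF p] by blast
  qed
  finally show ?thesis .
qed

text \<open>The variable \<open>a\<close> comes from a pair \<open>(i, a)\<close> that is chosen and
  from a pair \<open>(a, j)\<close> that is not.\<close>

lemma count_choice_mset:
  assumes "S \<subseteq> pairs n" "a < n"
  shows "count (choice_mset n S) a =
    (\<Sum>i<a. of_bool ((i, a) \<in> S)) + (\<Sum>j<n. of_bool (a < j \<and> (a, j) \<notin> S))"
proof -
  have fin: "finite S" using assms(1) finite_subset finite_pairs by blast
  have "count (\<Sum>p \<in> S. {#snd p#}) a = card {p \<in> S. snd p = a}"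
    using fin by (simp add: count_sum sum.If_cases Int_def eq_commute)
  also have "{p \<in> S. snd p = a} = (\<lambda>i. (i, a)) ` {i. i < a \<and> (i, a) \<in> S}"
    using assms(1) by (auto simp: pairs_def)
  also have "card \<dots> = card {i. i < a \<and> (i, a) \<in> S}"
    by (rule card_image) (auto simp: inj_on_def)
  also have "\<dots> = (\<Sum>i<a. of_bool ((i, a) \<in> S))"
    by (simp add: of_bool_def sum.If_cases Int_def lessThan_def)
  finally have 1: "count (\<Sum>p \<in> S. {#snd p#}) a = (\<Sum>i<a. of_bool ((i, a) \<in> S))" .
  have "count (\<Sum>p \<in> pairs n - S. {#fst p#}) a = card {p \<in> pairs n - S. fst p = a}"
    using finite_pairs[of n] by (simp add: count_sum sum.If_cases Int_def eq_commute)
  also have "{p \<in> pairs n - S. fst p = a} = (\<lambda>j. (a, j)) ` {j. j < n \<and> a < j \<and> (a, j) \<notin> S}"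
    by (auto simp: pairs_def)
  also have "card \<dots> = card {j. j < n \<and> a < j \<and> (a, j) \<notin> S}"
    by (rule card_image) (auto simp: inj_on_def)
  also have "\<dots> = (\<Sum>j<n. of_bool (a < j \<and> (a, j) \<notin> S))"
    by (simp add: of_bool_def sum.If_cases Int_def lessThan_def)
  finally show ?thesis using 1 by (simp add: choice_mset_def)
qed

lemma card_choice:
  assumes "S \<subseteq> pairs n"
  shows "card S = (\<Sum>i<n. \<Sum>j<n. of_bool ((i, j) \<in> S))"
proof -
  have "S = S \<inter> ({..<n} \<times> {..<n})" using assms by (auto simp: pairs_def)
  then have "card S = (\<Sum>p \<in> {..<n} \<times> {..<n}. of_bool (p \<in> S))"
    by (simp add: of_bool_def sum.If_cases Int_commute)
  also have "\<dots> = (\<Sum>i<n. \<Sum>j<n. of_bool ((i, j) \<in> S))"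
    unfolding sum.cartesian_product by (rule sum.cong) auto
  finally show ?thesis .
qed

lemma set_choice_mset: "S \<subseteq> pairs n \<Longrightarrow> set_mset (choice_mset n S) \<subseteq> {..<n}"
  using finite_subset[OF _ finite_pairs[of n], of S]
  by (auto simp: choice_mset_def set_mset_sum) (auto simp: pairs_def)

definition inner_fillings :: "kind \<Rightarrow> nat list \<Rightarrow> nat \<Rightarrow> nat list list set" where
  "inner_fillings kg nu n = {x. tab kg nu x \<and> set (concat x) \<subseteq> {..<n}}"

definition two_level :: "kind \<Rightarrow> kind \<Rightarrow> nat list \<Rightarrow> nat list \<Rightarrow> nat list \<Rightarrow> (nat \<times> nat) set \<Rightarrow> nat list
    list list list set" where
  "two_level kf kg la mu nu S = {T. tab kf mu T \<and> set (concat T) \<subseteq> inner_fillings kg nu (length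
      la) \<and>
     (\<Sum>x \<in># mset (concat T). mset (concat x)) + choice_mset (length la) S = shifted_mset la}"

lemma good_shape_cong:
  assumes "\<And>i. i < L \<Longrightarrow> m i = m' i"
  shows "good k L m lt = good k L m' lt"
  using assms by (cases k) (auto simp: less_trans)

lemma all_cells:
  assumes "map length T = mu"
  shows "(\<forall>x \<in> set (concat T). P x) \<longleftrightarrow> (\<forall>r<length mu. \<forall>c<mu ! r. P (T ! r ! c))"
proof -
  have "(\<forall>x \<in> set (concat T). P x) \<longleftrightarrow> (\<forall>r \<in> set T. \<forall>x \<in> set r. P x)" by auto
  also have "\<dots> \<longleftrightarrow> (\<forall>r<length mu. \<forall>c<mu ! r. P (T ! r ! c))"
    using assms by (auto simp: all_set_conv_all_nth)
  finally show ?thesis .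
qed

text \<open>Functions and lists have to agree only on indices that exist, since decoding promises
  nothing elsewhere; \<open>good_cong_partition\<close> keeps all comparisons inside the
  diagrams.\<close>

lemma certificate_iff:
  assumes mu: "is_partition mu" and nu: "is_partition nu"
    and T: "map length T = mu" "\<And>x. x \<in> set (concat T) \<Longrightarrow> map length x = nu"
    and S: "S \<subseteq> pairs (length la)"
    and la': "\<And>i. i < length la \<Longrightarrow> la' i = la ! i"
    and mu': "\<And>i. i < length mu \<Longrightarrow> mu' i = mu ! i"
    and nu': "\<And>i. i < length nu \<Longrightarrow> nu' i = nu ! i"
    and ent: "\<And>r c p q. r < length mu \<Longrightarrow> c < mu ! r \<Longrightarrow> p < length nu \<Longrightarrow> q < nu ! p \<Longrightarrow> ent r c p q
        = T ! r ! c ! p ! q"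
    and tb: "\<And>i j. i < length la \<Longrightarrow> j < length la \<Longrightarrow> tb i j \<longleftrightarrow> (i, j) \<in> S"
  shows "certificate kf kg par (length la) la' (length mu) mu' (length nu) nu' ent tb \<longleftrightarrow>
    T \<in> two_level kf kg la mu nu S \<and> (\<exists>h. card S = h + h + par)"
proof -
  let ?n = "length la" and ?L = "length mu" and ?L' = "length nu"
  have shape: "map length (T ! r ! c) = nu" if "r < ?L" "c < mu ! r" for r c
    using T(2) all_cells[OF T(1), of "\<lambda>x. map length x = nu"] that by blast
  have 1: "(\<forall>r<?L. \<forall>c<mu' r. \<forall>p<?L'. \<forall>q<nu' p. ent r c p q < ?n) \<longleftrightarrow>
      (\<forall>x \<in> set (concat T). set (concat x) \<subseteq> {..<?n})"
  proof -
    have "set (concat (T ! r ! c)) \<subseteq> {..<?n} \<longleftrightarrow> (\<forall>p<?L'. \<forall>q<nu' p. ent r c p q < ?n)"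
      if "r < ?L" "c < mu ! r" for r c
    proof -
      have "set (concat (T ! r ! c)) \<subseteq> {..<?n} \<longleftrightarrow> (\<forall>a \<in> set (concat (T ! r ! c)). a < ?n)" by blast
      also have "\<dots> \<longleftrightarrow> (\<forall>p<?L'. \<forall>q<nu ! p. T ! r ! c ! p ! q < ?n)"
        by (rule all_cells[OF shape[OF that]])
      finally show ?thesis using ent[OF that] nu' by simp
    qed
    then show ?thesis using all_cells[OF T(1), of "\<lambda>x. set (concat x) \<subseteq> {..<?n}"] mu' by simp
  qed
  have 2: "(\<forall>r<?L. \<forall>c<mu' r. good kg ?L' nu' (\<lambda>p q p' q'. ent r c p q < ent r c p' q')) \<longleftrightarrow>
      (\<forall>x \<in> set (concat T). tab kg nu x)"
  proof -
    have "good kg ?L' nu' (\<lambda>p q p' q'. ent r c p q < ent r c p' q') \<longleftrightarrow> tab kg nu (T ! r ! c)"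
      if "r < ?L" "c < mu ! r" for r c
    proof -
      have "good kg ?L' nu' (\<lambda>p q p' q'. ent r c p q < ent r c p' q') =
          good kg ?L' ((!) nu) (\<lambda>p q p' q'. ent r c p q < ent r c p' q')"
        by (rule good_shape_cong) (rule nu')
      also have "\<dots> = good kg ?L' ((!) nu) (\<lambda>p q p' q'. T ! r ! c ! p ! q < T ! r ! c ! p' ! q')"
        using ent[OF that] by (intro good_cong_partition[OF nu]) simp
      finally show ?thesis using shape[OF that] by (simp add: tab_def)
    qed
    then show ?thesis using all_cells[OF T(1), of "tab kg nu"] mu' by simp
  qed
  have 3: "good kf ?L mu' (\<lambda>r c r' c'. filling_less ?L' nu' (ent r c) (ent r' c')) \<longleftrightarrow> tab kf mu T"
  proof -
    have "good kf ?L mu' (\<lambda>r c r' c'. filling_less ?L' nu' (ent r c) (ent r' c')) =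
        good kf ?L ((!) mu) (\<lambda>r c r' c'. filling_less ?L' nu' (ent r c) (ent r' c'))"
      by (rule good_shape_cong) (rule mu')
    also have "\<dots> = good kf ?L ((!) mu) (\<lambda>r c r' c'. T ! r ! c < T ! r' ! c')"
    proof (rule good_cong_partition[OF mu])
      fix r c r' c' assume *: "r < ?L" "c < mu ! r" "r' < ?L" "c' < mu ! r'"
      have e: "\<And>p q. p < ?L' \<Longrightarrow> q < nu ! p \<Longrightarrow> ent r c p q = T ! r ! c ! p ! q"
        "\<And>p q. p < ?L' \<Longrightarrow> q < nu ! p \<Longrightarrow> ent r' c' p q = T ! r' ! c' ! p ! q"
        using ent * by blast+
      have "filling_less ?L' nu' (ent r c) (ent r' c') =
          filling_less ?L' ((!) nu) (\<lambda>p q. T ! r ! c ! p ! q) (\<lambda>p q. T ! r' ! c' ! p ! q)"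
        unfolding filling_less_def
      proof (intro ex_cong1 conj_cong refl)
        fix p q assume p: "p < ?L'"
        show "(q < nu' p) = (q < nu ! p)" using nu'[OF p] by simp
        assume "q < nu ! p"
        then show "(ent r c p q < ent r' c' p q) = (T ! r ! c ! p ! q < T ! r' ! c' ! p ! q)"
          "(\<forall>q'<q. ent r c p q' = ent r' c' p q') = (\<forall>q'<q. T ! r ! c ! p ! q'
              = T ! r' ! c' ! p ! q')"
          "(\<forall>p'<p. \<forall>q'<nu' p'. ent r c p' q' = ent r' c' p' q') =
            (\<forall>p'<p. \<forall>q'<nu ! p'. T ! r ! c ! p' ! q' = T ! r' ! c' ! p' ! q')"
          using e p nu' by auto
      qed
      then show "filling_less ?L' nu' (ent r c) (ent r' c') = (T ! r ! c < T ! r' ! c')"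
        using filling_less_iff[OF shape[OF *(1,2)] shape[OF *(3,4)]] by simp
    qed
    finally show ?thesis using T(1) by (simp add: tab_def)
  qed
  \<comment> \<open>Exponents are compared for the first \<open>n\<close> variables. The bound on
    all entries, given by the first conjunct, excludes any further variable from the
    monomial.\<close>
  have 4: "(\<forall>a<?n. (\<Sum>r<?L. \<Sum>c<mu' r. \<Sum>p<?L'. \<Sum>q<nu' p. of_bool (ent r c p q = a)) +
        ((\<Sum>i<a. of_bool (tb i a)) + (\<Sum>j<?n. of_bool (a < j \<and> \<not> tb a j))) = la' a + (?n - 1 - a)) \<longleftrightarrow>
      (\<Sum>x \<in># mset (concat T). mset (concat x)) + choice_mset ?n S = shifted_mset la"
    if supp: "\<forall>x \<in> set (concat T). set (concat x) \<subseteq> {..<?n}"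
  proof -
    let ?M = "\<Sum>x \<in># mset (concat T). mset (concat x)"
    have len: "length T = ?L" "\<And>r. r < ?L \<Longrightarrow> length (T ! r) = mu ! r" using T(1) by auto
    have len': "length (T ! r ! c) = ?L'" "\<And>p. p < ?L' \<Longrightarrow> length (T ! r ! c ! p) = nu ! p"
      if "r < ?L" "c < mu ! r" for r c using shape[OF that] by auto
    have cnt: "count ?M a = (\<Sum>r<?L. \<Sum>c<mu' r. \<Sum>p<?L'. \<Sum>q<nu' p. of_bool (ent r c p q = a))" for a
    proof -
      have "count ?M a = (\<Sum>r<?L. \<Sum>c<length (T ! r). count (mset (concat (T ! r ! c))) a)"
        unfolding count_sum_mset_image unfolding sum_mset_concat len(1) ..
      also have "\<dots> = (\<Sum>r<?L. \<Sum>c<mu' r. \<Sum>p<?L'. \<Sum>q<nu' p. of_bool (ent r c p q = a))"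
      proof (rule sum.cong[OF refl], rule sum.cong)
        fix r assume "r \<in> {..<?L}"
        then have r: "r < ?L" by simp
        show "{..<length (T ! r)} = {..<mu' r}" using len(2)[OF r] mu'[OF r] by simp
        fix c assume "c \<in> {..<mu' r}"
        then have c: "c < mu ! r" using mu'[OF r] by simp
        have "count (mset (concat (T ! r ! c))) a = (\<Sum>p<?L'. \<Sum>q<length (T ! r ! c ! p). of_bool (T
            ! r ! c ! p ! q = a))"
          unfolding count_mset_sum unfolding sum_mset_concat len'(1)[OF r c] ..
        also have "\<dots> = (\<Sum>p<?L'. \<Sum>q<nu' p. of_bool (ent r c p q = a))"
          using len'(2)[OF r c] nu' ent[OF r c] by (intro sum.cong) auto
        finally show "count (mset (concat (T ! r ! c))) a = (\<Sum>p<?L'. \<Sum>q<nu' p. of_bool (ent r c p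
            q = a))" .
      qed
      finally show ?thesis .
    qed
    have "set_mset ?M \<subseteq> {..<?n}" using supp by auto
    then have out: "count (?M + choice_mset ?n S) a = count (shifted_mset la) a" if "\<not> a < ?n" for a
    proof -
      have "a \<notin># ?M" "a \<notin># choice_mset ?n S" "a \<notin># shifted_mset la"
        using that \<open>set_mset ?M \<subseteq> {..<?n}\<close> set_choice_mset[OF S] set_shifted_mset[of
            "shifted_mset la" "{#}" la]
        by auto
      then show ?thesis by (simp only: count_union not_in_iff)
    qed
    have "?M + choice_mset ?n S = shifted_mset la \<longleftrightarrow>
        (\<forall>a<?n. count (?M + choice_mset ?n S) a = count (shifted_mset la) a)"
      unfolding multiset_eq_iff using out by blast
    also have "\<dots> \<longleftrightarrow> (\<forall>a<?n. (\<Sum>r<?L. \<Sum>c<mu' r. \<Sum>p<?L'. \<Sum>q<nu' p. of_bool (ent r c p q = a)) +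
        ((\<Sum>i<a. of_bool (tb i a)) + (\<Sum>j<?n. of_bool (a < j \<and> \<not> tb a j))) = la' a + (?n - 1 - a))"
    proof (intro all_cong)
      fix a assume a: "a < ?n"
      have "count (choice_mset ?n S) a = (\<Sum>i<a. of_bool (tb i a)) + (\<Sum>j<?n. of_bool (a < j
          \<and> \<not> tb a j))"
        unfolding count_choice_mset[OF S a] using tb a by (intro arg_cong2[where f =
            "(+)"] sum.cong) auto
      then show "(count (?M + choice_mset ?n S) a = count (shifted_mset la) a) =
        ((\<Sum>r<?L. \<Sum>c<mu' r. \<Sum>p<?L'. \<Sum>q<nu' p. of_bool (ent r c p q = a)) +
        ((\<Sum>i<a. of_bool (tb i a)) + (\<Sum>j<?n. of_bool (a < j \<and> \<not> tb a j))) = la' a + (?n - 1 - a))"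
        unfolding count_union cnt count_shifted_mset[OF a] la'[OF a] by (simp only:)
    qed
    finally show ?thesis by simp
  qed
  have tb_sum: "(\<Sum>i<?n. \<Sum>j<?n. of_bool (tb i j)) = card S"
    unfolding card_choice[OF S] using tb by (intro sum.cong) auto
  \<comment> \<open>From \<open>N = h + h + par\<close> it follows that \<open>h\<close> is at most
    \<open>N\<close>, so the bounded search is complete.\<close>
  have half: "(\<exists>h < Suc N. N = h + h + par) \<longleftrightarrow> (\<exists>h. N = h + h + par)" for N
  proof
    assume "\<exists>h. N = h + h + par"
    then obtain h where "N = h + h + par" ..
    then have "h < Suc N \<and> N = h + h + par" by simp
    then show "\<exists>h < Suc N. N = h + h + par" ..
  qed blast
  have 5: "(\<exists>h < Suc (\<Sum>i<?n. \<Sum>j<?n. of_bool (tb i j)). (\<Sum>i<?n. \<Sum>j<?n. of_bool (tb i j)) = h + h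
      + par) \<longleftrightarrow>
      (\<exists>h. card S = h + h + par)"
    unfolding tb_sum by (rule half)
  show ?thesis
    unfolding certificate_def two_level_def inner_fillings_def 1 2 3 5 using 4 by blast
qed

subsection \<open>Counter programs\<close>

text \<open>
  Register 0 is the position of the head on the input tape; every other register is the head position
  on a work tape whose cell 0 alone is marked, so that being zero can be tested. Nothing is ever
  written after the first step.
\<close>

datatype test = Pos nat | Sym "nat \<Rightarrow> bool"

datatype com = Skip | Inc nat | Dec nat | Seq com com | If test com com | While test com

definition symbol_at :: "nat list \<Rightarrow> nat \<Rightarrow> nat" where
  "symbol_at x i = (if i < length x then x ! i else 0)"

fun test_holds :: "nat list \<Rightarrow> test \<Rightarrow> (nat \<Rightarrow> nat) \<Rightarrow> bool" where
  "test_holds x (Pos r) s \<longleftrightarrow> 0 < s r"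
| "test_holds x (Sym P) s \<longleftrightarrow> P (symbol_at x (s 0))"

text \<open>The time is the exact number of steps of the compiled machine: a test costs one step,
  and so does the jump that ends a then-branch or a loop body. \<open>Dec\<close> has no rule at
  zero, so no head ever moves to the left of its origin.\<close>

inductive exec :: "nat list \<Rightarrow> com \<Rightarrow> (nat \<Rightarrow> nat) \<Rightarrow> nat \<Rightarrow> (nat \<Rightarrow> nat) \<Rightarrow> bool" for x where
  "exec x Skip s 0 s"
| "exec x (Inc r) s 1 (s(r := Suc (s r)))"
| "0 < s r \<Longrightarrow> exec x (Dec r) s 1 (s(r := s r - 1))"
| "exec x c s t s' \<Longrightarrow> exec x d s' t' s'' \<Longrightarrow> exec x (Seq c d) s (t + t') s''"
| "test_holds x b s \<Longrightarrow> exec x c s t s' \<Longrightarrow> exec x (If b c d) s (Suc (t + 1)) s'"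
| "\<not> test_holds x b s \<Longrightarrow> exec x d s t s' \<Longrightarrow> exec x (If b c d) s (Suc t) s'"
| "\<not> test_holds x b s \<Longrightarrow> exec x (While b c) s 1 s"
| "test_holds x b s \<Longrightarrow> exec x c s t s' \<Longrightarrow> exec x (While b c) s' t' s'' \<Longrightarrow>
     exec x (While b c) s (Suc (t + Suc t')) s''"

subsection \<open>Compilation to Turing machines\<close>

datatype instr = IInc nat | IDec nat | JumpUnless test nat | Jump nat

fun code_length :: "com \<Rightarrow> nat" where
  "code_length Skip = 0"
| "code_length (Inc r) = 1"
| "code_length (Dec r) = 1"
| "code_length (Seq c d) = code_length c + code_length d"
| "code_length (If b c d) = code_length c + code_length d + 2"
| "code_length (While b c) = code_length c + 2"

fun compile :: "com \<Rightarrow> nat \<Rightarrow> instr list" where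
  "compile Skip a = []"
| "compile (Inc r) a = [IInc r]"
| "compile (Dec r) a = [IDec r]"
| "compile (Seq c d) a = compile c a @ compile d (a + code_length c)"
| "compile (If b c d) a =
     JumpUnless b (a + code_length c + 2) # compile c (Suc a) @
     Jump (a + code_length c + code_length d + 2) # compile d (a + code_length c + 2)"
| "compile (While b c) a =
     JumpUnless b (a + code_length c + 2) # compile c (Suc a) @ [Jump a]"

lemma length_compile [simp]: "length (compile c a) = code_length c"
  by (induction c a rule: compile.induct) auto

text \<open>\<open>Pos 0\<close> is excluded because the input tape has no mark at its
  origin.\<close>

fun test_ok :: "nat \<Rightarrow> test \<Rightarrow> bool" where
  "test_ok k (Pos r) \<longleftrightarrow> 0 < r \<and> r < k"
| "test_ok k (Sym P) \<longleftrightarrow> True"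

fun com_ok :: "nat \<Rightarrow> com \<Rightarrow> bool" where
  "com_ok k Skip \<longleftrightarrow> True"
| "com_ok k (Inc r) \<longleftrightarrow> r < k"
| "com_ok k (Dec r) \<longleftrightarrow> r < k"
| "com_ok k (Seq c d) \<longleftrightarrow> com_ok k c \<and> com_ok k d"
| "com_ok k (If b c d) \<longleftrightarrow> test_ok k b \<and> com_ok k c \<and> com_ok k d"
| "com_ok k (While b c) \<longleftrightarrow> test_ok k b \<and> com_ok k c"

lemma com_ok_mono: "com_ok k c \<Longrightarrow> k \<le> k' \<Longrightarrow> com_ok k' c"
proof -
  have "test_ok k b \<Longrightarrow> k \<le> k' \<Longrightarrow> test_ok k' b" for b
    by (cases b) auto
  then show "com_ok k c \<Longrightarrow> k \<le> k' \<Longrightarrow> com_ok k' c"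
    by (induction c) auto
qed


text \<open>A work tape shows the mark 1 at cell 0 and nowhere else, so any other symbol means a
  positive counter.\<close>

fun symbol_test :: "test \<Rightarrow> nat list \<Rightarrow> bool" where
  "symbol_test (Pos r) syms \<longleftrightarrow> syms ! r \<noteq> 1"
| "symbol_test (Sym P) syms \<longleftrightarrow> P (syms ! 0)"

definition moves :: "nat \<Rightarrow> nat list \<Rightarrow> (nat \<Rightarrow> int) \<Rightarrow> (nat \<times> int) list" where
  "moves k syms d = map (\<lambda>i. (syms ! i, d i)) [0..<k]"

fun instr_delta :: "nat \<Rightarrow> instr \<Rightarrow> nat \<Rightarrow> nat list \<Rightarrow> nat \<times> (nat \<times> int) list" where
  "instr_delta k (IInc r) q syms = (Suc q, moves k syms (\<lambda>i. if i = r then 1 else 0))"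
| "instr_delta k (IDec r) q syms = (Suc q, moves k syms (\<lambda>i. if i = r then -1 else 0))"
| "instr_delta k (JumpUnless b a) q syms =
     (if symbol_test b syms then Suc q else a, moves k syms (\<lambda>_. 0))"
| "instr_delta k (Jump a) q syms = (a, moves k syms (\<lambda>_. 0))"

text \<open>
  With \<open>L\<close> instructions, the program counter is the state; \<open>L\<close> accepts, \<open>L + 1\<close> rejects, and the
  initial state \<open>L + 2\<close> marks the origins of the work tapes. The minimum only serves to make the
  machine well-formed for arbitrary jump targets.
\<close>

definition machine :: "nat \<Rightarrow> instr list \<Rightarrow> tm" where
  "machine k P =
     \<lparr>tm_tapes = k, tm_states = length P + 3, tm_symbols = 4, tm_start = length P + 2,
      tm_accept = length P, tm_reject = length P + 1,
      tm_delta = (\<lambda>q syms.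
        if q < length P then map_prod (min (length P + 2)) id (instr_delta k (P ! q) q syms)
        else (0, map (\<lambda>i. (if i = 0 then syms ! 0 else 1, 0)) [0..<k]))\<rparr>"

lemma machine_sel [simp]:
  "tm_tapes (machine k P) = k" "tm_states (machine k P) = length P + 3"
  "tm_symbols (machine k P) = 4" "tm_start (machine k P) = length P + 2"
  "tm_accept (machine k P) = length P" "tm_reject (machine k P) = length P + 1"
  by (simp_all add: machine_def)

lemma instr_delta_wf:
  assumes "length syms = k" "\<forall>a \<in> set syms. a < 4" "instr_delta k I q syms = (q', acts)"
  shows "length acts = k \<and> (\<forall>(a, d) \<in> set acts. a < 4 \<and> d \<in> {-1, 0, 1})"
  using assms by (cases I) (auto simp: moves_def split: if_splits)

lemma wf_machine:
  assumes "1 \<le> k"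
  shows "wf_tm (machine k P)"
proof -
  have "q' < length P + 3 \<and> length acts = k \<and> (\<forall>(a, d) \<in> set acts. a < 4 \<and> d \<in> {-1, 0, 1})"
    if syms: "length syms = k" "\<forall>a \<in> set syms. a < 4"
      and delta: "tm_delta (machine k P) q syms = (q', acts)" for q syms q' acts
  proof (cases "q < length P")
    case True
    obtain p bs where p: "instr_delta k (P ! q) q syms = (p, bs)" by force
    show ?thesis
      using instr_delta_wf[OF syms p] True delta p by (auto simp: machine_def)
  next
    case False
    then show ?thesis using delta syms assms by (auto simp: machine_def)
  qed
  then have "case tm_delta (machine k P) q syms of (q', acts) \<Rightarrow>
      q' < length P + 3 \<and> length acts = k \<and> (\<forall>(a, d) \<in> set acts. a < 4 \<and> d \<in> {-1, 0, 1})"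
    if "length syms = k" "\<forall>a \<in> set syms. a < 4" for q syms
    using that by (simp only: case_prod_beta) (metis prod.collapse)
  then show ?thesis
    using assms unfolding wf_tm_def machine_sel by simp
qed

definition store_tapes :: "nat \<Rightarrow> nat list \<Rightarrow> (nat \<Rightarrow> nat) \<Rightarrow> tape list" where
  "store_tapes k x s =
     map (\<lambda>r. (if r = 0 then (\<lambda>i. if 0 \<le> i \<and> i < int (length x) then x ! nat i else 0)
               else (\<lambda>i. if i = 0 then 1 else 0), int (s r))) [0..<k]"

lemma length_store_tapes [simp]: "length (store_tapes k x s) = k"
  by (simp add: store_tapes_def)

lemma symbol_test_store:
  assumes "test_ok k b" "1 \<le> k"
  shows "symbol_test b (map tape_read (store_tapes k x s)) = test_holds x b s"
  using assms by (cases b) (auto simp: store_tapes_def tape_read_def symbol_at_def)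

lemma moves_store:
  assumes "\<And>i. i < k \<Longrightarrow> int (s' i) = int (s i) + d i"
  shows "map2 tape_act (moves k (map tape_read (store_tapes k x s)) d) (store_tapes k x s)
       = store_tapes k x s'"
  using assms by (intro nth_equalityI) (auto simp: moves_def store_tapes_def tape_act_def
      tape_read_def)

lemma machine_step:
  assumes "q < length P" "instr_delta k (P ! q) q (map tape_read (store_tapes k x s)) =
      (q', moves k (map tape_read (store_tapes k x s)) d)"
    and "q' \<le> length P" and "\<And>i. i < k \<Longrightarrow> int (s' i) = int (s i) + d i"
  shows "tm_step (machine k P) (q, store_tapes k x s) = (q', store_tapes k x s')"
  using assms moves_store[OF assms(4), where x = x] by (auto simp: tm_step_def machine_def)

definition code_at :: "instr list \<Rightarrow> nat \<Rightarrow> instr list \<Rightarrow> bool" where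
  "code_at P a C \<longleftrightarrow> a + length C \<le> length P \<and> (\<forall>i < length C. P ! (a + i) = C ! i)"

lemma code_at_Cons: "code_at P a (I # C) \<longleftrightarrow> a < length P \<and> P ! a = I \<and> code_at P (Suc a) C"
proof -
  have "(\<forall>i < Suc n. Q i) \<longleftrightarrow> Q 0 \<and> (\<forall>i < n. Q (Suc i))" for n Q
    by (auto simp: less_Suc_eq_0_disj)
  then show ?thesis
    by (auto simp: code_at_def)
qed

lemma code_at_append: "code_at P a (C @ D) \<longleftrightarrow> code_at P a C \<and> code_at P (a + length C) D"
proof (induction C arbitrary: a)
  case Nil
  then show ?case by (auto simp: code_at_def)
next
  case (Cons I C)
  then show ?case by (auto simp: code_at_Cons)
qed

lemma code_at_le: "code_at P a C \<Longrightarrow> a + length C \<le> length P"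
  by (simp add: code_at_def)

lemma funpow_add_apply: "(f ^^ m) c = d \<Longrightarrow> (f ^^ n) d = e \<Longrightarrow> (f ^^ (m + n)) c = e"
  by (simp add: funpow_add add.commute[of m])

lemma funpow_Suc_apply: "(f ^^ 1) c = d \<Longrightarrow> (f ^^ n) d = e \<Longrightarrow> (f ^^ Suc n) c = e"
  by (simp add: funpow_swap1)

lemma exec_machine:
  assumes "exec x c s t s'" "code_at P a (compile c a)" "com_ok k c" "1 \<le> k"
  shows "(tm_step (machine k P) ^^ t) (a, store_tapes k x s) = (a
      + code_length c, store_tapes k x s')"
  using assms
proof (induction arbitrary: a rule: exec.induct)
  case (1 s)
  then show ?case by simp
next
  case (2 s r)
  then show ?case by (auto simp: code_at_Cons intro!: machine_step)
next
  case (3 s r)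
  then show ?case by (auto simp: code_at_Cons intro!: machine_step)
next
  case (4 c s t s' d t' s'')
  then show ?case
    by (auto simp: code_at_append add.assoc intro!: funpow_add_apply)
next
  case (5 b s c t s' d)
  note C = code_at_le[OF "5.prems"(1)]
  show ?case
  proof (rule funpow_Suc_apply)
    show "(tm_step (machine k P) ^^ 1) (a, store_tapes k x s) = (Suc a, store_tapes k x s)"
      using 5 C by (simp, intro machine_step) (auto simp: code_at_Cons code_at_append
          symbol_test_store)
    show "(tm_step (machine k P) ^^ (t + 1)) (Suc a, store_tapes k x s) =
        (a + code_length (If b c d), store_tapes k x s')"
    proof (rule funpow_add_apply)
      show "(tm_step (machine k P) ^^ t) (Suc a, store_tapes k x s) =
          (Suc a + code_length c, store_tapes k x s')"
        using 5 by (auto simp: code_at_Cons code_at_append)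
      show "(tm_step (machine k P) ^^ 1) (Suc a + code_length c, store_tapes k x s') =
        (a + code_length (If b c d), store_tapes k x s')"
        using 5 C by (auto simp: code_at_Cons code_at_append intro!: machine_step)
    qed
  qed
next
  case (6 b s d t s' c)
  note C = code_at_le[OF "6.prems"(1)]
  have "(tm_step (machine k P) ^^ 1) (a, store_tapes k x s) = (a + code_length c
      + 2, store_tapes k x s)"
    using 6 C by (simp, intro machine_step) (auto simp: code_at_Cons code_at_append
        symbol_test_store)
  moreover have "(tm_step (machine k P) ^^ t) (a + code_length c + 2, store_tapes k x s) =
      (a + code_length (If b c d), store_tapes k x s')"
    using "6.IH"[of "a + code_length c + 2"] "6.prems"
    by (auto simp: code_at_Cons code_at_append algebra_simps)
  ultimately show ?case by (rule funpow_Suc_apply)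
next
  case (7 b s c)
  note C = code_at_le[OF "7.prems"(1)]
  show ?case
    using 7 C by (auto simp: code_at_Cons code_at_append symbol_test_store intro!: machine_step)
next
  case (8 b s c t s' t' s'')
  note C = code_at_le[OF "8.prems"(1)]
  have P: "a < length P" "P ! a = JumpUnless b (a + code_length c + 2)"
    "code_at P (Suc a) (compile c (Suc a))" "Suc a + code_length c < length P"
    "P ! (Suc a + code_length c) = Jump a" "test_ok k b" "com_ok k c"
    using "8.prems" by (auto simp: code_at_Cons code_at_append)
  have "tm_step (machine k P) (a, store_tapes k x s) = (Suc a, store_tapes k x s)"
    by (rule machine_step) (use P C "8.hyps"(1) "8.prems"(3) in \<open>auto simp: symbol_test_store\<close>)
  then have 1: "(tm_step (machine k P) ^^ 1) (a, store_tapes k x s) = (Suc a, store_tapes k x s)"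
    by simp
  have 2: "(tm_step (machine k P) ^^ t) (Suc a, store_tapes k x s) =
      (Suc a + code_length c, store_tapes k x s')"
    using "8.IH"(1) P "8.prems"(3) by blast
  have "tm_step (machine k P) (Suc a + code_length c, store_tapes k x s') = (a, store_tapes k x s')"
    by (rule machine_step) (use P in auto)
  then have 3: "(tm_step (machine k P) ^^ 1) (Suc a + code_length c, store_tapes k x s') =
      (a, store_tapes k x s')"
    by simp
  have "(tm_step (machine k P) ^^ t') (a, store_tapes k x s') =
      (a + code_length (While b c), store_tapes k x s'')"
    using "8.IH"(2) "8.prems" by blast
  then have "(tm_step (machine k P) ^^ Suc t') (Suc a + code_length c, store_tapes k x s') =
      (a + code_length (While b c), store_tapes k x s'')"
    by (rule funpow_Suc_apply[where f = "tm_step (machine k P)", OF 3])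
  then have "(tm_step (machine k P) ^^ (t + Suc t')) (Suc a, store_tapes k x s) =
      (a + code_length (While b c), store_tapes k x s'')"
    by (rule funpow_add_apply[where f = "tm_step (machine k P)", OF 2])
  then show ?case
    by (rule funpow_Suc_apply[where f = "tm_step (machine k P)", OF 1])
qed

text \<open>One step marks the origins and one tests the answer, hence \<open>t + 2\<close>. The
  test is the last instruction: falling through leads to state \<open>length P\<close>, which
  accepts, and the jump target \<open>code_length c + 2\<close> is the rejecting state
  \<open>length P + 1\<close>.\<close>

lemma exec_decides:
  assumes "exec x c (\<lambda>_. 0) t s'" "com_ok k c" "0 < r" "r < k"
  defines "P \<equiv> compile c 0 @ [JumpUnless (Pos r) (code_length c + 2)]"
  shows "fst ((tm_step (machine k P) ^^ (t + 2)) (tm_init (machine k P) x)) =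
    (if 0 < s' r then tm_accept (machine k P) else tm_reject (machine k P))"
proof -
  let ?M = "machine k P"
  have P: "code_at P 0 (compile c 0)" "length P = Suc (code_length c)"
    "P ! code_length c = JumpUnless (Pos r) (code_length c + 2)"
    by (auto simp: P_def code_at_def nth_append)
  have "map2 tape_act (map (\<lambda>i. (if i = 0 then map tape_read (snd (tm_init ?M x)) ! 0 else 1, 0))
      [0..<k])
      (snd (tm_init ?M x)) = store_tapes k x (\<lambda>_. 0)"
    using assms(3,4)
    by (intro nth_equalityI)
       (auto simp: tm_init_def machine_def store_tapes_def tape_act_def tape_read_def nth_Cons'
         split: if_splits)
  moreover have "tm_delta ?M (length P + 2) syms =
      (0, map (\<lambda>i. (if i = 0 then syms ! 0 else 1, 0)) [0..<k])" for syms
    by (simp add: machine_def)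
  moreover have "fst (tm_init ?M x) = length P + 2"
    by (simp add: tm_init_def)
  ultimately have 1: "(tm_step ?M ^^ 1) (tm_init ?M x) = (0, store_tapes k x (\<lambda>_. 0))"
    by (simp add: tm_step_def)
  have 2: "(tm_step ?M ^^ t) (0, store_tapes k x (\<lambda>_. 0)) = (code_length c, store_tapes k x s')"
    using exec_machine[OF assms(1) P(1) assms(2)] assms(3,4) by simp
  have 3: "tm_step ?M (code_length c, store_tapes k x s') =
      (if 0 < s' r then length P else Suc (length P), store_tapes k x s')"
  proof -
    have "symbol_test (Pos r) (map tape_read (store_tapes k x s')) = (0 < s' r)"
      using symbol_test_store[of k "Pos r"] assms(3,4) by simp
    then have "tm_delta ?M (code_length c) (map tape_read (store_tapes k x s')) =
        (if 0 < s' r then length P else Suc (length P),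
         moves k (map tape_read (store_tapes k x s')) (\<lambda>_. 0))"
      using P by (simp add: machine_def)
    then show ?thesis
      using moves_store[of k s' s' "\<lambda>_. 0" x] P(2) unfolding tm_step_def by simp
  qed
  have "(tm_step ?M ^^ Suc (t + 1)) (tm_init ?M x) =
      (if 0 < s' r then length P else Suc (length P), store_tapes k x s')"
    by (rule funpow_Suc_apply[where f = "tm_step ?M", OF 1],
        rule funpow_add_apply[where f = "tm_step ?M", OF 2]) (simp add: 3)
  then show ?thesis by (simp add: machine_def)
qed

section \<open>Execution within a time bound\<close>

definition execs :: "nat list \<Rightarrow> com \<Rightarrow> (nat \<Rightarrow> nat) \<Rightarrow> nat \<Rightarrow> (nat \<Rightarrow> nat) \<Rightarrow> bool" where
  "execs x c s T s' \<longleftrightarrow> (\<exists>t \<le> T. exec x c s t s')"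

lemma execs_mono: "execs x c s T s' \<Longrightarrow> T \<le> T' \<Longrightarrow> execs x c s T' s'"
  unfolding execs_def using le_trans by blast

lemma execs_Skip: "s' = s \<Longrightarrow> execs x Skip s 0 s'"
  unfolding execs_def using exec.intros(1) by blast

lemma execs_Inc: "s' = s(r := Suc (s r)) \<Longrightarrow> execs x (Inc r) s 1 s'"
  unfolding execs_def using exec.intros(2) by blast

lemma execs_Dec: "0 < s r \<Longrightarrow> s' = s(r := s r - 1) \<Longrightarrow> execs x (Dec r) s 1 s'"
  unfolding execs_def using exec.intros(3) by blast

lemma execs_Seq:
  "execs x c s T s' \<Longrightarrow> execs x d s' T' s'' \<Longrightarrow> execs x (Seq c d) s (T + T') s''"
  unfolding execs_def using exec.intros(4) add_mono by blast

lemma execs_If: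
  assumes "test_holds x b s \<Longrightarrow> execs x c s T s'" "\<not> test_holds x b s \<Longrightarrow> execs x d s T s'"
  shows "execs x (If b c d) s (T + 2) s'"
proof (cases "test_holds x b s")
  case True
  with assms obtain t where "t \<le> T" "exec x c s t s'" by (auto simp: execs_def)
  with True show ?thesis
    unfolding execs_def using exec.intros(5)[of x b s c t s' d] by (intro exI[of _ "Suc (t
        + 1)"]) auto
next
  case False
  with assms obtain t where "t \<le> T" "exec x d s t s'" by (auto simp: execs_def)
  with False show ?thesis
    unfolding execs_def by (intro exI[of _ "Suc t"]) (auto intro: exec.intros(6))
qed

text \<open>\<open>S i\<close> is the store after \<open>i\<close> rounds. A round costs its body
  plus a test and the jump back; the failing test at the end costs one more step.\<close>

lemma execs_While:
  assumes "\<And>i. i < n \<Longrightarrow> test_holds x b (S i) \<and> execs x c (S i) T (S (Suc i))"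
    and "\<not> test_holds x b (S n)" "s = S 0" "s' = S n"
  shows "execs x (While b c) s (n * (T + 2) + 1) s'"
  using assms
proof (induction n arbitrary: S s)
  case 0
  then show ?case using exec.intros(7) by (auto simp: execs_def)
next
  case (Suc n)
  have "execs x (While b c) (S 1) (n * (T + 2) + 1) s'"
    by (rule Suc.IH[of "\<lambda>i. S (Suc i)"]) (use Suc.prems in auto)
  then obtain t' where t': "t' \<le> n * (T + 2) + 1" "exec x (While b c) (S 1) t' s'"
    by (auto simp: execs_def)
  obtain t where t: "t \<le> T" "exec x c (S 0) t (S 1)"
    using Suc.prems(1)[of 0] by (auto simp: execs_def)
  have "exec x (While b c) (S 0) (Suc (t + Suc t')) s'"
    using Suc.prems(1)[of 0] t t' by (intro exec.intros(8)) auto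
  then show ?case
    unfolding execs_def Suc.prems(3)
    by (intro exI[of _ "Suc (t + Suc t')"]) (use t t' in auto)
qed

subsection \<open>Terms with bounded sums\<close>

datatype trm = Var nat | One | Len | Inp nat trm | Add trm trm | Monus trm trm | Sum trm trm

text \<open>Variables are de Bruijn indices; \<open>Sum\<close> binds the index of summation.\<close>

fun eval :: "trm \<Rightarrow> nat list \<Rightarrow> (nat \<Rightarrow> nat) \<Rightarrow> nat" where
  "eval (Var v) x e = e v"
| "eval One x e = 1"
| "eval Len x e = length x"
| "eval (Inp a t) x e = of_bool (symbol_at x (eval t x e) = a)"
| "eval (Add t u) x e = eval t x e + eval u x e"
| "eval (Monus t u) x e = eval t x e - eval u x e"
| "eval (Sum t u) x e = (\<Sum>i < eval t x e. eval u x (case_nat i e))"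

text \<open>
  The program adds the value of the term to register \<open>r\<close>. Variable \<open>v\<close> is kept in register \<open>\<rho> v\<close>, and
  the registers from \<open>m\<close> on are free.
\<close>

fun program :: "trm \<Rightarrow> (nat \<Rightarrow> nat) \<Rightarrow> nat \<Rightarrow> nat \<Rightarrow> com" where
  "program (Var v) \<rho> m r =
     Seq (While (Pos (\<rho> v)) (Seq (Dec (\<rho> v)) (Seq (Inc r) (Inc m))))
         (While (Pos m) (Seq (Dec m) (Inc (\<rho> v))))"
| "program One \<rho> m r = Inc r"
| "program Len \<rho> m r =
     Seq (While (Sym (\<lambda>a. a \<noteq> 0)) (Seq (Inc 0) (Seq (Inc r) (Inc m))))
         (While (Pos m) (Seq (Dec m) (Dec 0)))"
| "program (Inp a t) \<rho> m r =
     Seq (program t \<rho> (m + 1) m)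
    (Seq (While (Pos m) (Seq (Dec m) (Seq (Inc 0) (Inc (m + 1)))))
    (Seq (If (Sym (\<lambda>b. b = a)) (Inc r) Skip)
         (While (Pos (m + 1)) (Seq (Dec (m + 1)) (Dec 0)))))"
| "program (Add t u) \<rho> m r = Seq (program t \<rho> m r) (program u \<rho> m r)"
| "program (Monus t u) \<rho> m r =
     Seq (program t \<rho> (m + 2) m)
    (Seq (program u \<rho> (m + 2) (m + 1))
    (Seq (While (Pos (m + 1)) (Seq (Dec (m + 1)) (If (Pos m) (Dec m) Skip)))
         (While (Pos m) (Seq (Dec m) (Inc r)))))"
| "program (Sum t u) \<rho> m r =
     Seq (program t \<rho> (m + 2) m)
    (Seq (While (Pos m)
            (Seq (Dec m) (Seq (program u (case_nat (m + 1) \<rho>) (m + 2) r) (Inc (m + 1)))))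
         (While (Pos (m + 1)) (Dec (m + 1))))"

lemma program_ok: "(\<And>v. 0 < \<rho> v \<and> \<rho> v < m) \<Longrightarrow> 0 < r \<Longrightarrow> r < m \<Longrightarrow> \<exists>k. com_ok k (program t \<rho> m r)"
proof (induction t arbitrary: \<rho> m r)
  case (Var v)
  then show ?case by (intro exI[of _ "Suc m"]) (auto intro: less_SucI)
next
  case One
  then show ?case by auto
next
  case Len
  then show ?case by (intro exI[of _ "Suc m"]) auto
next
  case (Inp a t)
  have "\<exists>k. com_ok k (program t \<rho> (m + 1) m)"
    using Inp.prems by (intro Inp.IH) (auto intro: less_SucI)
  then obtain k where k: "com_ok k (program t \<rho> (m + 1) m)" ..
  show ?case
    using com_ok_mono[OF k, of "max k (m + 2)"] Inp.prems
    by (intro exI[of _ "max k (m + 2)"]) auto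
next
  case (Add t u)
  from Add.IH(1)[of \<rho> m r] Add.IH(2)[of \<rho> m r] Add.prems obtain k k' where
    k: "com_ok k (program t \<rho> m r)" "com_ok k' (program u \<rho> m r)" by blast
  show ?case
    using com_ok_mono[OF k(1), of "max k k'"] com_ok_mono[OF k(2), of "max k k'"]
    by (intro exI[of _ "max k k'"]) auto
next
  case (Monus t u)
  have "\<exists>k. com_ok k (program t \<rho> (m + 2) m)" "\<exists>k. com_ok k (program u \<rho> (m + 2) (m + 1))"
    using Monus.prems by (intro Monus.IH; auto intro: less_SucI)+
  then obtain k k' where
    k: "com_ok k (program t \<rho> (m + 2) m)" "com_ok k' (program u \<rho> (m + 2) (m + 1))" by blast
  show ?case
    using com_ok_mono[OF k(1), of "k + k' + m + 2"] com_ok_mono[OF k(2), of "k + k' + m + 2"]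
      Monus.prems
    by (intro exI[of _ "k + k' + m + 2"]) auto
next
  case (Sum t u)
  have "\<exists>k. com_ok k (program t \<rho> (m + 2) m)"
    "\<exists>k. com_ok k (program u (case_nat (m + 1) \<rho>) (m + 2) r)"
    using Sum.prems by (intro Sum.IH; auto intro: less_SucI split: nat.split)+
  then obtain k k' where k: "com_ok k (program t \<rho> (m + 2) m)"
    "com_ok k' (program u (case_nat (m + 1) \<rho>) (m + 2) r)" by blast
  show ?case
    using com_ok_mono[OF k(1), of "k + k' + m + 2"] com_ok_mono[OF k(2), of "k + k' + m + 2"]
      Sum.prems
    by (intro exI[of _ "k + k' + m + 2"]) auto
qed

text \<open>\<open>N\<close> bounds the input length and the variables alike. The base
  \<open>N + 2\<close> is at least 2, so constants and sums can be absorbed by raising the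
  exponent.\<close>

definition poly_bounded :: "(nat list \<Rightarrow> (nat \<Rightarrow> nat) \<Rightarrow> nat) \<Rightarrow> bool" where
  "poly_bounded F \<longleftrightarrow>
     (\<exists>k. \<forall>N x e. length x \<le> N \<and> (\<forall>v. e v \<le> N) \<longrightarrow> F x e \<le> (N + 2) ^ k)"

lemma poly_bounded_mono:
  assumes "poly_bounded G" "\<And>x e. F x e \<le> G x e"
  shows "poly_bounded F"
  using assms unfolding poly_bounded_def by (meson le_trans)

lemma poly_bounded_const: "poly_bounded (\<lambda>x e. c)"
  unfolding poly_bounded_def
proof (intro exI allI impI)
  fix N :: nat
  have "c \<le> 2 ^ c" by (simp add: less_imp_le)
  also have "\<dots> \<le> (N + 2) ^ c" by (simp add: power_mono)
  finally show "c \<le> (N + 2) ^ c" .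
qed

lemma poly_bounded_var: "poly_bounded (\<lambda>x e. e v)" and poly_bounded_len: "poly_bounded
    (\<lambda>x e. length x)"
  unfolding poly_bounded_def by (intro exI[of _ 1]; auto intro: le_SucI)+

lemma poly_bounded_mult:
  assumes "poly_bounded F" "poly_bounded G"
  shows "poly_bounded (\<lambda>x e. F x e * G x e)"
proof -
  obtain k where k: "\<And>N x e. length x \<le> N \<Longrightarrow> (\<forall>v. e v \<le> N) \<Longrightarrow> F x e \<le> (N + 2) ^ k"
    using assms(1) unfolding poly_bounded_def by blast
  obtain l where l: "\<And>N x e. length x \<le> N \<Longrightarrow> (\<forall>v. e v \<le> N) \<Longrightarrow> G x e \<le> (N + 2) ^ l"
    using assms(2) unfolding poly_bounded_def by blast
  show ?thesis
    unfolding poly_bounded_def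
    by (rule exI[of _ "k + l"], unfold power_add) (use k l in \<open>blast intro: mult_le_mono\<close>)
qed

text \<open>The sum is at most \<open>(F + 1) * (G + 1)\<close>, and adding 1 costs one more factor
  of the base, which is at least 2.\<close>

lemma poly_bounded_add:
  assumes "poly_bounded F" "poly_bounded G"
  shows "poly_bounded (\<lambda>x e. F x e + G x e)"
proof -
  have "poly_bounded (\<lambda>x e. (F x e + 1) * (G x e + 1))" if "poly_bounded (\<lambda>x e. F x e + 1)"
      "poly_bounded (\<lambda>x e. G x e + 1)"
    using poly_bounded_mult[OF that] .
  moreover have "poly_bounded (\<lambda>x e. H x e + 1)" if H: "poly_bounded H" for H
  proof -
    obtain k where k: "\<And>N x e. length x \<le> N \<Longrightarrow> (\<forall>v. e v \<le> N) \<Longrightarrow> H x e \<le> (N + 2) ^ k"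
      using H unfolding poly_bounded_def by blast
    have "H x e + 1 \<le> (N + 2) ^ Suc k" if "length x \<le> N" "\<forall>v. e v \<le> N" for N x e
    proof -
      have "H x e + 1 \<le> (N + 2) ^ k + 1" using k[OF that] by simp
      also have "\<dots> \<le> (N + 2) ^ k + (N + 2) ^ k" by simp
      also have "\<dots> \<le> (N + 2) ^ Suc k" by simp
      finally show ?thesis .
    qed
    then show ?thesis unfolding poly_bounded_def by blast
  qed
  ultimately have "poly_bounded (\<lambda>x e. (F x e + 1) * (G x e + 1))"
    using assms by blast
  then show ?thesis by (rule poly_bounded_mono) simp
qed

lemma poly_bounded_sum:
  assumes "poly_bounded F" "poly_bounded G"
  shows "poly_bounded (\<lambda>x e. \<Sum>i < F x e. G x (case_nat i e))"
proof -
  obtain k where k: "\<And>N x e. length x \<le> N \<Longrightarrow> (\<forall>v. e v \<le> N) \<Longrightarrow> F x e \<le> (N + 2) ^ k"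
    using assms(1) unfolding poly_bounded_def by blast
  obtain l where l: "\<And>N x e. length x \<le> N \<Longrightarrow> (\<forall>v. e v \<le> N) \<Longrightarrow> G x e \<le> (N + 2) ^ l"
    using assms(2) unfolding poly_bounded_def by blast
  have "(\<Sum>i < F x e. G x (case_nat i e)) \<le> (N + 2) ^ (k + (k + 2) * l)"
    if "length x \<le> N" "\<forall>v. e v \<le> N" for N x e
  proof -
    have "G x (case_nat i e) \<le> (N + 2) ^ ((k + 2) * l)" if "i < F x e" for i
    proof -
      \<comment> \<open>A bound on the extended environment, because the index of summation is
        smaller than \<open>F x e\<close>.\<close>
      let ?N = "(N + 2) ^ k + N"
      have "N + 2 \<le> (N + 2) ^ Suc k" using self_le_power[of "N + 2" "Suc k"] by simp
      then have "?N + 2 \<le> (N + 2) ^ Suc k + (N + 2) ^ Suc k"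
        using power_increasing[of k "Suc k" "N + 2"] by simp
      also have "\<dots> \<le> (N + 2) ^ (k + 2)" by simp
      finally have N: "?N + 2 \<le> (N + 2) ^ (k + 2)" .
      have "G x (case_nat i e) \<le> (?N + 2) ^ l"
        using \<open>length x \<le> N\<close> \<open>\<forall>v. e v \<le> N\<close> k[of x N e] that
        by (intro l) (auto split: nat.split intro: trans_le_add2)
      also have "\<dots> \<le> ((N + 2) ^ (k + 2)) ^ l" using N by (rule power_mono) simp
      finally show ?thesis by (simp only: power_mult)
    qed
    then have "(\<Sum>i < F x e. G x (case_nat i e)) \<le> F x e * (N + 2) ^ ((k + 2) * l)"
      using sum_bounded_above[of "{..<F x e}" "\<lambda>i. G x (case_nat i e)" "(N + 2) ^ ((k + 2) * l)"]
      by simp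
    also have "\<dots> \<le> (N + 2) ^ k * (N + 2) ^ ((k + 2) * l)"
      using k[OF that] by (intro mult_le_mono) auto
    finally show ?thesis by (simp add: power_add)
  qed
  then show ?thesis unfolding poly_bounded_def by blast
qed

lemma poly_bounded_eval: "poly_bounded (eval t)"
proof (induction t)
  case (Inp a t)
  show ?case by (rule poly_bounded_mono[OF poly_bounded_const[of 1]]) simp
next
  case (Add t u)
  then show ?case using poly_bounded_add by (simp add: fun_eq_iff)
next
  case (Monus t u)
  then show ?case by (rule_tac poly_bounded_mono[OF Monus(1)]) simp
next
  case (Sum t u)
  then show ?case using poly_bounded_sum by (simp add: fun_eq_iff)
qed (simp_all add: poly_bounded_var poly_bounded_len poly_bounded_const)

text \<open>The constants add up the loops of \<open>program\<close>. Copying a value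
  \<open>n\<close> and restoring it takes \<open>(5 * n + 1) + (4 * n + 1)\<close> steps, which is
  \<open>9 * n + 2\<close>. For \<open>Sum\<close> every round is charged with the cost of all
  rounds together, a crude bound that stays polynomial.\<close>

fun cost :: "trm \<Rightarrow> nat list \<Rightarrow> (nat \<Rightarrow> nat) \<Rightarrow> nat" where
  "cost (Var v) x e = 9 * e v + 2"
| "cost One x e = 1"
| "cost Len x e = 9 * length x + 2"
| "cost (Inp a t) x e = cost t x e + 9 * eval t x e + 5"
| "cost (Add t u) x e = cost t x e + cost u x e"
| "cost (Monus t u) x e = cost t x e + cost u x e + 6 * eval u x e + 4 * eval t x e + 2"
| "cost (Sum t u) x e = cost t x e +
     eval t x e * ((\<Sum>i < eval t x e. cost u x (case_nat i e)) + 7) + 2"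

lemma poly_bounded_cost: "poly_bounded (cost t)"
proof (induction t)
  case (Var v)
  have "cost (Var v) = (\<lambda>x e. 9 * e v + 2)" by (simp add: fun_eq_iff)
  then show ?case
    by (simp only:) (intro poly_bounded_add poly_bounded_mult poly_bounded_var poly_bounded_const)
next
  case One
  have "cost One = (\<lambda>x e. 1)" by (simp add: fun_eq_iff)
  then show ?case by (simp only: poly_bounded_const)
next
  case Len
  have "cost Len = (\<lambda>x e. 9 * length x + 2)" by (simp add: fun_eq_iff)
  then show ?case
    by (simp only:) (intro poly_bounded_add poly_bounded_mult poly_bounded_len poly_bounded_const)
next
  case (Inp a t)
  have "cost (Inp a t) = (\<lambda>x e. cost t x e + 9 * eval t x e + 5)" by (simp add: fun_eq_iff)
  then show ?case
    by (simp only:)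
       (intro poly_bounded_add poly_bounded_mult poly_bounded_const poly_bounded_eval Inp)
next
  case (Add t u)
  have "cost (Add t u) = (\<lambda>x e. cost t x e + cost u x e)" by (simp add: fun_eq_iff)
  then show ?case by (simp only:) (intro poly_bounded_add Add)
next
  case (Monus t u)
  have "cost (Monus t u) =
      (\<lambda>x e. cost t x e + cost u x e + 6 * eval u x e + 4 * eval t x e + 2)"
    by (simp add: fun_eq_iff)
  then show ?case
    by (simp only:)
       (intro poly_bounded_add poly_bounded_mult poly_bounded_const poly_bounded_eval Monus)
next
  case (Sum t u)
  have "cost (Sum t u) = (\<lambda>x e. cost t x e +
      eval t x e * ((\<Sum>i < eval t x e. cost u x (case_nat i e)) + 7) + 2)"
    by (simp add: fun_eq_iff)
  then show ?case
    by (simp only:)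
       (intro poly_bounded_add poly_bounded_mult poly_bounded_const poly_bounded_eval
          poly_bounded_sum Sum)
qed

section \<open>Correctness and running time of the programs for terms\<close>

lemma execs_cong: "execs x c s T s' \<Longrightarrow> T \<le> T' \<Longrightarrow> s' = s'' \<Longrightarrow> execs x c s T' s''"
  using execs_mono by blast

lemma execs_Dec_Inc:
  assumes "0 < s a" "a \<noteq> b" "s' = s(a := s a - 1, b := Suc (s b))"
  shows "execs x (Seq (Dec a) (Inc b)) s 2 s'"
  by (rule execs_cong[OF execs_Seq[OF execs_Dec[where s = s and r = a] execs_Inc]])
     (use assms in auto)

lemma execs_Dec_Dec:
  assumes "0 < s a" "0 < s b" "a \<noteq> b" "s' = s(a := s a - 1, b := s b - 1)"
  shows "execs x (Seq (Dec a) (Dec b)) s 2 s'"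
  by (rule execs_cong[OF execs_Seq[OF execs_Dec[where s = s and r = a]
        execs_Dec[where s = "s(a := s a - 1)" and r = b]]])
     (use assms in auto)

lemma execs_Inc_Inc:
  assumes "a \<noteq> b" "s' = s(a := Suc (s a), b := Suc (s b))"
  shows "execs x (Seq (Inc a) (Inc b)) s 2 s'"
  by (rule execs_cong[OF execs_Seq[OF execs_Inc execs_Inc]]) (use assms in auto)

lemma execs_Dec_Inc_Inc:
  assumes "0 < s a" "a \<noteq> b" "a \<noteq> c" "b \<noteq> c" "s' = s(a := s a - 1, b := Suc (s b), c := Suc (s c))"
  shows "execs x (Seq (Dec a) (Seq (Inc b) (Inc c))) s 3 s'"
  by (rule execs_cong[OF execs_Seq[OF execs_Dec[where s = s and r = a] execs_Inc_Inc]])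
     (use assms in auto)

lemma execs_Inc_Inc_Inc:
  assumes "a \<noteq> b" "a \<noteq> c" "b \<noteq> c" "s' = s(a := Suc (s a), b := Suc (s b), c := Suc (s c))"
  shows "execs x (Seq (Inc a) (Seq (Inc b) (Inc c))) s 3 s'"
  by (rule execs_cong[OF execs_Seq[OF execs_Inc execs_Inc_Inc]]) (use assms in auto)

lemmas execs_simple = execs_Dec execs_Dec_Inc execs_Dec_Dec execs_Dec_Inc_Inc execs_Inc_Inc_Inc

lemma env_registers:
  assumes "0 < a \<and> a < m \<and> a \<noteq> (r :: nat)"
  shows "0 < a" "a < m" "a < Suc m" "a < Suc (Suc m)" "a \<noteq> m" "a \<noteq> Suc m" "a \<noteq> r"
  using assms by auto

text \<open>Register 0 and all registers from \<open>m\<close> on are zero before and after a run,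
  so subterms can share scratch space, and a variable that is counted down gets restored. As the
  input contains no blank, \<open>Len\<close> can recognise its end.\<close>

lemma program_correct:
  assumes "0 \<notin> set x" "\<And>v. 0 < \<rho> v \<and> \<rho> v < m \<and> \<rho> v \<noteq> r" "0 < r" "r < m"
    and "s 0 = 0" "\<And>i. m \<le> i \<Longrightarrow> s i = 0"
  shows "execs x (program t \<rho> m r) s (cost t x (\<lambda>v. s (\<rho> v)))
    (s(r := s r + eval t x (\<lambda>v. s (\<rho> v))))"
  using assms(2-)
proof (induction t arbitrary: \<rho> m r s)
  case (Var v)
  define n where "n = s (\<rho> v)"
  have ne: "\<rho> v \<noteq> r" "\<rho> v \<noteq> m" "r \<noteq> m" "s m = 0" using Var by (metis order_less_irrefl, metis
      order_less_irrefl, auto)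
  have 1: "execs x (While (Pos (\<rho> v)) (Seq (Dec (\<rho> v)) (Seq (Inc r) (Inc m)))) s (n * (3 + 2) + 1)
    (s(\<rho> v := 0, r := s r + n, m := n))"
    by (rule execs_While[where S = "\<lambda>i. s(\<rho> v := n - i, r := s r + i, m := i)"])
       (use ne in \<open>auto simp: n_def fun_upd_idem intro!: execs_simple\<close>)
  have 2: "execs x (While (Pos m) (Seq (Dec m) (Inc (\<rho> v)))) (s(\<rho> v := 0, r := s r + n, m := n))
    (n * (2 + 2) + 1) (s(r := s r + n))"
    by (rule execs_While[where S = "\<lambda>i. s(\<rho> v := i, r := s r + n, m := n - i)"])
       (use ne in \<open>auto simp: n_def fun_upd_idem fun_eq_iff intro!: execs_simple\<close>)
  show ?case
    unfolding program.simps
    by (rule execs_cong[OF execs_Seq[OF 1 2]])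
       (auto simp: fun_eq_iff n_def)
next
  case One
  show ?case
    unfolding program.simps by (rule execs_cong[OF execs_Inc[OF refl]]) (auto simp: fun_eq_iff)
next
  case Len
  define n where "n = length x"
  have ne: "0 \<noteq> r" "0 \<noteq> m" "r \<noteq> m" "s m = 0" "s 0 = 0" using Len by auto
  have sym: "0 < symbol_at x i \<longleftrightarrow> i < n" for i
  proof (cases "i < n")
    case True
    then have "x ! i \<in> set x" by (simp add: n_def)
    then have "x ! i \<noteq> 0" using assms(1) by metis
    then show ?thesis using True by (simp add: symbol_at_def n_def)
  qed (simp add: symbol_at_def n_def)
  have 1: "execs x (While (Sym (\<lambda>a. a \<noteq> 0)) (Seq (Inc 0) (Seq (Inc r) (Inc m)))) s (n * (3 + 2) + 1)
    (s(0 := n, r := s r + n, m := n))"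
    by (rule execs_While[where S = "\<lambda>i. s(0 := i, r := s r + i, m := i)"])
       (use ne in \<open>auto simp: sym fun_upd_idem fun_eq_iff intro!: execs_simple\<close>)
  have 2: "execs x (While (Pos m) (Seq (Dec m) (Dec 0))) (s(0 := n, r := s r + n, m := n))
    (n * (2 + 2) + 1) (s(r := s r + n))"
    by (rule execs_While[where S = "\<lambda>i. s(0 := n - i, r := s r + n, m := n - i)"])
       (use ne in \<open>auto simp: fun_upd_idem fun_eq_iff intro!: execs_simple\<close>)
  show ?case
    unfolding program.simps
    by (rule execs_cong[OF execs_Seq[OF 1 2]])
       (auto simp: fun_eq_iff n_def)
next
  case (Inp a t)
  define n where "n = eval t x (\<lambda>v. s (\<rho> v))"
  have ne: "0 \<noteq> r" "0 \<noteq> m" "r \<noteq> m" "r \<noteq> Suc m" "s m = 0" "s (Suc m) = 0" "s 0 = 0" "r < m"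
    using Inp.prems by auto
  note \<rho> = env_registers[OF Inp.prems(1)]
  have 0: "execs x (program t \<rho> (m + 1) m) s (cost t x (\<lambda>v. s (\<rho> v))) (s(m := n))"
    by (rule execs_cong[OF Inp.IH[of \<rho> "m + 1" m s]])
       (use ne \<rho> Inp.prems(5) in \<open>auto simp: n_def\<close>)
  have 1: "execs x (While (Pos m) (Seq (Dec m) (Seq (Inc 0) (Inc (m + 1))))) (s(m := n))
    (n * (3 + 2) + 1) (s(0 := n, m + 1 := n))"
    by (rule execs_While[where S = "\<lambda>i. s(m := n - i, 0 := i, m + 1 := i)"])
       (use ne in \<open>auto simp: fun_upd_idem fun_eq_iff intro!: execs_simple\<close>)
  define b :: nat where "b = of_bool (symbol_at x n = a)"
  have 2: "execs x (If (Sym (\<lambda>b. b = a)) (Inc r) Skip) (s(0 := n, m + 1 := n)) (1 + 2)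
    (s(0 := n, m + 1 := n, r := s r + b))"
    by (rule execs_If, rule execs_Inc)
       (use ne in \<open>auto simp: b_def fun_eq_iff intro: execs_mono[OF execs_Skip]\<close>)
  have 3: "execs x (While (Pos (m + 1)) (Seq (Dec (m + 1)) (Dec 0))) (s(0 := n, m
      + 1 := n, r := s r + b))
    (n * (2 + 2) + 1) (s(r := s r + b))"
    by (rule execs_While[where S = "\<lambda>i. s(0 := n - i, m + 1 := n - i, r := s r + b)"])
       (use ne in \<open>auto simp: fun_upd_idem fun_eq_iff intro!: execs_simple\<close>)
  show ?case
    unfolding program.simps
    by (rule execs_cong[OF execs_Seq[OF 0 execs_Seq[OF 1 execs_Seq[OF 2 3]]]])
       (auto simp: fun_eq_iff n_def b_def)
next
  case (Add t u)
  note \<rho> = env_registers[OF Add.prems(1)]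
  have 1: "execs x (program t \<rho> m r) s (cost t x (\<lambda>v. s (\<rho> v)))
      (s(r := s r + eval t x (\<lambda>v. s (\<rho> v))))"
    using Add.prems by (intro Add.IH) auto
  have 2: "execs x (program u \<rho> m r) (s(r := y)) (cost u x (\<lambda>v. s (\<rho> v)))
      (s(r := y + eval u x (\<lambda>v. s (\<rho> v))))" for y
    by (rule execs_cong[OF Add.IH(2)[of \<rho> m r "s(r := y)"]])
       (use \<rho> Add.prems in auto)
  show ?case
    unfolding program.simps
    by (rule execs_cong[OF execs_Seq[OF 1 2]]) (auto simp: fun_eq_iff)
next
  case (Monus t u)
  define n where "n = eval t x (\<lambda>v. s (\<rho> v))"
  define k where "k = eval u x (\<lambda>v. s (\<rho> v))"
  have ne: "r \<noteq> m" "r \<noteq> Suc m" "s m = 0" "s (Suc m) = 0" "s 0 = 0" "r < m"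
    using Monus.prems by auto
  note \<rho> = env_registers[OF Monus.prems(1)]
  have 0: "execs x (program t \<rho> (m + 2) m) s (cost t x (\<lambda>v. s (\<rho> v))) (s(m := n))"
    by (rule execs_cong[OF Monus.IH(1)[of \<rho> "m + 2" m s]])
       (use ne \<rho> Monus.prems(5) in \<open>auto simp: n_def\<close>)
  have 1: "execs x (program u \<rho> (m + 2) (m + 1)) (s(m := n)) (cost u x (\<lambda>v. s (\<rho> v)))
      (s(m := n, m + 1 := k))"
    by (rule execs_cong[OF Monus.IH(2)[of \<rho> "m + 2" "m + 1" "s(m := n)"]])
       (use ne \<rho> Monus.prems(5) in \<open>auto simp: k_def\<close>)
  have 2: "execs x (While (Pos (m + 1)) (Seq (Dec (m + 1)) (If (Pos m) (Dec m) Skip)))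
      (s(m := n, m + 1 := k)) (k * (1 + (1 + 2) + 2) + 1) (s(m := n - k))"
  proof (rule execs_While[where S = "\<lambda>i. s(m := n - i, m + 1 := k - i)"])
    fix i assume i: "i < k"
    have "execs x (Seq (Dec (m + 1)) (If (Pos m) (Dec m) Skip)) (s(m := n - i, m + 1 := k - i))
        (1 + (1 + 2)) (s(m := n - Suc i, m + 1 := k - Suc i))"
    proof (rule execs_Seq)
      show "execs x (Dec (m + 1)) (s(m := n - i, m + 1 := k - i)) 1
          (s(m := n - i, m + 1 := k - Suc i))"
        using i by (intro execs_Dec) auto
      show "execs x (If (Pos m) (Dec m) Skip) (s(m := n - i, m + 1 := k - Suc i)) (1 + 2)
          (s(m := n - Suc i, m + 1 := k - Suc i))"
        by (rule execs_If, rule execs_Dec)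
           (auto simp: fun_eq_iff intro: execs_mono[OF execs_Skip])
    qed
    then show "test_holds x (Pos (m + 1)) (s(m := n - i, m + 1 := k - i)) \<and>
        execs x (Seq (Dec (m + 1)) (If (Pos m) (Dec m) Skip)) (s(m := n - i, m + 1 := k - i))
        (1 + (1 + 2)) (s(m := n - Suc i, m + 1 := k - Suc i))"
      using i by simp
  qed (use ne in \<open>auto simp: fun_eq_iff\<close>)
  have 3: "execs x (While (Pos m) (Seq (Dec m) (Inc r))) (s(m := n - k)) ((n - k) * (2 + 2) + 1)
      (s(r := s r + (n - k)))"
    by (rule execs_While[where S = "\<lambda>i. s(m := n - k - i, r := s r + i)"])
       (use ne in \<open>auto simp: fun_upd_idem fun_eq_iff intro!: execs_simple\<close>)
  show ?case
    unfolding program.simps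
    by (rule execs_cong[OF execs_Seq[OF 0 execs_Seq[OF 1 execs_Seq[OF 2 3]]]])
       (auto simp: fun_eq_iff n_def k_def)
next
  case (Sum t u)
  let ?e = "\<lambda>v. s (\<rho> v)"
  define n where "n = eval t x ?e"
  \<comment> \<open>The total over all rounds bounds each single round, which provides the uniform
    body cost that \<open>execs_While\<close> asks for.\<close>
  define c where "c = (\<Sum>i < n. cost u x (case_nat i ?e))"
  define y where "y = (\<lambda>i. s r + (\<Sum>j < i. eval u x (case_nat j ?e)))"
  have ne: "r \<noteq> m" "r \<noteq> Suc m" "s m = 0" "s (Suc m) = 0" "s (m + 1) = 0" "s 0 = 0" "r < m" "0 < r"
    using Sum.prems by auto
  note \<rho> = env_registers[OF Sum.prems(1)]
  have 0: "execs x (program t \<rho> (m + 2) m) s (cost t x ?e) (s(m := n))"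
    by (rule execs_cong[OF Sum.IH(1)[of \<rho> "m + 2" m s]])
       (use ne \<rho> Sum.prems(5) in \<open>auto simp: n_def\<close>)
  have 1: "execs x (While (Pos m)
      (Seq (Dec m) (Seq (program u (case_nat (m + 1) \<rho>) (m + 2) r) (Inc (m + 1)))))
      (s(m := n)) (n * (1 + (c + 1) + 2) + 1) (s(m + 1 := n, r := y n))"
  proof (rule execs_While[where S = "\<lambda>i. s(m := n - i, m + 1 := i, r := y i)"])
    fix i assume i: "i < n"
    let ?s = "s(m := n - Suc i, m + 1 := i, r := y i)"
    \<comment> \<open>Register \<open>m + 1\<close> counts the completed rounds and so holds the
      index of summation, the new variable 0.\<close>
    have env: "?s (case_nat (m + 1) \<rho> v) = case_nat i ?e v" for v
      using \<rho> ne by (auto split: nat.split)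
    have "execs x (program u (case_nat (m + 1) \<rho>) (m + 2) r) ?s
        (cost u x (\<lambda>v. ?s (case_nat (m + 1) \<rho> v)))
        (?s(r := ?s r + eval u x (\<lambda>v. ?s (case_nat (m + 1) \<rho> v))))"
      by (rule Sum.IH(2)) (use \<rho> ne Sum.prems(5) in \<open>auto split: nat.split\<close>)
    then have "execs x (program u (case_nat (m + 1) \<rho>) (m + 2) r) ?s (cost u x (case_nat i ?e))
        (?s(r := ?s r + eval u x (case_nat i ?e)))"
      unfolding env .
    moreover have "cost u x (case_nat i ?e) \<le> c"
      unfolding c_def by (rule member_le_sum[of i _ "\<lambda>i. cost u x (case_nat i ?e)"]) (use i in auto)
    moreover have "?s(r := ?s r + eval u x (case_nat i ?e)) = s(m := n - Suc i, m
        + 1 := i, r := y (Suc i))"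
      by (auto simp: y_def)
    ultimately have u: "execs x (program u (case_nat (m + 1) \<rho>) (m + 2) r) ?s c
        (s(m := n - Suc i, m + 1 := i, r := y (Suc i)))"
      by (rule execs_cong)
    have "execs x (Seq (Dec m) (Seq (program u (case_nat (m + 1) \<rho>) (m + 2) r) (Inc (m + 1))))
        (s(m := n - i, m + 1 := i, r := y i)) (1 + (c + 1))
        (s(m := n - Suc i, m + 1 := Suc i, r := y (Suc i)))"
      by (rule execs_Seq[OF _ execs_Seq[OF u]])
         (use i ne in \<open>auto simp: fun_eq_iff simp del: One_nat_def intro!: execs_Dec execs_Inc\<close>)
    then show "test_holds x (Pos m) (s(m := n - i, m + 1 := i, r := y i)) \<and>
        execs x (Seq (Dec m) (Seq (program u (case_nat (m + 1) \<rho>) (m + 2) r) (Inc (m + 1))))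
        (s(m := n - i, m + 1 := i, r := y i)) (1 + (c + 1))
        (s(m := n - Suc i, m + 1 := Suc i, r := y (Suc i)))"
      using i ne by simp
  qed (use ne in \<open>auto simp: fun_eq_iff y_def\<close>)
  have 2: "execs x (While (Pos (m + 1)) (Dec (m + 1))) (s(m + 1 := n, r := y n)) (n * (1 + 2) + 1)
      (s(r := y n))"
    by (rule execs_While[where S = "\<lambda>i. s(m + 1 := n - i, r := y n)"])
       (use ne in \<open>auto simp: fun_eq_iff simp del: One_nat_def intro!: execs_Dec\<close>)
  show ?case
    unfolding program.simps
    by (rule execs_cong[OF execs_Seq[OF 0 execs_Seq[OF 1 2]]])
       (auto simp: fun_eq_iff y_def add_mult_distrib2 simp flip: n_def c_def)
qed

lemma set_pair_input: "0 \<notin> set (pair_input w u)"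
  by (auto simp: pair_input_def Let_def)

lemma poly_time_decidable_eval:
  "poly_time_decidable {(w, u). 0 < eval t (pair_input w u) (\<lambda>_. 0)}"
proof -
  \<comment> \<open>All variables share register 1, which stays zero; the result goes to register 2,
    and scratch space starts at 3.\<close>
  define c where "c = program t (\<lambda>_. 1) 3 2"
  obtain k0 where "com_ok k0 c"
    using program_ok[of "\<lambda>_. 1" 3 2 t] by (auto simp: c_def)
  define k where "k = k0 + 3"
  have k: "com_ok k c" "2 < k"
    using com_ok_mono[OF \<open>com_ok k0 c\<close>] by (auto simp: k_def)
  define P where "P = compile c 0 @ [JumpUnless (Pos 2) (code_length c + 2)]"
  obtain d where d: "\<And>N x e. length x \<le> N \<Longrightarrow> (\<forall>v. e v \<le> N) \<Longrightarrow> cost t x e \<le> (N + 2) ^ d"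
    using poly_bounded_cost[of t] unfolding poly_bounded_def by blast
  \<comment> \<open>The constant summand pays for marking the origins and for testing the
    result.\<close>
  define p :: "nat poly" where "p = [:2, 1:] ^ d + [:2:]"
  have p: "poly p N = (N + 2) ^ d + 2" for N
    by (simp add: p_def poly_power)
  have "\<exists>n \<le> poly p (length (pair_input w u)).
      fst ((tm_step (machine k P) ^^ n) (tm_init (machine k P) (pair_input w u))) =
      (if (w, u) \<in> {(w, u). 0 < eval t (pair_input w u) (\<lambda>_. 0)}
       then tm_accept (machine k P) else tm_reject (machine k P))" for w u
  proof -
    let ?x = "pair_input w u"
    have "execs ?x c (\<lambda>_. 0) (cost t ?x (\<lambda>_. 0)) ((\<lambda>_. 0)(2 := 0 + eval t ?x (\<lambda>_. 0)))"
      unfolding c_def by (rule program_correct[of ?x "\<lambda>_. 1" 3 2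
          "\<lambda>_. 0"]) (simp_all add: set_pair_input)
    then obtain n where n: "n \<le> cost t ?x (\<lambda>_. 0)"
      "exec ?x c (\<lambda>_. 0) n ((\<lambda>_. 0)(2 := 0 + eval t ?x (\<lambda>_. 0)))"
      by (auto simp: execs_def)
    have "n + 2 \<le> poly p (length ?x)"
      using n(1) d[of ?x "length ?x" "\<lambda>_. 0"] by (simp add: p)
    moreover have "fst ((tm_step (machine k P) ^^ (n + 2)) (tm_init (machine k P) ?x)) =
      (if 0 < ((\<lambda>_. 0)(2 := 0 + eval t ?x (\<lambda>_. 0))) (2 :: nat)
       then tm_accept (machine k P) else tm_reject (machine k P))"
      unfolding P_def by (rule exec_decides[OF n(2) k(1) _ k(2)]) simp
    ultimately show ?thesis
      by (intro exI[of _ "n + 2"]) simp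
  qed
  moreover have "wf_tm (machine k P)"
    using k(2) by (intro wf_machine) simp
  ultimately show ?thesis
    unfolding poly_time_decidable_def by blast
qed

subsection \<open>Functions defined by terms\<close>

fun rename_trm :: "(nat \<Rightarrow> nat) \<Rightarrow> trm \<Rightarrow> trm" where
  "rename_trm f (Var v) = Var (f v)"
| "rename_trm f One = One"
| "rename_trm f Len = Len"
| "rename_trm f (Inp a t) = Inp a (rename_trm f t)"
| "rename_trm f (Add t u) = Add (rename_trm f t) (rename_trm f u)"
| "rename_trm f (Monus t u) = Monus (rename_trm f t) (rename_trm f u)"
| "rename_trm f (Sum t u) = Sum (rename_trm f t) (rename_trm (case_nat 0 (\<lambda>v. Suc (f v))) u)"

lemma eval_rename_trm: "eval (rename_trm f t) x e = eval t x (\<lambda>v. e (f v))"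
proof (induction t arbitrary: f e)
  case (Sum t u)
  have "(\<lambda>v. case_nat i e (case_nat 0 (\<lambda>v. Suc (f v)) v)) = case_nat i (\<lambda>v. e (f v))" for i
    by (auto simp: fun_eq_iff split: nat.split)
  then show ?case by (simp add: Sum)
qed simp_all

text \<open>The functions of a pair of words that some term computes. With the closure rules below,
  definability is shown by following the structure of a HOL definition, without writing down the
  term.\<close>

definition term_fun :: "(bool list \<Rightarrow> bool list \<Rightarrow> (nat \<Rightarrow> nat) \<Rightarrow> nat) \<Rightarrow> bool" where
  "term_fun F \<longleftrightarrow> (\<exists>t. \<forall>w u e. eval t (pair_input w u) e = F w u e)"

definition term_pred :: "(bool list \<Rightarrow> bool list \<Rightarrow> (nat \<Rightarrow> nat) \<Rightarrow> bool) \<Rightarrow> bool" where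
  "term_pred P \<longleftrightarrow> term_fun (\<lambda>w u e. of_bool (P w u e))"

lemma term_pred_decidable:
  assumes "term_pred P"
  shows "poly_time_decidable {(w, u). P w u (\<lambda>_. 0)}"
proof -
  obtain t where t: "\<And>w u e. eval t (pair_input w u) e = of_bool (P w u e)"
    using assms unfolding term_pred_def term_fun_def by blast
  show ?thesis using poly_time_decidable_eval[of t] by (simp add: t)
qed

text \<open>Renaming by \<open>Suc\<close> carries a term under the binder of a sum.\<close>

lemma term_fun_rename: "term_fun F \<Longrightarrow> term_fun (\<lambda>w u e. F w u (\<lambda>v. e (f v)))"
  unfolding term_fun_def by (metis eval_rename_trm)

lemma term_fun_var: "term_fun (\<lambda>w u e. e v)"
  unfolding term_fun_def by (intro exI[of _ "Var v"]) simp

lemma term_fun_add: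
  assumes "term_fun F" "term_fun G"
  shows "term_fun (\<lambda>w u e. F w u e + G w u e)"
proof -
  obtain t t' where "\<And>w u e. eval t (pair_input w u) e = F w u e"
      "\<And>w u e. eval t' (pair_input w u) e = G w u e"
    using assms unfolding term_fun_def by blast
  then show ?thesis unfolding term_fun_def by (intro exI[of _ "Add t t'"]) simp
qed

lemma term_fun_diff:
  assumes "term_fun F" "term_fun G"
  shows "term_fun (\<lambda>w u e. F w u e - G w u e)"
proof -
  obtain t t' where "\<And>w u e. eval t (pair_input w u) e = F w u e"
      "\<And>w u e. eval t' (pair_input w u) e = G w u e"
    using assms unfolding term_fun_def by blast
  then show ?thesis unfolding term_fun_def by (intro exI[of _ "Monus t t'"]) simp
qed

lemma term_fun_sum:
  assumes "term_fun B" "term_fun (\<lambda>w u e. F w u (\<lambda>v. e (Suc v)) (e 0))"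
  shows "term_fun (\<lambda>w u e. \<Sum>i < B w u e. F w u e i)"
proof -
  obtain t t' where "\<And>w u e. eval t (pair_input w u) e = B w u e"
    "\<And>w u e. eval t' (pair_input w u) e = F w u (\<lambda>v. e (Suc v)) (e 0)"
    using assms unfolding term_fun_def by blast
  then show ?thesis unfolding term_fun_def by (intro exI[of _ "Sum t t'"]) simp
qed

lemma term_fun_const: "term_fun (\<lambda>w u e. c)"
proof (induction c)
  case 0
  have "term_fun (\<lambda>w u e. e 0 - e 0)" by (intro term_fun_diff term_fun_var)
  then show ?case by simp
next
  case (Suc c)
  have "term_fun (\<lambda>w u e. 1)" unfolding term_fun_def by (intro exI[of _ One]) simp
  from term_fun_add[OF this Suc] show ?case by simp
qed

lemma term_fun_Suc: "term_fun F \<Longrightarrow> term_fun (\<lambda>w u e. Suc (F w u e))"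
  using term_fun_add[OF term_fun_const[of 1]] by simp

lemma term_fun_mult:
  assumes "term_fun F" "term_fun G"
  shows "term_fun (\<lambda>w u e. F w u e * G w u e)"
proof -
  have "term_fun (\<lambda>w u e. \<Sum>i < F w u e. G w u e)"
    by (intro term_fun_sum assms(1) term_fun_rename[OF assms(2)])
  then show ?thesis by simp
qed

lemma term_fun_of_bool: "term_pred P \<Longrightarrow> term_fun (\<lambda>w u e. of_bool (P w u e))"
  by (simp add: term_pred_def)

lemma term_pred_less:
  assumes "term_fun F" "term_fun G"
  shows "term_pred (\<lambda>w u e. F w u e < G w u e)"
proof -
  \<comment> \<open>Truncated subtraction from 1, done twice, turns any positive difference into
    1.\<close>
  have "of_bool (a < b) = 1 - (1 - (b - a))" for a b :: nat by auto
  then show ?thesis unfolding term_pred_def using assms by (simp only:) (intro term_fun_diff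
      term_fun_const)
qed

lemma term_pred_not:
  assumes "term_pred P"
  shows "term_pred (\<lambda>w u e. \<not> P w u e)"
proof -
  have "of_bool (\<not> b) = 1 - (of_bool b :: nat)" for b by simp
  then show ?thesis unfolding term_pred_def
    by (simp only:) (intro term_fun_diff term_fun_const term_fun_of_bool assms)
qed

lemma term_pred_conj:
  assumes "term_pred P" "term_pred Q"
  shows "term_pred (\<lambda>w u e. P w u e \<and> Q w u e)"
proof -
  have "of_bool (a \<and> b) = (of_bool a * of_bool b :: nat)" for a b by simp
  then show ?thesis unfolding term_pred_def
    by (simp only:) (intro term_fun_mult term_fun_of_bool assms)
qed

lemma term_pred_disj:
  assumes "term_pred P" "term_pred Q"
  shows "term_pred (\<lambda>w u e. P w u e \<or> Q w u e)"
proof -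
  have "term_pred (\<lambda>w u e. \<not> (\<not> P w u e \<and> \<not> Q w u e))"
    by (intro term_pred_not term_pred_conj assms)
  then show ?thesis by simp
qed

lemma term_pred_imp:
  assumes "term_pred P" "term_pred Q"
  shows "term_pred (\<lambda>w u e. P w u e \<longrightarrow> Q w u e)"
  unfolding imp_conv_disj by (intro term_pred_disj term_pred_not assms)

lemma term_pred_le:
  assumes "term_fun F" "term_fun G"
  shows "term_pred (\<lambda>w u e. F w u e \<le> G w u e)"
  unfolding not_less[symmetric] by (intro term_pred_not term_pred_less assms)

lemma term_pred_eq:
  assumes "term_fun F" "term_fun G"
  shows "term_pred (\<lambda>w u e. F w u e = G w u e)"
  unfolding order.eq_iff by (intro term_pred_conj term_pred_le assms)

lemma term_pred_all:
  assumes "term_fun B" "term_pred (\<lambda>w u e. P w u (\<lambda>v. e (Suc v)) (e 0))"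
  shows "term_pred (\<lambda>w u e. \<forall>i < B w u e. P w u e i)"
proof -
  \<comment> \<open>Bounded quantification becomes arithmetic by counting the
    counterexamples.\<close>
  have eq: "(\<forall>i < b. Q i) \<longleftrightarrow> (\<Sum>i < b. of_bool (\<not> Q i)) = (0 :: nat)" for b :: nat and Q
    by (subst sum_eq_0_iff) auto
  show ?thesis
    unfolding eq
    by (intro term_pred_eq term_fun_sum term_fun_const term_fun_of_bool term_pred_not assms)
qed

lemma term_pred_ex:
  assumes "term_fun B" "term_pred (\<lambda>w u e. P w u (\<lambda>v. e (Suc v)) (e 0))"
  shows "term_pred (\<lambda>w u e. \<exists>i < B w u e. P w u e i)"
proof -
  have "term_pred (\<lambda>w u e. \<not> (\<forall>i < B w u e. \<not> P w u e i))"
    by (intro term_pred_not term_pred_all assms)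
  then show ?thesis by simp
qed

section \<open>Access to the two words of the input\<close>

lemma length_pair_input: "length (pair_input w u) = length w + length u + 1"
  by (simp add: pair_input_def Let_def)

lemma symbol_at_pair_input:
  "symbol_at (pair_input w u) i =
     (if i < length w then (if w ! i then 2 else 1) else if i = length w then 3
      else if i < length w + length u + 1 then (if u ! (i - length w - 1) then 2 else 1) else 0)"
  by (auto simp: symbol_at_def length_pair_input) (auto simp: pair_input_def Let_def nth_append
      nth_Cons')

lemma term_fun_symbol:
  assumes "term_fun F"
  shows "term_pred (\<lambda>w u e. symbol_at (pair_input w u) (F w u e) = a)"
proof -
  obtain t where "\<And>w u e. eval t (pair_input w u) e = F w u e"
    using assms unfolding term_fun_def by blast
  then show ?thesis unfolding term_pred_def term_fun_def by (intro exI[of _ "Inp a t"]) simp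
qed

lemma term_fun_input_length: "term_fun (\<lambda>w u e. length w + length u + 1)"
  unfolding term_fun_def by (intro exI[of _ Len]) (simp add: length_pair_input)

text \<open>The separator 3 occurs just once, at position \<open>length w\<close>, so adding up the
  positions that carry 3 gives that length.\<close>

lemma term_fun_length_left: "term_fun (\<lambda>w u e. length w)"
proof -
  have "term_fun (\<lambda>w u e. \<Sum>i < length w + length u + 1. i * of_bool (symbol_at (pair_input w u) i
      = 3))"
    by (intro term_fun_sum term_fun_input_length term_fun_mult term_fun_var term_fun_of_bool
        term_fun_symbol)
  moreover have "(\<Sum>i < length w + length u + 1. i * of_bool (symbol_at (pair_input w u) i = 3))
      = length w"
    for w u
  proof -
    have "(\<Sum>i < length w + length u + 1. i * of_bool (symbol_at (pair_input w u) i = 3)) =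
        (\<Sum>i < length w + length u + 1. if i = length w then i else 0)"
      by (intro sum.cong) (auto simp: symbol_at_pair_input)
    then show ?thesis by simp
  qed
  ultimately show ?thesis by (simp only:)
qed

lemma term_fun_length_right: "term_fun (\<lambda>w u e. length u)"
proof -
  have "term_fun (\<lambda>w u e. (length w + length u + 1) - length w - 1)"
    by (intro term_fun_diff term_fun_input_length term_fun_length_left term_fun_const)
  then show ?thesis by simp
qed

definition bit_at :: "bool list \<Rightarrow> nat \<Rightarrow> bool" where
  "bit_at w i \<longleftrightarrow> i < length w \<and> w ! i"

lemma term_pred_bit_left:
  assumes "term_fun F"
  shows "term_pred (\<lambda>w u e. bit_at w (F w u e))"
proof -
  have "term_pred (\<lambda>w u e. F w u e < length w \<and> symbol_at (pair_input w u) (F w u e) = 2)"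
    by (intro term_pred_conj term_pred_less term_fun_length_left term_fun_symbol assms)
  moreover have "i < length w \<and> symbol_at (pair_input w u) i = 2 \<longleftrightarrow> bit_at w i" for w u i
    by (auto simp: symbol_at_pair_input bit_at_def)
  ultimately show ?thesis by (simp only:)
qed

lemma term_pred_bit_right:
  assumes "term_fun F"
  shows "term_pred (\<lambda>w u e. bit_at u (F w u e))"
proof -
  have "term_pred (\<lambda>w u e. symbol_at (pair_input w u) (length w + 1 + F w u e) = 2)"
    by (intro term_fun_symbol term_fun_add term_fun_length_left term_fun_const assms)
  moreover have "symbol_at (pair_input w u) (length w + 1 + i) = 2 \<longleftrightarrow> bit_at u i" for w u i
    by (auto simp: symbol_at_pair_input bit_at_def)
  ultimately show ?thesis by (simp only:)
qed

lemmas term_intros =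
  term_fun_var term_fun_const term_fun_Suc term_fun_add term_fun_diff term_fun_mult term_fun_sum
  term_fun_of_bool term_fun_length_left term_fun_length_right
  term_pred_less term_pred_le term_pred_eq term_pred_not term_pred_conj term_pred_disj term_pred_imp
  term_pred_all term_pred_ex term_pred_bit_left term_pred_bit_right

subsection \<open>Decoding unary partitions\<close>

definition zeros_before :: "bool list \<Rightarrow> nat \<Rightarrow> nat" where
  "zeros_before w p = (\<Sum>q<p. of_bool (\<not> bit_at w q))"

text \<open>The length of run \<open>i\<close> of ones, where a one belongs to the run numbered by
  the zeros before it. Consecutive zeros enclose an empty run.\<close>

definition gap :: "bool list \<Rightarrow> nat \<Rightarrow> nat" where
  "gap w i = (\<Sum>p<length w. of_bool (bit_at w p \<and> zeros_before w p = i))"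

text \<open>The number of consecutive nonempty runs from run \<open>s\<close> on: summand
  \<open>i\<close> is 1 as long as all the runs from \<open>s\<close> to \<open>s + i\<close> are
  nonempty.\<close>

definition part_count :: "bool list \<Rightarrow> nat \<Rightarrow> nat" where
  "part_count w s = (\<Sum>i<length w. of_bool (\<forall>j<Suc i. 0 < gap w (s + j)))"

definition unary_code :: "nat list \<Rightarrow> bool list" where
  "unary_code ks = concat (map (\<lambda>k. replicate k True @ [False]) ks)"

lemma sum_lessThan_add: "(\<Sum>p<m + n. f p) = (\<Sum>p<m. f p) + (\<Sum>q<n. f (m + q))" for m n :: nat
  by (induction n) (simp_all add: add.assoc)

lemma gap_unary_code: "gap (unary_code ks) i = (if i < length ks then ks ! i else 0)"
proof (induction ks arbitrary: i)
  case Nil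
  then show ?case by (simp add: gap_def unary_code_def)
next
  case (Cons k ks)
  let ?v = "unary_code ks" and ?w = "unary_code (k # ks)"
  have w: "?w = replicate k True @ False # ?v" by (simp add: unary_code_def)
  have len: "length ?w = k + (1 + length ?v)" by (simp add: w)
  have bit: "p < k \<Longrightarrow> bit_at ?w p" "\<not> bit_at ?w k" "bit_at ?w (k + (1 + q)) \<longleftrightarrow> bit_at ?v q" for p q
    by (auto simp: bit_at_def w nth_append)
  have z0: "zeros_before ?w p = 0" if "p \<le> k" for p
    unfolding zeros_before_def using bit(1) that by (intro sum.neutral) auto
  have zS: "zeros_before ?w (k + (1 + q)) = Suc (zeros_before ?v q)" for q
  proof -
    have "zeros_before ?w (k + (1 + q)) = zeros_before ?w k + (of_bool (\<not> bit_at ?w k) +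
        (\<Sum>j<q. of_bool (\<not> bit_at ?w (k + (1 + j)))))"
      unfolding zeros_before_def sum_lessThan_add by simp
    then show ?thesis by (simp only: z0 bit order_refl) (simp add: zeros_before_def)
  qed
  have "gap ?w i = (\<Sum>p<k. of_bool (0 = i)) + (\<Sum>q<length ?v. of_bool (bit_at ?v q
      \<and> Suc (zeros_before ?v q) = i))"
  proof -
    have "gap ?w i = (\<Sum>p<k. of_bool (bit_at ?w p \<and> zeros_before ?w p = i)) +
        (of_bool (bit_at ?w k \<and> zeros_before ?w k = i) +
         (\<Sum>q<length ?v. of_bool (bit_at ?w (k + (1 + q)) \<and> zeros_before ?w (k + (1 + q)) = i)))"
      unfolding gap_def len sum_lessThan_add by simp
    moreover have "(\<Sum>p<k. of_bool (bit_at ?w p \<and> zeros_before ?w p = i)) = (\<Sum>p<k. of_bool (0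
        = i) :: nat)"
      using bit(1) z0 by (intro sum.cong) auto
    ultimately show ?thesis unfolding bit(3) zS using bit(2) by simp
  qed
  also have "\<dots> = (if i < length (k # ks) then (k # ks) ! i else 0)"
  proof (cases i)
    case (Suc i')
    have "(\<Sum>q<length ?v. of_bool (bit_at ?v q \<and> Suc (zeros_before ?v q) = i)) = gap ?v i'"
      by (simp add: gap_def Suc)
    then show ?thesis using Cons[of i'] Suc by simp
  qed simp
  finally show ?case .
qed

lemma length_unary_code: "length (unary_code ks) = sum_list ks + length ks"
  by (induction ks) (simp_all add: unary_code_def)

lemma part_count_unary_code:
  assumes "ks = as @ bs @ 0 # cs" "0 \<notin> set bs"
  shows "part_count (unary_code ks) (length as) = length bs"
proof -
  have "(\<forall>j<Suc i. 0 < gap (unary_code ks) (length as + j)) \<longleftrightarrow> i < length bs" for i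
  proof
    assume *: "\<forall>j<Suc i. 0 < gap (unary_code ks) (length as + j)"
    show "i < length bs"
    proof (rule ccontr)
      assume "\<not> i < length bs"
      then have "0 < gap (unary_code ks) (length as + length bs)" using * by simp
      then show False by (simp add: gap_unary_code assms(1) nth_append)
    qed
  next
    assume i: "i < length bs"
    show "\<forall>j<Suc i. 0 < gap (unary_code ks) (length as + j)"
    proof (intro allI impI)
      fix j assume "j < Suc i"
      then have j: "j < length bs" using i by simp
      then have "gap (unary_code ks) (length as + j) = bs ! j"
        by (simp add: gap_unary_code assms(1) nth_append)
      moreover have "bs ! j \<noteq> 0" using assms(2) nth_mem[OF j] by metis
      ultimately show "0 < gap (unary_code ks) (length as + j)" by simp
    qed
  qed
  then have "part_count (unary_code ks) (length as) = (\<Sum>i<length (unary_code ks). of_bool (i <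
      length bs))"
    by (simp only: part_count_def)
  also have "\<dots> = card ({..<length (unary_code ks)} \<inter> {..<length bs})"
    by (simp add: of_bool_def sum.If_cases lessThan_def)
  \<comment> \<open>The code is longer than \<open>bs\<close>, so the bound of the sum cuts nothing
    off.\<close>
  also have "{..<length (unary_code ks)} \<inter> {..<length bs} = {..<length bs}"
    by (auto simp: length_unary_code assms(1))
  finally show ?thesis by simp
qed

text \<open>Offsets count runs. The zero that ends a partition gives one empty run, which accounts
  for the increments by 1.\<close>

definition count1 :: "bool list \<Rightarrow> nat" where "count1 w = part_count w 0"
definition offset2 :: "bool list \<Rightarrow> nat" where "offset2 w = count1 w + 1"
definition count2 :: "bool list \<Rightarrow> nat" where "count2 w = part_count w (offset2 w)"
definition offset3 :: "bool list \<Rightarrow> nat" where "offset3 w = offset2 w + count2 w + 1"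
definition count3 :: "bool list \<Rightarrow> nat" where "count3 w = part_count w (offset3 w)"
definition part2 :: "bool list \<Rightarrow> nat \<Rightarrow> nat" where "part2 w i = gap w (offset2 w + i)"
definition part3 :: "bool list \<Rightarrow> nat \<Rightarrow> nat" where "part3 w i = gap w (offset3 w + i)"

lemma unary_triple_code: "unary_triple (la, mu, nu) = unary_code (la @ 0 # mu @ 0 # nu @ [0])"
  by (simp add: unary_triple_def unary_partition_def unary_code_def)

lemma decode_triple:
  assumes "is_partition la" "is_partition mu" "is_partition nu"
  defines "w \<equiv> unary_triple (la, mu, nu)"
  shows "count1 w = length la" "count2 w = length mu" "count3 w = length nu"
    "i < length la \<Longrightarrow> gap w i = la ! i" "i < length mu \<Longrightarrow> part2 w i = mu ! i"
    "i < length nu \<Longrightarrow> part3 w i = nu ! i"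
proof -
  let ?ks = "la @ 0 # mu @ 0 # nu @ [0]"
  have pos: "0 \<notin> set la" "0 \<notin> set mu" "0 \<notin> set nu" using assms by (auto simp: is_partition_def)
  show 1: "count1 w = length la"
    unfolding count1_def w_def unary_triple_code
    using part_count_unary_code[of ?ks "[]" la "mu @ 0 # nu @ [0]"] pos by simp
  have o2: "offset2 w = length (la @ [0])" by (simp add: offset2_def 1)
  show 2: "count2 w = length mu"
    unfolding count2_def o2 unfolding w_def unary_triple_code
    using part_count_unary_code[of ?ks "la @ [0]" mu "nu @ [0]"] pos by simp
  have o3: "offset3 w = length (la @ 0 # mu @ [0])" by (simp add: offset3_def o2 2)
  show "count3 w = length nu"
    unfolding count3_def o3 unfolding w_def unary_triple_code
    using part_count_unary_code[of ?ks "la @ 0 # mu @ [0]" nu "[]"] pos by simp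
  show "i < length la \<Longrightarrow> gap w i = la ! i"
    unfolding w_def unary_triple_code gap_unary_code by (simp add: nth_append)
  show "i < length mu \<Longrightarrow> part2 w i = mu ! i"
    unfolding part2_def o2 unfolding w_def unary_triple_code gap_unary_code
        by (simp add: nth_append)
  show "i < length nu \<Longrightarrow> part3 w i = nu ! i"
    unfolding part3_def o3 unfolding w_def unary_triple_code gap_unary_code
        by (simp add: nth_append)
qed

text \<open>In unary the input length exceeds the number of parts of each partition and all parts of
  \<open>mu\<close> and \<open>nu\<close>. It can therefore serve as the base in which the indices
  of a witness are written.\<close>

lemma triple_bounds:
  fixes la mu nu :: "nat list"
  defines "w \<equiv> unary_triple (la, mu, nu)"
  shows "length la < length w" "length mu < length w" "length nu < length w"
    "i < length mu \<Longrightarrow> mu ! i < length w" "i < length nu \<Longrightarrow> nu ! i < length w"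
proof -
  have len: "length w = sum_list la + sum_list mu + sum_list nu + length la + length mu
      + length nu + 3"
    by (simp add: w_def unary_triple_code length_unary_code)
  show "length la < length w" "length mu < length w" "length nu < length w" by (simp_all add: len)
  show "mu ! i < length w" if "i < length mu"
    using member_le_sum_list[OF nth_mem[OF that]] len by simp
  show "nu ! i < length w" if "i < length nu"
    using member_le_sum_list[OF nth_mem[OF that]] len by simp
qed

subsection \<open>Witnesses\<close>

text \<open>
  A witness starts with one bit for all \<open>r, c, p, q, a\<close> below the length of \<open>w\<close>, telling whether the
  entry in cell \<open>(p, q)\<close> of the filling in cell \<open>(r, c)\<close> exceeds \<open>a\<close>; it continues with one bit for
  every pair \<open>(i, j)\<close>.
\<close>

definition cell_bit :: "bool list \<Rightarrow> bool list \<Rightarrow> nat \<Rightarrow> nat \<Rightarrow> nat \<Rightarrow> nat \<Rightarrow> nat \<Rightarrow> bool" where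
  "cell_bit w u r c p q a \<longleftrightarrow>
     bit_at u ((((r * length w + c) * length w + p) * length w + q) * length w + a)"

definition entry :: "bool list \<Rightarrow> bool list \<Rightarrow> nat \<Rightarrow> nat \<Rightarrow> nat \<Rightarrow> nat \<Rightarrow> nat" where
  "entry w u r c p q = (\<Sum>a<length w. of_bool (cell_bit w u r c p q a))"

definition cell_size :: "bool list \<Rightarrow> nat" where
  "cell_size w = length w * length w * length w * length w * length w"

definition pair_bit :: "bool list \<Rightarrow> bool list \<Rightarrow> nat \<Rightarrow> nat \<Rightarrow> bool" where
  "pair_bit w u i j \<longleftrightarrow> bit_at u (cell_size w + (i * length w + j))"

text \<open>Leaves one word for each object: the length is fixed, all bits outside the diagrams and
  the pairs are off, and the bits of an entry are downward closed, as in a unary numeral.\<close>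

definition wellformed :: "bool list \<Rightarrow> bool list \<Rightarrow> bool" where
  "wellformed w u \<longleftrightarrow> length u = cell_size w + length w * length w \<and>
     (\<forall>r<length w. \<forall>c<length w. \<forall>p<length w. \<forall>q<length w. \<forall>a<length w. cell_bit w u r c p q a \<longrightarrow>
        r < count2 w \<and> c < part2 w r \<and> p < count3 w \<and> q < part3 w p \<and>
            (\<forall>b<a. cell_bit w u r c p q b)) \<and>
     (\<forall>i<length w. \<forall>j<length w. pair_bit w u i j \<longrightarrow> i < j \<and> j < count1 w)"

definition witness :: "kind \<Rightarrow> kind \<Rightarrow> nat \<Rightarrow> bool list \<Rightarrow> bool list \<Rightarrow> bool" where
  "witness kf kg par w u \<longleftrightarrow> wellformed w u \<and>
     certificate kf kg par (count1 w) (gap w) (count2 w) (part2 w) (count3 w) (part3 w) (entry w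
         u) (pair_bit w u)"

section \<open>The witness condition as a term\<close>

lemma term_fun_gap:
  assumes "term_fun I"
  shows "term_fun (\<lambda>w u e. gap w (I w u e))"
  unfolding gap_def zeros_before_def by (intro term_intros term_fun_rename[OF assms])

lemma term_fun_part_count:
  assumes "term_fun I"
  shows "term_fun (\<lambda>w u e. part_count w (I w u e))"
  unfolding part_count_def by (intro term_intros term_fun_gap term_fun_rename[OF assms])

lemma term_fun_counts: "term_fun (\<lambda>w u e. count1 w)" "term_fun (\<lambda>w u e. offset2 w)"
  "term_fun (\<lambda>w u e. count2 w)" "term_fun (\<lambda>w u e. offset3 w)" "term_fun (\<lambda>w u e. count3 w)"
  unfolding count3_def offset3_def count2_def offset2_def count1_def
  by (intro term_intros term_fun_part_count)+

lemma term_fun_parts: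
  assumes "term_fun I"
  shows "term_fun (\<lambda>w u e. part2 w (I w u e))" "term_fun (\<lambda>w u e. part3 w (I w u e))"
  unfolding part2_def part3_def by (intro term_intros term_fun_gap term_fun_counts assms)+

lemma term_pred_cell_bit:
  assumes "term_fun R" "term_fun C" "term_fun P" "term_fun Q" "term_fun I"
  shows "term_pred (\<lambda>w u e. cell_bit w u (R w u e) (C w u e) (P w u e) (Q w u e) (I w u e))"
  unfolding cell_bit_def by (intro term_intros assms)

lemma term_fun_entry:
  assumes "term_fun R" "term_fun C" "term_fun P" "term_fun Q"
  shows "term_fun (\<lambda>w u e. entry w u (R w u e) (C w u e) (P w u e) (Q w u e))"
  unfolding entry_def by (intro term_intros term_pred_cell_bit term_fun_rename[OF assms(1)]
      term_fun_rename[OF assms(2)] term_fun_rename[OF assms(3)] term_fun_rename[OF assms(4)])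

lemma term_fun_cell_size: "term_fun (\<lambda>w u e. cell_size w)"
  unfolding cell_size_def by (intro term_intros)

lemma term_pred_pair_bit:
  assumes "term_fun I" "term_fun J"
  shows "term_pred (\<lambda>w u e. pair_bit w u (I w u e) (J w u e))"
  unfolding pair_bit_def by (intro term_intros term_fun_cell_size assms)

lemmas witness_intros = term_fun_gap term_fun_counts term_fun_parts term_pred_cell_bit
    term_fun_entry
  term_fun_cell_size term_pred_pair_bit

lemma term_pred_wellformed: "term_pred (\<lambda>w u e. wellformed w u)"
  unfolding wellformed_def by (intro term_intros witness_intros)

lemma term_pred_filling_less:
  assumes "term_fun R" "term_fun C" "term_fun R'" "term_fun C'"
  shows "term_pred (\<lambda>w u e. filling_less (count3 w) (part3 w)
    (entry w u (R w u e) (C w u e)) (entry w u (R' w u e) (C' w u e)))"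
  unfolding filling_less_def
  by (intro term_intros witness_intros term_fun_rename[OF assms(1)] term_fun_rename[OF assms(2)]
      term_fun_rename[OF assms(3)] term_fun_rename[OF assms(4)])

lemma term_pred_good_inner:
  assumes "term_fun R" "term_fun C"
  shows "term_pred (\<lambda>w u e. good k (count3 w) (part3 w)
    (\<lambda>p q p' q'. entry w u (R w u e) (C w u e) p q < entry w u (R w u e) (C w u e) p' q'))"
  by (cases k; simp only: good.simps)
     (intro term_intros witness_intros term_fun_rename[OF assms(1)] term_fun_rename[OF assms(2)])+

lemma term_pred_good_outer:
  "term_pred (\<lambda>w u e. good k (count2 w) (part2 w)
    (\<lambda>r c r' c'. filling_less (count3 w) (part3 w) (entry w u r c) (entry w u r' c')))"
  by (cases k; simp only: good.simps)
     (intro term_intros witness_intros term_pred_filling_less)+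

lemma term_pred_witness: "term_pred (\<lambda>w u e. witness kf kg par w u)"
  unfolding witness_def certificate_def
  by (intro term_intros witness_intros term_pred_wellformed term_pred_good_inner
      term_pred_good_outer)

lemma decidable_witness: "poly_time_decidable {(w, u). witness kf kg par w u}"
  by (rule term_pred_decidable[OF term_pred_witness])

text \<open>A downward closed set of numbers below \<open>n\<close> is the initial segment given by
  its size. Hence the bits of an entry can be recovered from its value.\<close>

lemma down_closed_iff:
  fixes n :: nat
  assumes "\<And>a b. a < n \<Longrightarrow> Q a \<Longrightarrow> b < a \<Longrightarrow> Q b" "a < n"
  shows "Q a \<longleftrightarrow> a < (\<Sum>b<n. of_bool (Q b) :: nat)"
proof -
  have sum: "(\<Sum>b<n. of_bool (Q b)) = card {b. b < n \<and> Q b}"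
    by (simp add: of_bool_def sum.If_cases Int_def lessThan_def)
  show ?thesis
  proof
    assume "Q a"
    then have "Q b" if "b \<le> a" for b using that assms(1)[OF assms(2), of b] by (cases "b
        = a") simp_all
    then have "{..a} \<subseteq> {b. b < n \<and> Q b}" using assms(2) by auto
    then have "card {..a} \<le> card {b. b < n \<and> Q b}" by (intro card_mono) auto
    then show "a < (\<Sum>b<n. of_bool (Q b))" unfolding sum by simp
  next
    assume less: "a < (\<Sum>b<n. of_bool (Q b))"
    show "Q a"
    proof (rule ccontr)
      assume neg: "\<not> Q a"
      have "{b. b < n \<and> Q b} \<subseteq> {..<a}"
      proof
        fix b assume "b \<in> {b. b < n \<and> Q b}"
        then have b: "b < n" "Q b" by simp_all
        then have "\<not> a < b" "b \<noteq> a" using assms(1)[of b a] neg by blast+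
        then show "b \<in> {..<a}" by simp
      qed
      then have "card {b. b < n \<and> Q b} \<le> card {..<a}" by (intro card_mono) simp_all
      then have "card {b. b < n \<and> Q b} \<le> a" by simp
      then show False using less unfolding sum by simp
    qed
  qed
qed

section \<open>Witnesses as codes of two-level fillings\<close>

lemma digit: "(y :: nat) < W \<Longrightarrow> (x * W + y) mod W = y" "(y :: nat) < W \<Longrightarrow> (x * W + y) div W = x"
  by simp_all

lemma digit_less: "x < N \<Longrightarrow> y < W \<Longrightarrow> x * W + y < N * (W :: nat)"
proof -
  assume "x < N" "y < W"
  then have "x * W + y < Suc x * W" by simp
  also have "\<dots> \<le> N * W" using \<open>x < N\<close> by (intro mult_le_mono1) simp
  finally show ?thesis .
qed

text \<open>Inverts the layout of witnesses: a position in the first block is read as a number with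
  five digits in base \<open>W\<close>, one in the second block as a number with two.\<close>

definition encode_bits :: "nat \<Rightarrow> (nat \<Rightarrow> nat \<Rightarrow> nat \<Rightarrow> nat \<Rightarrow> nat \<Rightarrow> bool) \<Rightarrow> (nat \<Rightarrow> nat \<Rightarrow> bool) \<Rightarrow> bool
    list" where
  "encode_bits W f g = map (\<lambda>N. if N < W * W * W * W * W
     then f (N div W div W div W div W) (N div W div W div W mod W) (N div W div W mod W) (N div W
         mod W) (N mod W)
     else g ((N - W * W * W * W * W) div W) ((N - W * W * W * W * W) mod W)) [0..<W * W * W * W *
         W + W * W]"

lemma encode_bits:
  assumes "length w = W"
  shows "length (encode_bits W f g) = cell_size w + W * W"
    "r < W \<Longrightarrow> c < W \<Longrightarrow> p < W \<Longrightarrow> q < W \<Longrightarrow> a < W \<Longrightarrow> cell_bit w (encode_bits W f g) r c p q a = f r c p q a"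
    "i < W \<Longrightarrow> j < W \<Longrightarrow> pair_bit w (encode_bits W f g) i j = g i j"
proof -
  show "length (encode_bits W f g) = cell_size w + W * W" by (simp add: encode_bits_def
      cell_size_def assms)
  show "cell_bit w (encode_bits W f g) r c p q a = f r c p q a" if "r < W" "c < W" "p < W" "q < W"
      "a < W"
  proof -
    let ?N = "(((r * W + c) * W + p) * W + q) * W + a"
    have "?N < W * W * W * W * W" by (intro digit_less that)
    moreover have "?N mod W = a" "?N div W = ((r * W + c) * W + p) * W + q"
        using digit[OF that(5)] by blast+
    moreover have "(((r * W + c) * W + p) * W + q) mod W = q" "(((r * W + c) * W + p) * W
        + q) div W = (r * W + c) * W + p"
      using digit[OF that(4)] by blast+
    moreover have "((r * W + c) * W + p) mod W = p" "((r * W + c) * W + p) div W = r * W + c"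
        using digit[OF that(3)] by blast+
    moreover have "(r * W + c) mod W = c" "(r * W + c) div W = r" using digit[OF that(2)] by blast+
    ultimately show ?thesis unfolding cell_bit_def bit_at_def assms encode_bits_def by simp
  qed
  show "pair_bit w (encode_bits W f g) i j = g i j" if "i < W" "j < W"
  proof -
    have "i * W + j < W * W" by (intro digit_less that)
    moreover have "(i * W + j) mod W = j" "(i * W + j) div W = i" using digit[OF that(2)] by blast+
    ultimately show ?thesis unfolding pair_bit_def bit_at_def cell_size_def assms encode_bits_def
        by simp
  qed
qed

text \<open>Every position in the word is reached by some tuple of digits below
  \<open>W\<close>.\<close>

lemma bits_eqI:
  assumes "length w = W" "length u = cell_size w + W * W" "length v = cell_size w + W * W"
    and cell: "\<And>r c p q a. r < W \<Longrightarrow> c < W \<Longrightarrow> p < W \<Longrightarrow> q < W \<Longrightarrow> a < W \<Longrightarrow> cell_bit w u r c p q a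
        = cell_bit w v r c p q a"
    and pair: "\<And>i j. i < W \<Longrightarrow> j < W \<Longrightarrow> pair_bit w u i j = pair_bit w v i j"
  shows "u = v"
proof (rule nth_equalityI)
  show "length u = length v" using assms by simp
  fix N assume "N < length u"
  then have N: "N < cell_size w + W * W" using assms by simp
  have "bit_at u N = bit_at v N"
  proof (cases "N < cell_size w")
    case True
    have W: "0 < W" using True assms(1) by (auto simp: cell_size_def intro: Nat.gr0I)
    define a q p c r where "a = N mod W" "q = N div W mod W" "p = N div W div W mod W"
      "c = N div W div W div W mod W" "r = N div W div W div W div W"
    have "N div W < W * W * W * W" using True assms(1) by (intro less_mult_imp_div_less) (simp
        add: cell_size_def)
    then have "N div W div W < W * W * W" by (rule less_mult_imp_div_less)
    then have "N div W div W div W < W * W" by (rule less_mult_imp_div_less)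
    then have "r < W" unfolding a_q_p_c_r_def by (rule less_mult_imp_div_less)
    moreover have "a < W" "q < W" "p < W" "c < W" using W by (simp_all add: a_q_p_c_r_def)
    moreover have "N = (((r * W + c) * W + p) * W + q) * W + a"
      unfolding a_q_p_c_r_def by (simp only: div_mult_mod_eq)
    ultimately show ?thesis using cell[of r c p q a] unfolding cell_bit_def assms(1) by simp
  next
    case False
    define i j where "i = (N - cell_size w) div W" "j = (N - cell_size w) mod W"
    have N': "N - cell_size w < W * W" using N False by simp
    have W: "0 < W" using N' by (auto intro: Nat.gr0I)
    have "i < W" unfolding i_j_def using N' by (rule less_mult_imp_div_less)
    moreover have "j < W" using W by (simp add: i_j_def)
    moreover have "N = cell_size w + (i * W + j)"
      using False unfolding i_j_def by (simp only: div_mult_mod_eq)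
    ultimately show ?thesis using pair[of i j] unfolding pair_bit_def assms(1) by simp
  qed
  then show "u ! N = v ! N" using N assms by (simp add: bit_at_def)
qed

text \<open>Decoding a witness into its choice of pairs and its filling is inverse to
  \<open>enc\<close>. Entries are smaller than \<open>length la\<close>, hence than
  \<open>W\<close>, so \<open>W\<close> unary digits suffice for each.\<close>

lemma card_witness:
  assumes la: "is_partition la" and mu: "is_partition mu" and nu: "is_partition nu"
  defines "w \<equiv> unary_triple (la, mu, nu)"
  shows "card {u. witness kf kg par w u} =
    card (Sigma {S. S \<subseteq> pairs (length la) \<and> (\<exists>h. card S = h + h + par)} (two_level kf kg la mu nu))"
proof -
  define W where "W = length w"
  let ?n = "length la"
  note dec = decode_triple[OF la mu nu, folded w_def]
  note bnd = triple_bounds[where la = la and mu = mu and nu = nu, folded w_def, folded W_def]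
  have lenW: "length w = W" by (simp add: W_def)
  define shaped where "shaped = (\<lambda>T :: nat list list list list. map length T = mu \<and>
      (\<forall>x \<in> set (concat T). map length x = nu))"
  define cell where "cell = (\<lambda>r c p q. r < length mu \<and> c < mu ! r \<and> p < length nu \<and> q < nu ! p)"
  have cellW: "r < W" "c < W" "p < W" "q < W" if "cell r c p q" for r c p q
    using that bnd unfolding cell_def by (meson order_less_trans)+
  define enc where "enc = (\<lambda>(S, T). encode_bits W (\<lambda>r c p q a. cell r c p q
      \<and> a < T ! r ! c ! p ! q) (\<lambda>i j. (i, j) \<in> S))"
  define tabl where "tabl = (\<lambda>u. map (\<lambda>r. map (\<lambda>c. map (\<lambda>p. map
      (\<lambda>q. entry w u r c p q) [0..<nu ! p]) [0..<length nu]) [0..<mu ! r]) [0..<length mu])"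
  define pset where "pset = (\<lambda>u. {(i, j). i < ?n \<and> j < ?n \<and> pair_bit w u i j})"
  have tabl_shape: "shaped (tabl u)" for u
  proof -
    have "map length (tabl u) = mu" by (rule nth_equalityI) (simp_all add: tabl_def)
    moreover have "map length x = nu" if "x \<in> set (concat (tabl u))" for x
    proof -
      from that obtain r c where "x = map (\<lambda>p. map (\<lambda>q. entry w u r c p q) [0..<nu ! p])
          [0..<length nu]"
        unfolding tabl_def by auto
      then show ?thesis by (intro nth_equalityI) simp_all
    qed
    ultimately show ?thesis unfolding shaped_def by blast
  qed
  have tabl_nth: "tabl u ! r ! c ! p ! q = entry w u r c p q" if "cell r c p q" for u r c p q
    using that by (simp add: tabl_def cell_def)
  have cert: "certificate kf kg par (count1 w) (gap w) (count2 w) (part2 w) (count3 w) (part3 w)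
      (entry w u) (pair_bit w u)
      \<longleftrightarrow> T \<in> two_level kf kg la mu nu S \<and> (\<exists>h. card S = h + h + par)"
    if "shaped T" "S \<subseteq> pairs ?n" "\<And>r c p q. cell r c p q \<Longrightarrow> entry w u r c p q = T ! r ! c ! p ! q"
      "\<And>i j. i < ?n \<Longrightarrow> j < ?n \<Longrightarrow> pair_bit w u i j \<longleftrightarrow> (i, j) \<in> S" for u T S
    unfolding dec(1-3)
  proof (rule certificate_iff[OF mu nu])
    show "map length T = mu" "\<And>x. x \<in> set (concat T) \<Longrightarrow> map length x = nu"
      using that(1) unfolding shaped_def by blast+
    show "entry w u r c p q = T ! r ! c ! p ! q"
      if "r < length mu" "c < mu ! r" "p < length nu" "q < nu ! p" for r c p q
      using that \<open>\<And>r c p q. cell r c p q \<Longrightarrow> entry w u r c p q = T ! r ! c ! p ! q\<close>[of r c p q]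
          by (simp add: cell_def)
  qed (use dec(4-6) that in auto)
  have wf_iff: "wellformed w u \<longleftrightarrow> length u = cell_size w + W * W \<and>
     (\<forall>r<W. \<forall>c<W. \<forall>p<W. \<forall>q<W. \<forall>a<W. cell_bit w u r c p q a \<longrightarrow> cell r c p q \<and>
         (\<forall>b<a. cell_bit w u r c p q b)) \<and>
     (\<forall>i<W. \<forall>j<W. pair_bit w u i j \<longrightarrow> i < j \<and> j < ?n)" for u
  proof -
    have "r < length mu \<and> c < part2 w r \<and> p < length nu \<and> q < part3 w p \<longleftrightarrow> cell r c p q" for r c p q
      unfolding cell_def using dec(5)[of r] dec(6)[of p] by auto
    then have "r < length mu \<and> c < part2 w r \<and> p < length nu \<and> q < part3 w p \<and> Z \<longleftrightarrow> cell r c p q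
        \<and> Z" for r c p q Z
      by blast
    then show ?thesis unfolding wellformed_def dec(1-3) lenW by (simp only:)
  qed
  have "bij_betw (\<lambda>u. (pset u, tabl u)) {u. witness kf kg par w u}
      (Sigma {S. S \<subseteq> pairs ?n \<and> (\<exists>h. card S = h + h + par)} (two_level kf kg la mu nu))"
  proof (rule bij_betwI[where g = enc])
    show "(\<lambda>u. (pset u, tabl u)) \<in> {u. witness kf kg par w u} \<rightarrow>
        Sigma {S. S \<subseteq> pairs ?n \<and> (\<exists>h. card S = h + h + par)} (two_level kf kg la mu nu)"
    proof
      fix u assume "u \<in> {u. witness kf kg par w u}"
      then have u: "wellformed w u"
        "certificate kf kg par (count1 w) (gap w) (count2 w) (part2 w) (count3 w) (part3 w) (entry
            w u) (pair_bit w u)"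
        by (simp_all add: witness_def)
      have S: "pset u \<subseteq> pairs ?n"
      proof
        fix x assume "x \<in> pset u"
        then obtain i j where x: "x = (i, j)" "i < ?n" "j < ?n" "pair_bit w u i j"
            by (auto simp: pset_def)
        then have "i < W" "j < W" using bnd(1) by simp_all
        then have "i < j \<and> j < ?n" using u(1) x(4) unfolding wf_iff by blast
        then show "x \<in> pairs ?n" by (simp add: x pairs_def)
      qed
      have "tabl u \<in> two_level kf kg la mu nu (pset u) \<and> (\<exists>h. card (pset u) = h + h + par)"
        using u(2) cert[of "tabl u" "pset u" u, OF tabl_shape S] tabl_nth by (simp add: pset_def)
      then show "(pset u, tabl u) \<in> Sigma {S. S \<subseteq> pairs ?n \<and> (\<exists>h. card S = h + h
          + par)} (two_level kf kg la mu nu)"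
        using S by simp
    qed
    have enc: "witness kf kg par w (enc (S, T))" "pset (enc (S, T)) = S" "tabl (enc (S, T)) = T"
      if S: "S \<subseteq> pairs ?n" "\<exists>h. card S = h + h + par" and T: "T \<in> two_level kf kg la mu nu S"
          for S T
    proof -
      let ?u = "enc (S, T)"
      have Tin: "tab kf mu T" "\<And>x. x \<in> set (concat T) \<Longrightarrow> tab kg nu x" "\<And>x. x \<in> set (concat T)
          \<Longrightarrow> set (concat x) \<subseteq> {..<?n}"
        using T by (auto simp: two_level_def inner_fillings_def)
      have sh: "shaped T" using Tin unfolding shaped_def tab_def by blast
      have Tlen: "map length T = mu" "\<And>x. x \<in> set (concat T) \<Longrightarrow> map length x = nu"
        using sh unfolding shaped_def by blast+
      have small: "T ! r ! c ! p ! q < ?n" if "cell r c p q" for r c p q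
      proof -
        have rc: "r < length mu" "c < mu ! r" and pq: "p < length nu" "q < nu ! p" using that
            by (simp_all add: cell_def)
        have x: "map length (T ! r ! c) = nu"
          using all_cells[OF Tlen(1), of "\<lambda>x. map length x = nu"] Tlen(2) rc by blast
        have "\<forall>x \<in> set (concat T). \<forall>a \<in> set (concat x). a < ?n" using Tin(3) by blast
        then have "\<forall>a \<in> set (concat (T ! r ! c)). a < ?n"
          unfolding all_cells[OF Tlen(1), of "\<lambda>x. \<forall>a \<in> set (concat x). a < ?n"] using rc by blast
        then show ?thesis unfolding all_cells[OF x, of "\<lambda>a. a < ?n"] using pq by blast
      qed
      have cb: "cell_bit w ?u r c p q a \<longleftrightarrow> cell r c p q \<and> a < T ! r ! c ! p ! q"
        if "r < W" "c < W" "p < W" "q < W" "a < W" for r c p q a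
        unfolding enc_def using encode_bits(2)[OF lenW that] by simp
      have pb: "pair_bit w ?u i j \<longleftrightarrow> (i, j) \<in> S" if "i < W" "j < W" for i j
        unfolding enc_def using encode_bits(3)[OF lenW that] by simp
      have ent: "entry w ?u r c p q = T ! r ! c ! p ! q" if "cell r c p q" for r c p q
      proof -
        have "entry w ?u r c p q = (\<Sum>a<W. of_bool (a < T ! r ! c ! p ! q))"
          unfolding entry_def lenW using cb[OF cellW[OF that]] that by (intro sum.cong) auto
        also have "\<dots> = card ({..<W} \<inter> {..<T ! r ! c ! p ! q})"
          by (simp add: of_bool_def sum.If_cases lessThan_def)
        also have "{..<W} \<inter> {..<T ! r ! c ! p ! q} = {..<T ! r ! c ! p ! q}"
          using small[OF that] bnd(1) by auto
        finally show ?thesis by simp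
      qed
      have nW: "i < W" if "i < ?n" for i using that bnd(1) by simp
      have "wellformed w ?u"
        unfolding wf_iff
      proof (intro conjI allI impI)
        show "length ?u = cell_size w + W * W" unfolding enc_def using encode_bits(1)[OF lenW]
            by simp
        fix r c p q a assume *: "r < W" "c < W" "p < W" "q < W" "a < W" "cell_bit w ?u r c p q a"
        then show "cell r c p q" using cb[OF *(1-5)] by blast
        fix b assume b: "b < a"
        then have "b < W" using *(5) by simp
        then show "cell_bit w ?u r c p q b" using cb[OF *(1-5)] cb[OF *(1-4), of b] *(6) b by simp
      next
        fix i j assume *: "i < W" "j < W" "pair_bit w ?u i j"
        then have "(i, j) \<in> pairs ?n" using pb[OF *(1,2)] S(1) by blast
        then show "i < j" "j < ?n" by (simp_all add: pairs_def)
      qed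
      moreover have "certificate kf kg par (count1 w) (gap w) (count2 w) (part2 w) (count3 w)
          (part3 w) (entry w ?u) (pair_bit w ?u)"
        using cert[of T S ?u, OF sh S(1) ent] pb nW T S(2) by blast
      ultimately show "witness kf kg par w ?u" by (simp add: witness_def)
      show "pset ?u = S"
      proof (intro equalityI subsetI)
        fix x assume "x \<in> pset ?u"
        then obtain i j where "x = (i, j)" "i < ?n" "j < ?n" "pair_bit w ?u i j"
            by (auto simp: pset_def)
        then show "x \<in> S" using pb nW by blast
      next
        fix x assume x: "x \<in> S"
        then obtain i j where ij: "x = (i, j)" "i < j" "j < ?n" using S(1) by (auto simp: pairs_def)
        then show "x \<in> pset ?u" using x pb[of i j] nW by (simp add: pset_def)
      qed
      show "tabl ?u = T"
      proof (rule nth_equalityI)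
        have lT: "length T = length mu" "\<And>r. r < length mu \<Longrightarrow> length (T ! r) = mu ! r"
            using Tlen(1) by auto
        show "length (tabl ?u) = length T" by (simp add: tabl_def lT)
        fix r assume "r < length (tabl ?u)"
        then have r: "r < length mu" by (simp add: tabl_def)
        show "tabl ?u ! r = T ! r"
        proof (rule nth_equalityI)
          show "length (tabl ?u ! r) = length (T ! r)" using r lT by (simp add: tabl_def)
          fix c assume "c < length (tabl ?u ! r)"
          then have c: "c < mu ! r" using r by (simp add: tabl_def)
          have x: "map length (T ! r ! c) = nu"
            using all_cells[OF Tlen(1), of "\<lambda>x. map length x = nu"] Tlen(2) r c by blast
          have lx: "length (T ! r ! c) = length nu" "\<And>p. p < length nu \<Longrightarrow> length (T ! r ! c ! p)
              = nu ! p"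
            using x by auto
          show "tabl ?u ! r ! c = T ! r ! c"
          proof (rule nth_equalityI)
            show "length (tabl ?u ! r ! c) = length (T ! r ! c)" using r c lx
                by (simp add: tabl_def)
            fix p assume "p < length (tabl ?u ! r ! c)"
            then have p: "p < length nu" using r c by (simp add: tabl_def)
            show "tabl ?u ! r ! c ! p = T ! r ! c ! p"
            proof (rule nth_equalityI)
              show "length (tabl ?u ! r ! c ! p) = length (T ! r ! c ! p)" using r c p lx
                  by (simp add: tabl_def)
              fix q assume "q < length (tabl ?u ! r ! c ! p)"
              then have "cell r c p q" using r c p by (simp add: tabl_def cell_def)
              then show "tabl ?u ! r ! c ! p ! q = T ! r ! c ! p ! q" using tabl_nth ent by simp
            qed
          qed
        qed
      qed
    qed
    show "enc \<in> Sigma {S. S \<subseteq> pairs ?n \<and> (\<exists>h. card S = h + h + par)} (two_level kf kg la mu nu) \<rightarrow>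
        {u. witness kf kg par w u}"
      using enc(1) by auto
    show "(pset (enc y), tabl (enc y)) = y"
      if "y \<in> Sigma {S. S \<subseteq> pairs ?n \<and> (\<exists>h. card S = h + h + par)} (two_level kf kg la mu nu)" for y
    proof -
      obtain S T where y: "y = (S, T)" by force
      then have "S \<subseteq> pairs ?n" "\<exists>h. card S = h + h + par" "T \<in> two_level kf kg la mu nu S"
        using that by simp_all
      then show ?thesis unfolding y by (simp only: enc(2,3))
    qed
    fix u assume "u \<in> {u. witness kf kg par w u}"
    then have u: "wellformed w u" by (simp add: witness_def)
    show "enc (pset u, tabl u) = u"
    proof (rule bits_eqI[OF lenW])
      show "length (enc (pset u, tabl u)) = cell_size w + W * W"
        unfolding enc_def using encode_bits(1)[OF lenW] by simp
      show "length u = cell_size w + W * W" using u unfolding wf_iff by blast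
      fix r c p q a assume *: "r < W" "c < W" "p < W" "q < W" "a < W"
      \<comment> \<open>As the digits are downward closed, writing the decoded entry back restores
        them.\<close>
      have down: "cell_bit w u r c p q a \<longleftrightarrow> a < entry w u r c p q"
        unfolding entry_def lenW
      proof (rule down_closed_iff[where Q = "cell_bit w u r c p q"])
        fix a b assume "a < W" "cell_bit w u r c p q a" "b < a"
        then show "cell_bit w u r c p q b" using u *(1-4) unfolding wf_iff by blast
      qed (fact *(5))
      have "cell_bit w (enc (pset u, tabl u)) r c p q a \<longleftrightarrow> cell r c p q \<and> a < tabl u ! r ! c ! p ! q"
        unfolding enc_def using encode_bits(2)[OF lenW *] by simp
      also have "\<dots> \<longleftrightarrow> cell r c p q \<and> a < entry w u r c p q" using tabl_nth[of r c p q u] by auto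
      also have "\<dots> \<longleftrightarrow> cell_bit w u r c p q a" using down u * unfolding wf_iff by blast
      finally show "cell_bit w (enc (pset u, tabl u)) r c p q a = cell_bit w u r c p q a" .
    next
      fix i j assume *: "i < W" "j < W"
      have "pair_bit w (enc (pset u, tabl u)) i j \<longleftrightarrow> (i, j) \<in> pset u"
        unfolding enc_def using encode_bits(3)[OF lenW *] by simp
      also have "\<dots> \<longleftrightarrow> pair_bit w u i j"
      proof -
        have "pair_bit w u i j \<Longrightarrow> i < j \<and> j < ?n" using u * unfolding wf_iff by blast
        then show ?thesis by (auto simp: pset_def)
      qed
      finally show "pair_bit w (enc (pset u, tabl u)) i j = pair_bit w u i j" .
    qed
  qed
  then show ?thesis by (rule bij_betw_same_card)
qed

text \<open>The fifth power comes from the bits of the entries, the square from those of the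
  pairs.\<close>

lemma witness_length: "witness kf kg par w u \<Longrightarrow> length u \<le> poly ([:0, 1:] ^ 5
    + [:0, 1:] ^ 2) (length w)"
  by (simp add: witness_def wellformed_def cell_size_def poly_power power_numeral_reduce
      algebra_simps)

definition witness_count :: "kind \<Rightarrow> kind \<Rightarrow> nat \<Rightarrow> bool list \<Rightarrow> nat" where
  "witness_count kf kg par w = card {u. witness kf kg par w u}"

lemma witness_count_sharpP: "witness_count kf kg par \<in> sharpP"
proof -
  have "\<forall>(w, u) \<in> {(w, u). witness kf kg par w u}. length u \<le> poly ([:0, 1:] ^ 5
      + [:0, 1:] ^ 2) (length w)"
    using witness_length by blast
  moreover have "\<forall>w. witness_count kf kg par w = card {u. (w, u) \<in> {(w, u). witness kf kg par w u}}"
    by (simp add: witness_count_def)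
  ultimately show ?thesis
    unfolding sharpP_def using decidable_witness by blast
qed

section \<open>From counts of witnesses to plethysm coefficients\<close>

lemma finite_inner_fillings: "finite (inner_fillings kg nu n)"
  by (rule finite_subset[OF _ finite_fillings[of "{..<n}" nu]]) (auto simp: inner_fillings_def
      tab_def)

lemma finite_two_level: "finite (two_level kf kg la mu nu S)"
  by (rule finite_subset[OF _ finite_fillings[OF finite_inner_fillings[of kg nu
      "length la"], of mu]])
     (auto simp: two_level_def tab_def)

text \<open>On the first \<open>n\<close> variables the monomials of the inner function are the
  contents of fillings with letters below \<open>n\<close>. These form a finite set, which in its
  lexicographic order provides the variables of the outer function.\<close>

lemma plethysm_two_level:
  assumes "is_partition mu" "is_partition nu" "set_mset A \<subseteq> {..<n}"
  shows "plethysm (basis kf mu) (basis kg nu) A =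
    int (card {T. tab kf mu T \<and> set (concat T) \<subseteq> inner_fillings kg nu n \<and>
        (\<Sum>x \<in># mset (concat T). mset (concat x)) = A})"
proof (rule plethysm_count[OF assms(1) finite_inner_fillings, where B = "{..<n}"])
  fix \<tau> :: "nat multiset" assume \<tau>: "set_mset \<tau> \<subseteq> {..<n}"
  have "{x :: nat list list. tab kg nu x \<and> mset (concat x) = \<tau>}
      = {x \<in> inner_fillings kg nu n. mset (concat x) = \<tau>}"
    using \<tau> unfolding inner_fillings_def by (auto simp flip: set_mset_mset)
  then show "basis kg nu \<tau> = int (card {x \<in> inner_fillings kg nu n. mset (concat x) = \<tau>})"
    using basis_count[OF assms(2), of kg \<tau>] by simp
next
  fix x assume "x \<in> inner_fillings kg nu n"
  then show "set_mset (mset (concat x)) \<subseteq> {..<n}" by (simp add: inner_fillings_def)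
qed (fact assms(3))

text \<open>A two-level filling has just one content, so the sets counted for the admissible
  monomials \<open>A\<close> are disjoint, and their union is \<open>two_level\<close>.\<close>

lemma schur_extract_plethysm:
  assumes "is_partition mu" "is_partition nu"
  shows "schur_extract la (plethysm (basis kf mu) (basis kg nu)) =
    (\<Sum>S \<in> Pow (pairs (length la)). (-1) ^ card S * int (card (two_level kf kg la mu nu S)))"
  unfolding schur_extract_def
proof (rule sum.cong[OF refl])
  fix S assume "S \<in> Pow (pairs (length la))"
  let ?n = "length la" and ?wt = "\<lambda>T :: nat list list list list. \<Sum>x \<in># mset (concat T). mset
      (concat x)"
  let ?I = "{A. A + choice_mset ?n S = shifted_mset la}"
  define \<T> where "\<T> = {T. tab kf mu T \<and> set (concat T) \<subseteq> inner_fillings kg nu ?n}"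
  have fin: "finite \<T>"
    by (rule finite_subset[OF _ finite_fillings[OF finite_inner_fillings[of kg nu ?n], of mu]])
       (auto simp: \<T>_def tab_def)
  have "(\<Sum>A \<in> ?I. plethysm (basis kf mu) (basis kg nu) A) = (\<Sum>A \<in> ?I. int (card {T \<in> \<T>. ?wt T
      = A}))"
  proof (rule sum.cong[OF refl])
    fix A assume "A \<in> ?I"
    then have "set_mset A \<subseteq> {..<?n}" using set_shifted_mset by blast
    then show "plethysm (basis kf mu) (basis kg nu) A = int (card {T \<in> \<T>. ?wt T = A})"
      using plethysm_two_level[OF assms] by (simp add: \<T>_def conj_assoc)
  qed
  also have "\<dots> = int (card (\<Union>A \<in> ?I. {T \<in> \<T>. ?wt T = A}))"
    by (subst card_UN_disjoint) (auto simp: fin)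
  also have "(\<Union>A \<in> ?I. {T \<in> \<T>. ?wt T = A}) = two_level kf kg la mu nu S"
    unfolding \<T>_def two_level_def by blast
  finally show "(-1) ^ card S * (\<Sum>A \<in> ?I. plethysm (basis kf mu) (basis kg nu) A) =
      (-1) ^ card S * int (card (two_level kf kg la mu nu S))" by simp
qed

text \<open>The sign of a choice \<open>S\<close> is given by the parity of \<open>card S\<close>,
  which \<open>par\<close> prescribes.\<close>

lemma witness_count_difference:
  assumes la: "is_partition la" and mu: "is_partition mu" and nu: "is_partition nu"
  shows "int (witness_count kf kg 0 (unary_triple (la, mu, nu))) - int (witness_count kf kg 1
      (unary_triple (la, mu, nu))) =
    schur_extract la (plethysm (basis kf mu) (basis kg nu))"
proof -
  let ?P = "Pow (pairs (length la))"
  let ?Q = "\<lambda>par. {S. S \<subseteq> pairs (length la) \<and> (\<exists>h. card S = h + h + par)}"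
  have ev: "(\<exists>h. n = h + h + 0) \<longleftrightarrow> even n" "(\<exists>h. n = h + h + 1) \<longleftrightarrow> odd n" for n :: nat
    by presburger+
  have eo: "?Q 0 = {S \<in> ?P. even (card S)}" "?Q 1 = {S \<in> ?P. odd (card S)}"
    unfolding ev by auto
  have card: "int (witness_count kf kg par (unary_triple (la, mu, nu))) =
      (\<Sum>S \<in> ?Q par. int (card (two_level kf kg la mu nu S)))" for par
  proof -
    have "finite (?Q par)" by (rule finite_subset[of _ ?P]) auto
    then show ?thesis
      unfolding witness_count_def card_witness[OF assms] by (subst card_SigmaI) (auto simp:
          finite_two_level)
  qed
  have "schur_extract la (plethysm (basis kf mu) (basis kg nu)) =
      (\<Sum>S \<in> ?P. if even (card S) then int (card (two_level kf kg la mu nu S)) else - int (card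
          (two_level kf kg la mu nu S)))"
    unfolding schur_extract_plethysm[OF mu nu] by (rule sum.cong) auto
  also have "\<dots> = (\<Sum>S \<in> {S \<in> ?P. even (card S)}. int (card (two_level kf kg la mu nu S))) -
      (\<Sum>S \<in> {S \<in> ?P. odd (card S)}. int (card (two_level kf kg la mu nu S)))"
    by (subst sum.If_cases) (auto simp: sum_negf Int_def)
  finally show ?thesis unfolding card eo by simp
qed

theorem plethysm_coeff_basis:
  assumes "is_partition la" "is_partition mu" "is_partition nu"
  shows "plethysm_coeff (basis kf) (basis kg) la mu nu = schur_extract la (plethysm (basis kf mu)
      (basis kg nu))"
  unfolding plethysm_coeff_def
  by (rule the_schur_expansion[OF symmetric_plethysm[OF symmetric_basis symmetric_basis]
        degree_only_plethysm[OF degree_only_basis degree_only_basis]]) (use assms in auto)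

lemma basis_cases:
  assumes "f \<in> {schur, monomial, power_sum, elementary, homogeneous}"
  obtains k where "f = basis k"
  using assms basis.simps by (metis empty_iff insert_iff)

theorem theorem1p5:
  fixes f g :: "nat list \<Rightarrow> series"
  assumes "f \<in> {schur, monomial, power_sum, elementary, homogeneous}"
    and "g \<in> {schur, monomial, power_sum, elementary, homogeneous}"
  shows "in_GapP_on unary_triple
           {(la, mu, nu). is_partition la \<and> is_partition mu \<and> is_partition nu}
           (\<lambda>(la, mu, nu). plethysm_coeff f g la mu nu)"
proof -
  obtain kf kg where k: "f = basis kf" "g = basis kg"
    using assms by (elim basis_cases)
  define F where "F = (\<lambda>w. int (witness_count kf kg 0 w) - int (witness_count kf kg 1 w))"
  have "F \<in> GapP"
    unfolding GapP_def F_def using witness_count_sharpP by blast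
  moreover have "F (unary_triple (la, mu, nu)) = plethysm_coeff f g la mu nu"
    if "is_partition la" "is_partition mu" "is_partition nu" for la mu nu
    unfolding F_def k plethysm_coeff_basis[OF that] by (rule witness_count_difference[OF that])
  ultimately show ?thesis
    unfolding in_GapP_on_def by (intro bexI[of _ F]) auto
qed

end
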